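(* Let $\mathbf U_{\sqrt q}$ be the specialization at $\sqrt q$ of the quantum algebra of type $\mathbf D_{m+2}$, let $\mathcal I_D\subseteq \mathbf U_{\sqrt q}$ be the two-sided ideal of all elements acting by zero on $L(\lambda)$ for every $\lambda\in\mathbb N[I]$ of the form $\lambda=d j_m-C\nu$ with $\nu\in\mathbb N[I]$, and let $\mathscr C=\mathscr C(X\times X)$ be the convolution algebra generated by the functions $E_a,F_a,K_a^{\pm1}$ ($a\in I$) on $X\times X$, where $X$ is the set of ramified flags in a $d$-dimensional $\mathbb F_q$-vector space $D$ (all defined in the context). Let $\Psi:\mathbf U_{\sqrt q}/\mathcal I_D\to\mathscr C$ be the algebra homomorphism sending the class of each generator $E_a,F_a,K_a^{\pm1}$ of $\mathbf U_{\sqrt q}$ to the function with the same name. Then $\Psi$ is an isomorphism of algebras.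
   Context: $\mathbb N=\{0,1,2,\dots\}$. Fix an integer $m\ge 1$. Let $I=\{i,k,j_1,\dots,j_m\}$ be the vertex set of the Dynkin graph of type $\mathbf D_{m+2}$ whose edges are $i-j_1$, $k-j_1$, and $j_\beta-j_{\beta+1}$ for $1\le\beta\le m-1$. Let $C=(c_{ab})_{a,b\in I}$ be its Cartan matrix ($c_{aa}=2$, $c_{ab}=-1$ if $a\neq b$ are joined by an edge, $c_{ab}=0$ otherwise). For $\nu=\sum_a\nu_a a\in\mathbb Z[I]$, $C\nu\in\mathbb Z[I]$ has $a$-th component $\sum_b c_{ab}\nu_b$. **Flags.** Let $\mathbb F_q$ be a finite field with $q$ elements, $\sqrt q$ the square root of $q$, and $D$ a fixed $\mathbb F_q$-vector space of dimension $d$. $X$ is the set of all ramified flags $U=(V_{j_m},\dots,V_{j_1},U_i,U_k,U_{j_1},\dots,U_{j_m})$ of subspaces of $D$ with $$0\subseteq V_{j_m}\subseteq\cdots\subseteq V_{j_1}\subseteq U_i,U_k\subseteq U_{j_1}\subseteq\cdots\subseteq U_{j_m}\subseteq D$$ (both $U_i$ and $U_k$ lie between $V_{j_1}$ and $U_{j_1}$, with no relation imposed between $U_i$ and $U_k$). Convention: $U_{j_{m+1}}=D$, $V_{j_{m+1}}=0$. Write $|V|=\dim V$. For $\nu\in\mathbb N[I]$, $X_\nu\subseteq X$ is the set of $U$ with $|U_i|=\nu_i$, $|U_k|=\nu_k$, $|U_{j_\beta}|+|V_{j_\beta}|=\nu_{j_\beta}$ for $1\le\beta\le m$. **Convolution.**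 $\mathscr C'(X\times X)$ is the space of all functions $X\times X\to\mathbb C$, an associative unital algebra under $f_1\circ f_2(U,\tilde U)=\sum_{U'\in X}f_1(U,U')f_2(U',\tilde U)$, with unit the characteristic function of the diagonal. **Notation for pairs.** For $a\in\{i,k\}$, $U\overset{a}{\subset}\tilde U$ means $U_a\subset\tilde U_a$ with $|U_a|+1=|\tilde U_a|$ and all other subspaces of $U$ and $\tilde U$ coincide. For $a=j_\beta$, "$U\overset{j_\beta}{\subset}\tilde U,\ V_{j_\beta}\overset1\subset\tilde V_{j_\beta}$" means $V_{j_\beta}\subset\tilde V_{j_\beta}$ has codimension 1 and all other subspaces coincide; "$U\overset{j_\beta}{\subset}\tilde U,\ U_{j_\beta}\overset1\subset\tilde U_{j_\beta}$" means $U_{j_\beta}\subset\tilde U_{j_\beta}$ has codimension 1 and all other subspaces coincide. $\supset$ means the reversed relation (roles of $U,\tilde U$ exchanged). **Generating functions** (values are zero in cases not listed). For $a\in\{i,k\}$: $E_a(U,\tilde U)=\sqrt q^{-(|\tilde U_{j_1}|-|\tilde U_a|)}$ if $U\overset a\subset\tilde U$; $F_a(U,\tilde U)=\sqrt q^{-(|\tilde U_a|-|\tilde V_{j_1}|)}$ if $U\overset a\supset\tilde U$. $E_{j_1}(U,\tilde U)=\sqrt q^{-(|\tilde U_i|+|\tilde U_k|-|\tilde V_{j_1}|-|\tilde V_{j_2}|)}$ if $U\overset{j_1}\subset\tilde U,\ V_{j_1}\overset1\subset\tilde V_{j_1}$; $=\sqrt q^{-(|\tilde U_{j_2}|+2|\tilde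 V_{j_1}|-|\tilde U_{j_1}|)}$ if $U\overset{j_1}\subset\tilde U,\ U_{j_1}\overset1\subset\tilde U_{j_1}$. $F_{j_1}(U,\tilde U)=\sqrt q^{-(|\tilde U_{j_2}|-2|\tilde U_{j_1}|+|\tilde V_{j_1}|)}$ if $U\overset{j_1}\supset\tilde U,\ V_{j_1}\overset1\supset\tilde V_{j_1}$; $=\sqrt q^{-(|\tilde U_{j_1}|-|\tilde U_i|-|\tilde U_k|-|\tilde V_{j_2}|)}$ if $U\overset{j_1}\supset\tilde U,\ U_{j_1}\overset1\supset\tilde U_{j_1}$. For $2\le\beta\le m$: $E_{j_\beta}(U,\tilde U)=\sqrt q^{-(|\tilde U_{j_{\beta-1}}|-|\tilde V_{j_\beta}|-|\tilde V_{j_{\beta+1}}|)}$ if $U\overset{j_\beta}\subset\tilde U,\ V_{j_\beta}\overset1\subset\tilde V_{j_\beta}$; $=\sqrt q^{-(|\tilde U_{j_{\beta+1}}|+2|\tilde V_{j_\beta}|-|\tilde U_{j_\beta}|-|\tilde V_{j_{\beta-1}}|)}$ if $U\overset{j_\beta}\subset\tilde U,\ U_{j_\beta}\overset1\subset\tilde U_{j_\beta}$. For $2\le\beta\le m$: $F_{j_\beta}(U,\tilde U)=\sqrt q^{-(|\tilde U_{j_{\beta+1}}|-2|\tilde U_{j_\beta}|+|\tilde V_{j_\beta}|+|\tilde V_{j_{\beta-1}}|)}$ if $U\overset{j_\beta}\supset\tilde U,\ V_{j_\beta}\overset1\supset\tilde V_{j_\beta}$; $=\sqrt q^{-(-|\tilde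 V_{j_{\beta+1}}|+|\tilde U_{j_\beta}|-|\tilde U_{j_{\beta-1}}|)}$ if $U\overset{j_\beta}\supset\tilde U,\ U_{j_\beta}\overset1\supset\tilde U_{j_\beta}$. $K_a^{\pm1}(U,\tilde U)=0$ if $U\ne\tilde U$, and $K_a^{\pm1}(U,U)=\sqrt q^{\pm\kappa_a(U)}$ with $\kappa_a(U)=|U_{j_1}|+|V_{j_1}|-2|U_a|$ for $a\in\{i,k\}$; $\kappa_{j_1}(U)=|U_{j_2}|+|V_{j_2}|+|U_i|+|U_k|-2|U_{j_1}|-2|V_{j_1}|$; $\kappa_{j_\beta}(U)=|U_{j_{\beta+1}}|+|V_{j_{\beta+1}}|+|U_{j_{\beta-1}}|+|V_{j_{\beta-1}}|-2|U_{j_\beta}|-2|V_{j_\beta}|$ for $2\le\beta\le m$. $\mathscr C=\mathscr C(X\times X)$ is the subalgebra of $\mathscr C'(X\times X)$ generated by all $E_a,F_a,K_a^{\pm1}$, $a\in I$. **Quantum algebra.** $\mathbf U_{\sqrt q}$ is the associative unital $\mathbb C$-algebra generated by $E_a,F_a,K_a^{\pm1}$ ($a\in I$) with relations $K_aK_a^{-1}=1$, $K_aK_b=K_bK_a$, $K_aE_b=\sqrt q^{c_{ab}}E_bK_a$, $K_aF_b=\sqrt q^{-c_{ab}}F_bK_a$, $E_aF_b-F_bE_a=\delta_{ab}\frac{K_a-K_a^{-1}}{\sqrt q-\sqrt q^{-1}}$; if $c_{ab}=-1$: $E_a^2E_b-(\sqrt q+\sqrt q^{-1})E_aE_bE_a+E_bE_a^2=0$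 and the same with $F$ in place of $E$; if $c_{ab}=0$: $E_aE_b=E_bE_a$, $F_aF_b=F_bF_a$. For $\lambda=\sum_a\lambda_a a\in\mathbb N[I]$, $L(\lambda)$ is the simple highest-weight $\mathbf U_{\sqrt q}$-module generated by a vector $\xi_\lambda$ with $K_a\xi_\lambda=\sqrt q^{\lambda_a}\xi_\lambda$, $E_a\xi_\lambda=0$ for all $a\in I$. It is known that $E_a\mapsto E_a$, $F_a\mapsto F_a$, $K_a^{\pm1}\mapsto K_a^{\pm1}$ defines a surjective algebra homomorphism $\Phi:\mathbf U_{\sqrt q}\to\mathscr C$, and that $\mathcal I_D\subseteq\ker\Phi$; $\Psi$ is the induced map. The quotient $\mathbf U_{\sqrt q}/\mathcal I_D$ is the generalized $q$-Schur algebra attached to the finite saturated set of dominant weights $\pi=\{\lambda\in\mathbb N[I]\mid\lambda=dj_m-C\nu,\ \nu\in\mathbb N[I]\}$. *)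

theory Defs
  imports
    "HOL-Algebra.QuotRing"
    "HOL-Algebra.Module"
    "HOL-Algebra.Subrings"
    "HOL-Library.Poly_Mapping"
    "HOL-Library.Cardinality"
begin

section \<open>Complex algebras as records\<close>

text \<open>
  A unital associative algebra over the complex numbers is represented by a
  \<^typ>\<open>(complex, 'a) module\<close> record: the ring structure together with the scalar action.
\<close>

definition alg_hom :: "(complex, 'a) module \<Rightarrow> (complex, 'b) module \<Rightarrow> ('a \<Rightarrow> 'b) set" where
  "alg_hom A B = {h \<in> ring_hom A B. \<forall>c. \<forall>x \<in> carrier A. h (c \<odot>\<^bsub>A\<^esub> x) = c \<odot>\<^bsub>B\<^esub> h x}"

definition alg_iso :: "(complex, 'a) module \<Rightarrow> (complex, 'b) module \<Rightarrow> ('a \<Rightarrow> 'b) set" where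
  "alg_iso A B = {h \<in> alg_hom A B. bij_betw h (carrier A) (carrier B)}"

definition quot_alg :: "(complex, 'a) module \<Rightarrow> 'a set \<Rightarrow> (complex, 'a set) module" where
  "quot_alg A I = ring.extend (A Quot I)
     (module.fields (\<lambda>c X. \<Union>x\<in>X. I +>\<^bsub>A\<^esub> (c \<odot>\<^bsub>A\<^esub> x)))"

definition generated_subalg :: "(complex, 'a) module \<Rightarrow> 'a set \<Rightarrow> (complex, 'a) module" where
  "generated_subalg A S = A\<lparr>carrier :=
     \<Inter>{B. subring B A \<and> (\<forall>c. \<forall>x \<in> B. c \<odot>\<^bsub>A\<^esub> x \<in> B) \<and> S \<subseteq> B}\<rparr>"


section \<open>Modules over a non-commutative ring\<close>

text \<open>
  The axioms of \<^locale>\<open>module\<close>, with the base ring not required to be commutative.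
  Over a complex algebra, the complex scalars act through the multiples of the unit.
\<close>

locale left_module = R?: ring R + M?: abelian_group M
  for R :: "('a, 'c) ring_scheme" (structure) and M :: "('a, 'b) module" (structure) +
  assumes smult_closed: "\<lbrakk>a \<in> carrier R; x \<in> carrier M\<rbrakk> \<Longrightarrow> a \<odot>\<^bsub>M\<^esub> x \<in> carrier M"
    and smult_l_distr: "\<lbrakk>a \<in> carrier R; b \<in> carrier R; x \<in> carrier M\<rbrakk> \<Longrightarrow>
      (a \<oplus>\<^bsub>R\<^esub> b) \<odot>\<^bsub>M\<^esub> x = a \<odot>\<^bsub>M\<^esub> x \<oplus>\<^bsub>M\<^esub> b \<odot>\<^bsub>M\<^esub> x"
    and smult_r_distr: "\<lbrakk>a \<in> carrier R; x \<in> carrier M; y \<in> carrier M\<rbrakk> \<Longrightarrow>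
      a \<odot>\<^bsub>M\<^esub> (x \<oplus>\<^bsub>M\<^esub> y) = a \<odot>\<^bsub>M\<^esub> x \<oplus>\<^bsub>M\<^esub> a \<odot>\<^bsub>M\<^esub> y"
    and smult_assoc: "\<lbrakk>a \<in> carrier R; b \<in> carrier R; x \<in> carrier M\<rbrakk> \<Longrightarrow>
      (a \<otimes>\<^bsub>R\<^esub> b) \<odot>\<^bsub>M\<^esub> x = a \<odot>\<^bsub>M\<^esub> (b \<odot>\<^bsub>M\<^esub> x)"
    and smult_one: "x \<in> carrier M \<Longrightarrow> \<one>\<^bsub>R\<^esub> \<odot>\<^bsub>M\<^esub> x = x"

definition simple_module :: "('a, 'c) ring_scheme \<Rightarrow> ('a, 'b) module \<Rightarrow> bool" where
  "simple_module R M \<longleftrightarrow> left_module R M \<and> carrier M \<noteq> {\<zero>\<^bsub>M\<^esub>} \<and>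
     (\<forall>N. submodule N R M \<longrightarrow> N = {\<zero>\<^bsub>M\<^esub>} \<or> N = carrier M)"


section \<open>The free complex algebra on a set of generators\<close>

datatype 'a word = Word (letters: "'a list")

instantiation word :: (type) monoid_add
begin

definition zero_word :: "'a word" where
  "zero_word = Word []"

definition plus_word :: "'a word \<Rightarrow> 'a word \<Rightarrow> 'a word" where
  "plus_word x y = Word (letters x @ letters y)"

instance
  by standard (simp_all add: zero_word_def plus_word_def)

end

text \<open>Multiplication of finitely supported functions on words is convolution along concatenation.\<close>

type_synonym 'a free_poly = "'a word \<Rightarrow>\<^sub>0 complex"

abbreviation const :: "complex \<Rightarrow> 'a free_poly" where
  "const c \<equiv> Poly_Mapping.single 0 c"

abbreviation var :: "'a \<Rightarrow> 'a free_poly" where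
  "var g \<equiv> Poly_Mapping.single (Word [g]) 1"

definition free_alg :: "'a set \<Rightarrow> (complex, 'a free_poly) module" where
  "free_alg S = \<lparr>carrier = {x. \<forall>w \<in> Poly_Mapping.keys x. set (letters w) \<subseteq> S},
     mult = (*), one = 1, zero = 0, add = (+), smult = (\<lambda>c x. const c * x)\<rparr>"


section \<open>The quantum algebra of type D and its modules\<close>

text \<open>The vertices \<open>i\<close>, \<open>k\<close> and \<open>j\<^sub>\<beta>\<close>; only \<open>1 \<le> \<beta> \<le> m\<close> is used.\<close>

datatype node = Node_i | Node_k | Node_j nat

definition nodes :: "nat \<Rightarrow> node set" where
  "nodes m = {Node_i, Node_k} \<union> Node_j ` {1..m}"

definition edges :: "nat \<Rightarrow> (node \<times> node) set" where
  "edges m = {(Node_i, Node_j 1), (Node_k, Node_j 1)} \<union>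
     {(Node_j \<beta>, Node_j (\<beta> + 1)) | \<beta>. 1 \<le> \<beta> \<and> \<beta> < m}"

definition cartan :: "nat \<Rightarrow> node \<Rightarrow> node \<Rightarrow> int" where
  "cartan m a b =
     (if a = b then 2 else if (a, b) \<in> edges m \<or> (b, a) \<in> edges m then -1 else 0)"

datatype gen = E node | F node | K node | Kinv node

definition gens :: "nat \<Rightarrow> gen set" where
  "gens m = E ` nodes m \<union> F ` nodes m \<union> K ` nodes m \<union> Kinv ` nodes m"

text \<open>The elements \<open>lhs - rhs\<close> of the free algebra, for the defining relations \<open>lhs = rhs\<close>.\<close>

inductive_set relators :: "nat \<Rightarrow> complex \<Rightarrow> gen free_poly set"
  for m :: nat and v :: complex where
  K_Kinv: "a \<in> nodes m \<Longrightarrow> var (K a) * var (Kinv a) - 1 \<in> relators m v"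
| Kinv_K: "a \<in> nodes m \<Longrightarrow> var (Kinv a) * var (K a) - 1 \<in> relators m v"
| K_K: "a \<in> nodes m \<Longrightarrow> b \<in> nodes m \<Longrightarrow>
    var (K a) * var (K b) - var (K b) * var (K a) \<in> relators m v"
| K_E: "a \<in> nodes m \<Longrightarrow> b \<in> nodes m \<Longrightarrow>
    var (K a) * var (E b) - const (v powi cartan m a b) * var (E b) * var (K a) \<in> relators m v"
| K_F: "a \<in> nodes m \<Longrightarrow> b \<in> nodes m \<Longrightarrow>
    var (K a) * var (F b) - const (v powi (- cartan m a b)) * var (F b) * var (K a) \<in> relators m v"
| E_F: "a \<in> nodes m \<Longrightarrow> b \<in> nodes m \<Longrightarrow>
    var (E a) * var (F b) - var (F b) * var (E a)
      - (if a = b then const (1 / (v - inverse v)) * (var (K a) - var (Kinv a)) else 0)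
      \<in> relators m v"
| Serre: "a \<in> nodes m \<Longrightarrow> b \<in> nodes m \<Longrightarrow> cartan m a b = -1 \<Longrightarrow> X = E \<or> X = F \<Longrightarrow>
    var (X a) * var (X a) * var (X b)
      - const (v + inverse v) * var (X a) * var (X b) * var (X a)
      + var (X b) * var (X a) * var (X a) \<in> relators m v"
| commute: "a \<in> nodes m \<Longrightarrow> b \<in> nodes m \<Longrightarrow> cartan m a b = 0 \<Longrightarrow> X = E \<or> X = F \<Longrightarrow>
    var (X a) * var (X b) - var (X b) * var (X a) \<in> relators m v"

definition Uq_ideal :: "nat \<Rightarrow> complex \<Rightarrow> gen free_poly set" where
  "Uq_ideal m v = Idl\<^bsub>free_alg (gens m)\<^esub> (relators m v)"

definition Uq :: "nat \<Rightarrow> complex \<Rightarrow> (complex, gen free_poly set) module" where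
  "Uq m v = quot_alg (free_alg (gens m)) (Uq_ideal m v)"

definition Uq_gen :: "nat \<Rightarrow> complex \<Rightarrow> gen \<Rightarrow> gen free_poly set" where
  "Uq_gen m v g = Uq_ideal m v +>\<^bsub>free_alg (gens m)\<^esub> var g"

text \<open>
  \<open>L\<close> is a model of the simple highest-weight module \<open>L(w)\<close>, which is unique up to isomorphism. The
  condition on the submodules \<open>N\<close> says that \<open>\<xi>\<close> generates \<open>L\<close>.
\<close>

definition simple_highest_weight_module ::
    "nat \<Rightarrow> complex \<Rightarrow> (node \<Rightarrow> nat) \<Rightarrow> (gen free_poly set, 'l) module \<Rightarrow> bool" where
  "simple_highest_weight_module m v w L \<longleftrightarrow> simple_module (Uq m v) L \<and>
     (\<exists>\<xi> \<in> carrier L.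
        (\<forall>N. submodule N (Uq m v) L \<and> \<xi> \<in> N \<longrightarrow> N = carrier L) \<and>
        (\<forall>a \<in> nodes m.
           Uq_gen m v (K a) \<odot>\<^bsub>L\<^esub> \<xi> = (v ^ w a \<odot>\<^bsub>Uq m v\<^esub> \<one>\<^bsub>Uq m v\<^esub>) \<odot>\<^bsub>L\<^esub> \<xi> \<and>
           Uq_gen m v (E a) \<odot>\<^bsub>L\<^esub> \<xi> = \<zero>\<^bsub>L\<^esub>))"

text \<open>
  The saturated set \<open>\<pi>\<close> of weights \<open>w = d j\<^sub>m - C \<nu>\<close>. An element of \<open>\<nat>[I]\<close> is a function on
  \<^typ>\<open>node\<close> vanishing off \<open>nodes m\<close>.
\<close>

definition weights :: "nat \<Rightarrow> nat \<Rightarrow> (node \<Rightarrow> nat) set" where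
  "weights m d = {w. (\<forall>a. a \<notin> nodes m \<longrightarrow> w a = 0) \<and>
     (\<exists>\<nu> :: node \<Rightarrow> nat. \<forall>a \<in> nodes m.
        int (w a) = (if a = Node_j m then int d else 0)
          - (\<Sum>b \<in> nodes m. cartan m a b * int (\<nu> b)))}"

definition annihilator :: "nat \<Rightarrow> complex \<Rightarrow> nat \<Rightarrow>
    ((node \<Rightarrow> nat) \<Rightarrow> (gen free_poly set, 'l) module) \<Rightarrow> gen free_poly set set" where
  "annihilator m v d L =
     {u \<in> carrier (Uq m v). \<forall>w \<in> weights m d. \<forall>x \<in> carrier (L w). u \<odot>\<^bsub>L w\<^esub> x = \<zero>\<^bsub>L w\<^esub>}"


section \<open>Ramified flags\<close>

text \<open>
  The ambient space \<open>D\<close> is \<^term>\<open>UNIV :: 'v set\<close> with scalar action \<open>s\<close>. A flag is a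
  function assigning a subspace to each position: \<open>SU a\<close> for \<open>U\<^sub>a\<close> and \<open>SV \<beta>\<close> for the space
  \<open>V\<close> with index \<open>j\<^sub>\<beta>\<close>.
\<close>

datatype slot = SU node | SV nat

type_synonym 'v flag = "slot \<Rightarrow> 'v set"

text \<open>
  Off the range \<open>1, \<dots>, m\<close> the values are normalised so that flags are determined by their
  subspaces; at \<open>m + 1\<close> this is the convention that the \<open>U\<close>-space is \<open>D\<close> and the \<open>V\<close>-space
  is \<open>0\<close>.
\<close>

definition flags ::
    "('k::field \<Rightarrow> 'v::ab_group_add \<Rightarrow> 'v) \<Rightarrow> nat \<Rightarrow> 'v flag set" where
  "flags s m = {f.
     (\<forall>t. module.subspace s (f t)) \<and>
     (\<forall>\<beta>. \<beta> \<notin> {1..m} \<longrightarrow> f (SU (Node_j \<beta>)) = UNIV \<and> f (SV \<beta>) = {0}) \<and>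
     (\<forall>\<beta>. 1 \<le> \<beta> \<and> \<beta> < m \<longrightarrow>
        f (SV (\<beta> + 1)) \<subseteq> f (SV \<beta>) \<and> f (SU (Node_j \<beta>)) \<subseteq> f (SU (Node_j (\<beta> + 1)))) \<and>
     f (SV 1) \<subseteq> f (SU Node_i) \<and> f (SV 1) \<subseteq> f (SU Node_k) \<and>
     f (SU Node_i) \<subseteq> f (SU (Node_j 1)) \<and> f (SU Node_k) \<subseteq> f (SU (Node_j 1))}"

definition sdim :: "('k::field \<Rightarrow> 'v::ab_group_add \<Rightarrow> 'v) \<Rightarrow> 'v flag \<Rightarrow> slot \<Rightarrow> int" where
  "sdim s f t = int (vector_space.dim s (f t))"

definition step ::
    "('k::field \<Rightarrow> 'v::ab_group_add \<Rightarrow> 'v) \<Rightarrow> slot \<Rightarrow> 'v flag \<Rightarrow> 'v flag \<Rightarrow> bool" where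
  "step s t f g \<longleftrightarrow> f t \<subset> g t \<and> sdim s f t + 1 = sdim s g t \<and> (\<forall>t'. t' \<noteq> t \<longrightarrow> f t' = g t')"


section \<open>The convolution algebra\<close>

text \<open>
  Functions on \<open>X \<times> X\<close> are represented by functions of two arguments which vanish unless both
  arguments lie in \<open>X\<close>.
\<close>

definition conv_alg :: "'x set \<Rightarrow> (complex, 'x \<Rightarrow> 'x \<Rightarrow> complex) module" where
  "conv_alg X = \<lparr>carrier = {h. \<forall>f g. \<not> (f \<in> X \<and> g \<in> X) \<longrightarrow> h f g = 0},
     mult = (\<lambda>h1 h2 f g. \<Sum>f'\<in>X. h1 f f' * h2 f' g),
     one = (\<lambda>f g. if f = g \<and> f \<in> X then 1 else 0),
     zero = (\<lambda>f g. 0),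
     add = (\<lambda>h1 h2 f g. h1 f g + h2 f g),
     smult = (\<lambda>c h f g. c * h f g)\<rparr>"

text \<open>
  In the exponents, \<open>e t\<close> stands for the dimension of the subspace in position \<open>t\<close> of the
  second argument of the generating function.
\<close>

fun E_val :: "('k::field \<Rightarrow> 'v::ab_group_add \<Rightarrow> 'v) \<Rightarrow> complex \<Rightarrow> node \<Rightarrow>
    'v flag \<Rightarrow> 'v flag \<Rightarrow> complex" where
  "E_val s v (Node_j \<beta>) f g =
    (let e = sdim s g in
     if step s (SV \<beta>) f g then
       (if \<beta> = 1
        then v powi (- (e (SU Node_i) + e (SU Node_k) - e (SV 1) - e (SV 2)))
        else v powi (- (e (SU (Node_j (\<beta> - 1))) - e (SV \<beta>) - e (SV (\<beta> + 1)))))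
     else if step s (SU (Node_j \<beta>)) f g then
       (if \<beta> = 1
        then v powi (- (e (SU (Node_j 2)) + 2 * e (SV 1) - e (SU (Node_j 1))))
        else v powi (- (e (SU (Node_j (\<beta> + 1))) + 2 * e (SV \<beta>) - e (SU (Node_j \<beta>))
                        - e (SV (\<beta> - 1)))))
     else 0)"
| "E_val s v a f g =
    (let e = sdim s g in
     if step s (SU a) f g then v powi (- (e (SU (Node_j 1)) - e (SU a))) else 0)"

fun F_val :: "('k::field \<Rightarrow> 'v::ab_group_add \<Rightarrow> 'v) \<Rightarrow> complex \<Rightarrow> node \<Rightarrow>
    'v flag \<Rightarrow> 'v flag \<Rightarrow> complex" where
  "F_val s v (Node_j \<beta>) f g =
    (let e = sdim s g in
     if step s (SV \<beta>) g f then
       (if \<beta> = 1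
        then v powi (- (e (SU (Node_j 2)) - 2 * e (SU (Node_j 1)) + e (SV 1)))
        else v powi (- (e (SU (Node_j (\<beta> + 1))) - 2 * e (SU (Node_j \<beta>)) + e (SV \<beta>)
                        + e (SV (\<beta> - 1)))))
     else if step s (SU (Node_j \<beta>)) g f then
       (if \<beta> = 1
        then v powi (- (e (SU (Node_j 1)) - e (SU Node_i) - e (SU Node_k) - e (SV 2)))
        else v powi (- (- e (SV (\<beta> + 1)) + e (SU (Node_j \<beta>)) - e (SU (Node_j (\<beta> - 1))))))
     else 0)"
| "F_val s v a f g =
    (let e = sdim s g in
     if step s (SU a) g f then v powi (- (e (SU a) - e (SV 1))) else 0)"

fun kappa :: "('k::field \<Rightarrow> 'v::ab_group_add \<Rightarrow> 'v) \<Rightarrow> node \<Rightarrow> 'v flag \<Rightarrow> int" where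
  "kappa s (Node_j \<beta>) f =
    (let e = sdim s f in
     if \<beta> = 1
     then e (SU (Node_j 2)) + e (SV 2) + e (SU Node_i) + e (SU Node_k)
          - 2 * e (SU (Node_j 1)) - 2 * e (SV 1)
     else e (SU (Node_j (\<beta> + 1))) + e (SV (\<beta> + 1))
          + e (SU (Node_j (\<beta> - 1))) + e (SV (\<beta> - 1))
          - 2 * e (SU (Node_j \<beta>)) - 2 * e (SV \<beta>))"
| "kappa s a f =
    (let e = sdim s f in e (SU (Node_j 1)) + e (SV 1) - 2 * e (SU a))"

fun gen_val :: "('k::field \<Rightarrow> 'v::ab_group_add \<Rightarrow> 'v) \<Rightarrow> complex \<Rightarrow> gen \<Rightarrow>
    'v flag \<Rightarrow> 'v flag \<Rightarrow> complex" where
  "gen_val s v (E a) f g = E_val s v a f g"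
| "gen_val s v (F a) f g = F_val s v a f g"
| "gen_val s v (K a) f g = (if f = g then v powi kappa s a f else 0)"
| "gen_val s v (Kinv a) f g = (if f = g then v powi (- kappa s a f) else 0)"

definition gen_fun :: "('k::field \<Rightarrow> 'v::ab_group_add \<Rightarrow> 'v) \<Rightarrow> nat \<Rightarrow> complex \<Rightarrow> gen \<Rightarrow>
    'v flag \<Rightarrow> 'v flag \<Rightarrow> complex" where
  "gen_fun s m v x f g = (if f \<in> flags s m \<and> g \<in> flags s m then gen_val s v x f g else 0)"

definition flag_alg :: "('k::field \<Rightarrow> 'v::ab_group_add \<Rightarrow> 'v) \<Rightarrow> nat \<Rightarrow> complex \<Rightarrow>
    (complex, 'v flag \<Rightarrow> 'v flag \<Rightarrow> complex) module" where
  "flag_alg s m v = generated_subalg (conv_alg (flags s m)) (gen_fun s m v ` gens m)"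

end

theory Submission
  imports Defs "HOL-Combinatorics.Permutations"
begin

text \<open>
  Surjectivity holds because the image of \<open>\<Psi>\<close> is a subalgebra that contains the generators.
  Injectivity says that every element \<open>u\<close> of the quantum algebra acting by zero on the functions
  on flags acts by zero on \<open>L(w)\<close> for every \<open>w\<close> in the saturated set.

  The functions on the set of flags form a module over the quantum algebra, through \<open>\<Psi>\<close>. It is
  enough to find in it, for each such \<open>w\<close>, a highest weight vector \<open>\<phi> \<noteq> 0\<close> of weight \<open>w\<close>. Let
  \<open>\<xi>\<close> generate \<open>L(w)\<close>, and let \<open>J\<close> be the ideal of all \<open>u\<close> acting by zero on flags. As \<open>L(w)\<close> is
  simple, \<open>J \<xi>\<close> is \<open>0\<close> or all of \<open>L(w)\<close>. In the first case \<open>J\<close> kills \<open>L(w)\<close>, since \<open>\<xi>\<close> generates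
  it. In the second case some \<open>u \<in> J\<close> satisfies \<open>u \<xi> = \<xi>\<close> and \<open>u \<phi> = 0\<close>. This is impossible,
  because \<open>u\<close> acts on both vectors as one and the same polynomial in the \<open>F\<^sub>a\<close>, and the constant
  term of that polynomial would have to be both \<open>1\<close> and \<open>0\<close>
  (\<open>highest_weight_ideals_not_coprime\<close>, \<open>kernel_annihilates\<close>). Here \<open>v\<close> is a real number above
  \<open>1\<close>, so the powers of \<open>v\<close> separate the weights.

  To find \<open>\<phi>\<close>, consider functions supported on flags all of whose \<open>V\<close>-spaces are zero. Raising a
  \<open>V\<close>-space then leaves the support, and in the remaining sum over the enlargements of one
  \<open>U\<close>-space the coefficient of \<open>E\<^sub>a\<close> is constant. So \<open>E\<^sub>a \<phi> = 0\<close> only says that the sum of \<open>\<phi>\<close>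
  over all the ways to enlarge the space at \<open>a\<close> by one dimension vanishes, with no power of \<open>v\<close>
  left. Functions with this property are called singular. A product formula along a subspace
  \<open>D'\<close> of \<open>D\<close> multiplies singular functions for \<open>D'\<close> and \<open>D / D'\<close> and adds their dimension
  vectors (\<open>singular_product\<close>). Two kinds of factors suffice: a plane, of weight \<open>0\<close>, where
  three lines carry a singular function (\<open>singular_plane\<close>), and columns, whose singular
  functions are alternating sums over the complete flags of coordinate subspaces, that is,
  Steinberg vectors (\<open>singular_column\<close>). If \<open>d j\<^sub>m - C \<nu>\<close> is dominant, planes can be split off
  until \<open>\<nu>\<^sub>i\<close> or \<open>\<nu>\<^sub>k\<close> is zero; what is left is a partition of the remaining dimension, and its
  columns are split off one at a time (\<open>singular_exists\<close>).
\<close>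

section \<open>Polynomials in the free algebra\<close>

abbreviation poly_coeff :: "'a free_poly \<Rightarrow> 'a word \<Rightarrow> complex" where
  "poly_coeff \<equiv> Poly_Mapping.lookup"

lemma free_alg_simps [simp]:
  "monoid.mult (free_alg S) = (*)" "one (free_alg S) = 1" "zero (free_alg S) = 0"
  "add (free_alg S) = (+)" "smult (free_alg S) = (\<lambda>c x. const c * x)"
  by (simp_all add: free_alg_def)

lemma free_alg_carrier_iff:
  "x \<in> carrier (free_alg S) \<longleftrightarrow> (\<forall>w \<in> Poly_Mapping.keys x. set (letters w) \<subseteq> S)"
  by (simp add: free_alg_def)

lemma free_alg_single: "set (letters w) \<subseteq> S \<Longrightarrow> Poly_Mapping.single w c \<in> carrier (free_alg S)"
  by (simp add: free_alg_carrier_iff)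

lemma free_alg_add:
  assumes "x \<in> carrier (free_alg S)" "y \<in> carrier (free_alg S)"
  shows "x + y \<in> carrier (free_alg S)"
  using assms Poly_Mapping.keys_add[of x y] unfolding free_alg_carrier_iff by blast

lemma free_alg_diff:
  assumes "x \<in> carrier (free_alg S)" "y \<in> carrier (free_alg S)"
  shows "x - y \<in> carrier (free_alg S)"
  using assms Poly_Mapping.keys_diff[of x y] unfolding free_alg_carrier_iff by blast

lemma free_alg_mult:
  assumes "x \<in> carrier (free_alg S)" "y \<in> carrier (free_alg S)"
  shows "x * y \<in> carrier (free_alg S)"
  unfolding free_alg_carrier_iff
proof
  fix w assume "w \<in> Poly_Mapping.keys (x * y)"
  then obtain a b where "w = a + b" "a \<in> Poly_Mapping.keys x" "b \<in> Poly_Mapping.keys y"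
    using keys_mult[of x y] by auto
  then show "set (letters w) \<subseteq> S" using assms unfolding free_alg_carrier_iff
    by (auto simp: plus_word_def)
qed

lemma free_alg_zero: "0 \<in> carrier (free_alg S)" by (simp add: free_alg_carrier_iff)

lemma free_alg_const: "const c \<in> carrier (free_alg S)"
  by (rule free_alg_single) (simp add: zero_word_def)

lemma free_alg_one: "1 \<in> carrier (free_alg S)"
  using free_alg_const[of 1] by simp

lemma free_alg_var: "g \<in> S \<Longrightarrow> var g \<in> carrier (free_alg S)"
  by (rule free_alg_single) simp

lemma free_alg_uminus: "x \<in> carrier (free_alg S) \<Longrightarrow> - x \<in> carrier (free_alg S)"
  using free_alg_diff[OF free_alg_zero, of x S] by simp

lemmas free_alg_closed =
  free_alg_add free_alg_diff free_alg_mult free_alg_zero free_alg_const free_alg_one free_alg_uminus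

lemma free_alg_mono: "S \<subseteq> T \<Longrightarrow> carrier (free_alg S) \<subseteq> carrier (free_alg T)"
  by (force simp: free_alg_carrier_iff)

lemma free_alg_induct [consumes 1, case_names zero monomial add]:
  assumes p: "p \<in> carrier (free_alg S)"
    and 0: "Q 0"
    and s: "\<And>l c. set l \<subseteq> S \<Longrightarrow> Q (Poly_Mapping.single (Word l) c)"
    and a: "\<And>x y. x \<in> carrier (free_alg S) \<Longrightarrow> y \<in> carrier (free_alg S) \<Longrightarrow> Q x \<Longrightarrow> Q y \<Longrightarrow> Q (x + y)"
  shows "Q p"
proof -
  have sum: "p = (\<Sum>w\<in>Poly_Mapping.keys p. Poly_Mapping.single w (poly_coeff p w))"
    by (rule poly_mapping_eqI) (auto simp: lookup_sum lookup_single when_def in_keys_iff)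
  have "finite A \<Longrightarrow> A \<subseteq> Poly_Mapping.keys p \<Longrightarrow>
      Q (\<Sum>w\<in>A. Poly_Mapping.single w (poly_coeff p w)) \<and>
      (\<Sum>w\<in>A. Poly_Mapping.single w (poly_coeff p w)) \<in> carrier (free_alg S)" for A
  proof (induction A rule: finite_induct)
    case empty
    then show ?case using 0 by (simp add: free_alg_zero)
  next
    case (insert w A)
    then have w: "set (letters w) \<subseteq> S" using p by (auto simp: free_alg_carrier_iff)
    then have "Poly_Mapping.single w (poly_coeff p w) \<in> carrier (free_alg S)"
      by (rule free_alg_single)
    moreover have "Q (Poly_Mapping.single w (poly_coeff p w))" using s[of "letters w"] w by simp
    ultimately show ?case using insert a free_alg_add by auto
  qed
  from this[of "Poly_Mapping.keys p"] show ?thesis using sum by auto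
qed

lemma const_commute: "x * const c = const c * (x :: 'a free_poly)"
proof -
  have "x \<in> carrier (free_alg UNIV)" by (simp add: free_alg_carrier_iff)
  then show ?thesis
    by (induction rule: free_alg_induct)
       (simp_all add: distrib_left distrib_right mult_single mult.commute)
qed

lemma const_mult_const: "const a * (const b * x) = const (a * b) * (x :: 'a free_poly)"
  by (simp add: mult.assoc[symmetric] mult_single)

lemma const_left_commute: "y * (const c * x) = const c * (y * (x :: 'a free_poly))"
  by (metis const_commute mult.assoc)

lemma var_const_left_commute: "var g * (const c * x) = const c * (var g * x)"
  by (rule const_left_commute)

lemma const_mult_single: "const c * Poly_Mapping.single w d = Poly_Mapping.single w (c * d)"
  by (simp add: mult_single)

lemma single_Cons:
  "Poly_Mapping.single (Word (g # l)) c = var g * (Poly_Mapping.single (Word l) c :: 'a free_poly)"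
  by (simp add: mult_single plus_word_def)

abbreviation gen_polys :: "nat \<Rightarrow> gen free_poly set" where
  "gen_polys m \<equiv> carrier (free_alg (gens m))"

abbreviation F_polys :: "nat \<Rightarrow> gen free_poly set" where
  "F_polys m \<equiv> carrier (free_alg (F ` nodes m))"

lemma nodes_gens:
  "a \<in> nodes m \<Longrightarrow> E a \<in> gens m" "a \<in> nodes m \<Longrightarrow> F a \<in> gens m"
  "a \<in> nodes m \<Longrightarrow> K a \<in> gens m" "a \<in> nodes m \<Longrightarrow> Kinv a \<in> gens m"
  by (auto simp: gens_def)

lemma relators_in_free_alg: "r \<in> relators m v \<Longrightarrow> r \<in> gen_polys m"
proof (induction rule: relators.induct)
  case (E_F a b)
  then show ?case
    by (cases "a = b")
       (auto intro!: free_alg_closed free_alg_var nodes_gens simp del: single_one)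
qed (auto intro!: free_alg_closed free_alg_var simp: nodes_gens simp del: single_one)

section \<open>Left ideals of highest weight\<close>

text \<open>
  The properties of the annihilator, in the free algebra, of a highest weight vector of weight
  \<open>w\<close> in a module over the quantum algebra. Working with such left ideals treats vectors of
  different modules on the same footing; the intersection of two of them is the annihilator of a
  pair of vectors.
\<close>

locale highest_weight_ideal =
  fixes m :: nat and v :: complex and w :: "node \<Rightarrow> nat" and \<Lambda> :: "gen free_poly set"
  assumes subset: "\<Lambda> \<subseteq> gen_polys m"
    and diff: "x \<in> \<Lambda> \<Longrightarrow> y \<in> \<Lambda> \<Longrightarrow> x - y \<in> \<Lambda>"
    and left_mult: "p \<in> gen_polys m \<Longrightarrow> x \<in> \<Lambda> \<Longrightarrow> p * x \<in> \<Lambda>"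
    and relator: "r \<in> relators m v \<Longrightarrow> p \<in> gen_polys m \<Longrightarrow> r * p \<in> \<Lambda>"
    and E_mem: "a \<in> nodes m \<Longrightarrow> var (E a) \<in> \<Lambda>"
    and K_mem: "a \<in> nodes m \<Longrightarrow> var (K a) - const (v ^ w a) \<in> \<Lambda>"
    and v_nonzero: "v \<noteq> 0"

lemma highest_weight_ideal_Int:
  assumes "highest_weight_ideal m v w \<Lambda>1" "highest_weight_ideal m v w \<Lambda>2"
  shows "highest_weight_ideal m v w (\<Lambda>1 \<inter> \<Lambda>2)"
  using assms unfolding highest_weight_ideal_def by auto

abbreviation F_word :: "node list \<Rightarrow> gen free_poly" where
  "F_word l \<equiv> Poly_Mapping.single (Word (map F l)) 1"

lemma F_poly_subset: "F_polys m \<subseteq> gen_polys m"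
  by (rule free_alg_mono) (auto simp: gens_def)

lemma F_word_mem: "set l \<subseteq> nodes m \<Longrightarrow> F_word l \<in> F_polys m"
  by (rule free_alg_single) auto

lemma F_poly_induct [consumes 1, case_names zero monomial add]:
  assumes p: "p \<in> F_polys m"
    and 0: "Q 0"
    and s: "\<And>l c. set l \<subseteq> nodes m \<Longrightarrow> Q (const c * F_word l)"
    and a: "\<And>x y. Q x \<Longrightarrow> Q y \<Longrightarrow> Q (x + y)"
  shows "Q p"
  using p
proof (induction rule: free_alg_induct)
  case (monomial l c)
  then obtain l' where "l = map F l'" "set l' \<subseteq> nodes m"
  proof -
    have "\<forall>g\<in>set l. \<exists>a\<in>nodes m. g = F a" using monomial by auto
    then have "\<exists>l'. l = map F l' \<and> set l' \<subseteq> nodes m"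
      by (induction l) (auto, metis list.simps(9) set_subset_Cons insert_subset list.simps(15))
    then show ?thesis using that by blast
  qed
  then show ?case using s[of l' c] by (simp add: const_mult_single)
qed (use 0 a in auto)

context highest_weight_ideal
begin

lemma zero_mem: "0 \<in> \<Lambda>"
  using diff[OF E_mem E_mem, of Node_i Node_i] by (simp add: nodes_def)

lemma add_mem: "x \<in> \<Lambda> \<Longrightarrow> y \<in> \<Lambda> \<Longrightarrow> x + y \<in> \<Lambda>"
  using diff[OF _ diff[OF zero_mem]] by fastforce

lemma const_mem: "x \<in> \<Lambda> \<Longrightarrow> const c * x \<in> \<Lambda>"
  by (rule left_mult[OF free_alg_const])

text \<open>
  Modulo \<open>\<Lambda>\<close>, words in the \<open>F\<^sub>b\<close> are eigenvectors for every \<open>K\<^sub>a\<close>: commuting \<open>K\<^sub>a\<close> to the right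
  end of the word produces the exponent.
\<close>

lemma K_F_word:
  assumes a: "a \<in> nodes m" and l: "set l \<subseteq> nodes m"
  shows "var (K a) * F_word l
    - const (v powi (int (w a) - (\<Sum>b\<leftarrow>l. cartan m a b))) * F_word l \<in> \<Lambda>"
  using l
proof (induction l)
  case Nil
  then show ?case using K_mem[OF a] by (simp add: zero_word_def[symmetric] power_int_def)
next
  case (Cons b l)
  let ?e = "int (w a) - (\<Sum>b\<leftarrow>l. cartan m a b)"
  let ?c = "v powi (- cartan m a b)"
  have b: "b \<in> nodes m" and l: "set l \<subseteq> nodes m" using Cons by auto
  have y: "F_word l \<in> gen_polys m" using F_word_mem[OF l] F_poly_subset by blast
  have 1: "(var (K a) * var (F b) - const ?c * var (F b) * var (K a)) * F_word l \<in> \<Lambda>"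
    by (rule relator[OF K_F[OF a b] y])
  have 2: "const ?c * (var (F b) * (var (K a) * F_word l - const (v powi ?e) * F_word l)) \<in> \<Lambda>"
    using Cons l b by (intro const_mem left_mult free_alg_var nodes_gens) auto
  have e: "?c * v powi ?e = v powi (int (w a) - (\<Sum>b\<leftarrow>b # l. cartan m a b))"
    using v_nonzero by (simp add: power_int_add[symmetric] diff_diff_eq add.commute)
  have "var (K a) * F_word (b # l)
      - const (v powi (int (w a) - (\<Sum>b\<leftarrow>b # l. cartan m a b))) * F_word (b # l)
    = (var (K a) * var (F b) - const ?c * var (F b) * var (K a)) * F_word l
      + const ?c * (var (F b) * (var (K a) * F_word l - const (v powi ?e) * F_word l))"
    unfolding list.map(2)[of F b l] e[symmetric] single_Cons[of "F b" "map F l" 1]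
    by (simp only: right_diff_distrib left_diff_distrib mult.assoc var_const_left_commute
        const_mult_const) simp
  then show ?case using add_mem[OF 1 2] by simp
qed

lemma Kinv_F_word:
  assumes a: "a \<in> nodes m" and l: "set l \<subseteq> nodes m"
  shows "\<exists>c. var (Kinv a) * F_word l - const c * F_word l \<in> \<Lambda>"
proof -
  define c where "c = v powi (int (w a) - (\<Sum>b\<leftarrow>l. cartan m a b))"
  have c: "c \<noteq> 0" using v_nonzero by (simp add: c_def)
  have y: "F_word l \<in> gen_polys m" using F_word_mem[OF l] F_poly_subset by blast
  have 1: "(var (Kinv a) * var (K a) - 1) * F_word l \<in> \<Lambda>" by (rule relator[OF Kinv_K[OF a] y])
  have 2: "var (Kinv a) * (var (K a) * F_word l - const c * F_word l) \<in> \<Lambda>"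
    using K_F_word[OF a l] by (intro left_mult free_alg_var nodes_gens a) (simp add: c_def)
  have "const (inverse c) * ((var (Kinv a) * var (K a) - 1) * F_word l -
      var (Kinv a) * (var (K a) * F_word l - const c * F_word l)) \<in> \<Lambda>"
    by (rule const_mem[OF diff[OF 1 2]])
  also have "const (inverse c) * ((var (Kinv a) * var (K a) - 1) * F_word l -
      var (Kinv a) * (var (K a) * F_word l - const c * F_word l))
    = const (inverse c * c) * (var (Kinv a) * F_word l) - const (inverse c) * F_word l"
    by (simp only: right_diff_distrib left_diff_distrib mult.assoc var_const_left_commute
        const_mult_const) simp
  finally show ?thesis using c by auto
qed

text \<open>
  The polynomials that agree modulo \<open>\<Lambda>\<close> with a polynomial in the \<open>F\<^sub>b\<close> alone. The set is stable
  under left multiplication by all generators and contains \<open>1\<close>, hence is everything; on the side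
  of modules, a highest weight vector generates its module under the \<open>F\<^sub>b\<close>.
\<close>

definition reducible :: "gen free_poly set" where
  "reducible = {p. \<exists>y \<in> F_polys m. p - y \<in> \<Lambda>}"

lemma reducible_add:
  assumes "p \<in> reducible" "q \<in> reducible" shows "p + q \<in> reducible"
proof -
  obtain x y where x: "x \<in> F_polys m" "p - x \<in> \<Lambda>"
    and y: "y \<in> F_polys m" "q - y \<in> \<Lambda>"
    using assms by (auto simp: reducible_def)
  have "(p + q) - (x + y) \<in> \<Lambda>" using add_mem[OF x(2) y(2)] by (simp add: add_diff_add)
  then show ?thesis using free_alg_add[OF x(1) y(1)] by (auto simp: reducible_def)
qed

lemma reducible_const:
  assumes "p \<in> reducible" shows "const c * p \<in> reducible"
proof -
  obtain x where x: "x \<in> F_polys m" "p - x \<in> \<Lambda>"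
    using assms by (auto simp: reducible_def)
  have "const c * p - const c * x \<in> \<Lambda>" using const_mem[OF x(2), of c]
    by (simp only: right_diff_distrib)
  then show ?thesis using free_alg_mult[OF free_alg_const x(1)] by (auto simp: reducible_def)
qed

lemma reducible_F_poly: "y \<in> F_polys m \<Longrightarrow> y \<in> reducible"
  unfolding reducible_def using zero_mem by force

lemma reducible_cong: "p - q \<in> \<Lambda> \<Longrightarrow> q \<in> reducible \<Longrightarrow> p \<in> reducible"
  unfolding reducible_def using add_mem by fastforce

lemma reducible_F: 
  assumes "b \<in> nodes m" "p \<in> reducible"
  shows "var (F b) * p \<in> reducible"
proof -
  obtain y where y: "y \<in> F_polys m" "p - y \<in> \<Lambda>"
    using assms by (auto simp: reducible_def)
  have "var (F b) * p - var (F b) * y \<in> \<Lambda>"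
    using left_mult[OF free_alg_var[OF nodes_gens(2)] y(2)] assms by (simp add: right_diff_distrib)
  moreover have "var (F b) * y \<in> F_polys m"
    using assms y by (intro free_alg_mult free_alg_var) auto
  ultimately show ?thesis unfolding reducible_def by blast
qed

text \<open>
  By induction on the word: \<open>E\<^sub>a\<close> moves past the first letter at the cost of a multiple of
  \<open>K\<^sub>a - K\<^sub>a\<close> inverse, which acts on the rest of the word by a scalar.
\<close>

lemma E_F_word:
  assumes a: "a \<in> nodes m" and l: "set l \<subseteq> nodes m"
  shows "var (E a) * F_word l \<in> reducible"
  using l
proof (induction l)
  case Nil
  then show ?case using E_mem[OF a] reducible_cong[of _ 0] reducible_F_poly[OF free_alg_zero]
    by (simp add: zero_word_def[symmetric])
next
  case (Cons b l)
  let ?h = "if a = b then const (1 / (v - inverse v)) * (var (K a) - var (Kinv a)) else 0"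
  have b: "b \<in> nodes m" and l: "set l \<subseteq> nodes m" using Cons by auto
  have yF: "F_word l \<in> F_polys m" using F_word_mem[OF l] .
  then have y: "F_word l \<in> gen_polys m" using F_poly_subset by blast
  have 1: "(var (E a) * var (F b) - var (F b) * var (E a) - ?h) * F_word l \<in> \<Lambda>"
    by (rule relator[OF E_F[OF a b] y])
  have 2: "var (F b) * (var (E a) * F_word l) \<in> reducible"
    using Cons l b by (intro reducible_F) auto
  have K: "var (K a) * F_word l \<in> reducible"
    by (rule reducible_cong[OF K_F_word[OF a l]]) (intro reducible_const reducible_F_poly yF)
  obtain c where "var (Kinv a) * F_word l - const c * F_word l \<in> \<Lambda>" using Kinv_F_word[OF a l] ..
  from reducible_cong[OF this] have K': "var (Kinv a) * F_word l \<in> reducible"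
    by (simp add: reducible_const reducible_F_poly yF)
  have "const (1 / (v - inverse v)) * (var (K a) * F_word l + const (-1) * (var (Kinv a) * F_word
    l))
    \<in> reducible"
    by (intro reducible_const reducible_add K K')
  then have 3: "?h * F_word l \<in> reducible"
    using reducible_F_poly[OF free_alg_zero]
    by (auto simp: left_diff_distrib right_diff_distrib mult.assoc single_uminus)
  have "var (E a) * F_word (b # l) -
      (var (F b) * (var (E a) * F_word l) + ?h * F_word l) \<in> \<Lambda>"
    using 1 unfolding list.map single_Cons[of "F b" "map F l" 1]
    by (simp only: left_diff_distrib distrib_right mult.assoc diff_diff_eq)
  then show ?case by (rule reducible_cong) (intro reducible_add 2 3)
qed

lemma reducible_gen:
  assumes g: "g \<in> gens m" and p: "p \<in> reducible"
  shows "var g * p \<in> reducible"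
proof -
  have word: "var g * F_word l \<in> reducible" if l: "set l \<subseteq> nodes m" for l
  proof -
    note y = F_word_mem[OF l]
    consider a where "g = E a" "a \<in> nodes m" | a where "g = F a" "a \<in> nodes m"
      | a where "g = K a" "a \<in> nodes m" | a where "g = Kinv a" "a \<in> nodes m"
      using g by (auto simp: gens_def)
    then show ?thesis
    proof cases
      case 1
      then show ?thesis using E_F_word l by blast
    next
      case 2
      then show ?thesis using reducible_F reducible_F_poly[OF y] by blast
    next
      case (3 a)
      show ?thesis unfolding \<open>g = K a\<close>
        by (rule reducible_cong[OF K_F_word[OF 3(2) l]]) (intro reducible_const reducible_F_poly y)
    next
      case (4 a)
      obtain c where "var (Kinv a) * F_word l - const c * F_word l \<in> \<Lambda>"
        using Kinv_F_word[OF 4(2) l] ..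
      from reducible_cong[OF this] show ?thesis unfolding \<open>g = Kinv a\<close>
        by (simp add: reducible_const reducible_F_poly y)
    qed
  qed
  obtain y where y: "y \<in> F_polys m" "p - y \<in> \<Lambda>"
    using p by (auto simp: reducible_def)
  from y(1) have "var g * y \<in> reducible"
  proof (induction rule: F_poly_induct)
    case zero
    then show ?case by (simp add: reducible_F_poly free_alg_zero)
  next
    case (monomial l c)
    then show ?case by (simp only: const_left_commute reducible_const word)
  next
    case (add x y)
    then show ?case by (simp add: distrib_left reducible_add)
  qed
  moreover have "var g * p - var g * y \<in> \<Lambda>"
    using left_mult[OF free_alg_var[OF g] y(2)] by (simp add: right_diff_distrib)
  ultimately show ?thesis by (rule reducible_cong[rotated])
qed

lemma all_reducible:
  assumes "p \<in> gen_polys m"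
  shows "\<exists>y \<in> F_polys m. p - y \<in> \<Lambda>"
proof -
  have "p \<in> reducible" using assms
  proof (induction rule: free_alg_induct)
    case zero
    then show ?case by (simp add: reducible_F_poly free_alg_zero)
  next
    case (monomial l c)
    then show ?case
    proof (induction l)
      case Nil
      then show ?case using reducible_F_poly[OF free_alg_const] by (simp add: zero_word_def)
    next
      case (Cons g l)
      then show ?case by (simp only: single_Cons[of g l]) (simp add: reducible_gen)
    qed
  next
    case (add x y)
    then show ?case by (simp add: reducible_add)
  qed
  then show ?thesis by (simp add: reducible_def)
qed

lemma K_word_F_word:
  assumes "set ks \<subseteq> nodes m" and l: "set l \<subseteq> nodes m"
  shows "Poly_Mapping.single (Word (map K ks)) 1 * F_word l
    - const (v powi (\<Sum>a\<leftarrow>ks. int (w a) - (\<Sum>b\<leftarrow>l. cartan m a b))) * F_word l \<in> \<Lambda>"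
  using assms(1)
proof (induction ks)
  case Nil
  then show ?case using zero_mem by (simp add: zero_word_def[symmetric])
next
  case (Cons a ks)
  let ?k = "Poly_Mapping.single (Word (map K ks)) 1 :: gen free_poly"
  let ?e = "\<Sum>a\<leftarrow>ks. int (w a) - (\<Sum>b\<leftarrow>l. cartan m a b)"
  let ?f = "int (w a) - (\<Sum>b\<leftarrow>l. cartan m a b)"
  have a: "a \<in> nodes m" using Cons by auto
  have 1: "var (K a) * (?k * F_word l - const (v powi ?e) * F_word l) \<in> \<Lambda>"
    using Cons by (intro left_mult free_alg_var nodes_gens) auto
  have 2: "const (v powi ?e) * (var (K a) * F_word l - const (v powi ?f) * F_word l) \<in> \<Lambda>"
    by (intro const_mem K_F_word a l)
  have "v powi ?e * v powi ?f = v powi (\<Sum>a\<leftarrow>a # ks. int (w a) - (\<Sum>b\<leftarrow>l. cartan m a b))"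
    using v_nonzero by (simp only: list.map sum_list.Cons power_int_add[symmetric] add.commute
      simp_thms)
  then have e: "v powi ?e * v powi ?f = v powi (\<Sum>a\<leftarrow>a # ks. int (w a) - (\<Sum>b\<leftarrow>l. cartan m a b))" .
  have "Poly_Mapping.single (Word (map K (a # ks))) 1 * F_word l
      - const (v powi (\<Sum>a\<leftarrow>a # ks. int (w a) - (\<Sum>b\<leftarrow>l. cartan m a b))) * F_word l
    = var (K a) * (?k * F_word l - const (v powi ?e) * F_word l)
      + const (v powi ?e) * (var (K a) * F_word l - const (v powi ?f) * F_word l)"
    unfolding list.map(2)[of K a ks] e[symmetric] single_Cons[of "K a" "map K ks" 1]
    by (simp only: right_diff_distrib left_diff_distrib mult.assoc var_const_left_commute
        const_mult_const) simp
  then show ?case using add_mem[OF 1 2] by simp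
qed

end

text \<open>
  The coefficients of the simple coroots in the sum of all positive coroots. That sum pairs to
  \<open>2\<close> with every simple root (\<open>rho_word_cartan\<close>), so the product of the \<open>K\<^sub>a\<close> to these powers
  measures the length of a word in the \<open>F\<^sub>b\<close>.
\<close>

fun rho_coeff :: "nat \<Rightarrow> node \<Rightarrow> nat" where
  "rho_coeff m (Node_j \<beta>) = (m + 1) * (m + 2) - \<beta> * (\<beta> + 1)"
| "rho_coeff m a = (m + 1) * (m + 2) div 2"

definition rho_word :: "nat \<Rightarrow> node list" where
  "rho_word m = concat (map (\<lambda>a. replicate (rho_coeff m a) a) (Node_i # Node_k # map Node_j [1..<m
    + 1]))"

lemma set_rho_word: "set (rho_word m) \<subseteq> nodes m"
  by (auto simp: rho_word_def nodes_def)

lemma cartan_j_j: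
  "cartan m (Node_j \<beta>) (Node_j \<gamma>) =
    (if \<beta> = \<gamma> then 2 else if (\<beta> + 1 = \<gamma> \<and> 1 \<le> \<beta> \<and> \<beta> < m) \<or> (\<gamma> + 1 = \<beta> \<and> 1 \<le> \<gamma> \<and> \<gamma> < m) then -1
      else 0)"
  by (auto simp: cartan_def edges_def)

lemma cartan_ik:
  "cartan m Node_i Node_i = 2" "cartan m Node_k Node_k = 2"
  "cartan m Node_i Node_k = 0" "cartan m Node_k Node_i = 0"
  "cartan m Node_i (Node_j \<beta>) = (if \<beta> = 1 then -1 else 0)"
  "cartan m Node_k (Node_j \<beta>) = (if \<beta> = 1 then -1 else 0)"
  "cartan m (Node_j \<beta>) Node_i = (if \<beta> = 1 then -1 else 0)"
  "cartan m (Node_j \<beta>) Node_k = (if \<beta> = 1 then -1 else 0)"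
  by (auto simp: cartan_def edges_def)

lemma sum_cartan_j:
  fixes n :: "nat \<Rightarrow> int"
  assumes "\<gamma> \<in> {1..m}"
  shows "(\<Sum>\<beta>=1..m. n \<beta> * cartan m (Node_j \<beta>) (Node_j \<gamma>)) =
    2 * n \<gamma> - (if \<gamma> = 1 then 0 else n (\<gamma> - 1)) - (if \<gamma> = m then 0 else n (\<gamma> + 1))"
proof -
  have "(\<Sum>\<beta>=1..m. n \<beta> * cartan m (Node_j \<beta>) (Node_j \<gamma>)) =
    (\<Sum>\<beta>=1..m. (if \<beta> = \<gamma> then 2 * n \<gamma> else 0) - (if \<beta> = \<gamma> - 1 then n (\<gamma> - 1) else 0)
       - (if \<beta> = \<gamma> + 1 then n (\<gamma> + 1) else 0))"
    using assms by (intro sum.cong) (auto simp: cartan_j_j)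
  also have "\<dots> = 2 * n \<gamma> - (if \<gamma> = 1 then 0 else n (\<gamma> - 1)) - (if \<gamma> = m then 0 else n (\<gamma> + 1))"
    using assms by (auto simp: sum_subtractf sum.delta)
  finally show ?thesis .
qed

lemma sum_list_concat_replicate:
  "(\<Sum>a\<leftarrow>concat (map (\<lambda>a. replicate (n a) a) xs). (f a :: int)) = (\<Sum>a\<leftarrow>xs. int (n a) * f a)"
  by (induction xs) (auto simp: sum_list_replicate)

lemma rho_word_cartan:
  assumes "1 \<le> m" "b \<in> nodes m"
  shows "(\<Sum>a\<leftarrow>rho_word m. cartan m a b) = 2"
proof -
  have J: "(\<Sum>a\<leftarrow>rho_word m. cartan m a b) =
      int (rho_coeff m Node_i) * cartan m Node_i b + int (rho_coeff m Node_k) * cartan m Node_k b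
      + (\<Sum>\<beta>=1..m. int (rho_coeff m (Node_j \<beta>)) * cartan m (Node_j \<beta>) b)"
    unfolding rho_word_def sum_list_concat_replicate
    by (simp add: o_def interv_sum_list_conv_sum_set_nat atLeastLessThanSuc_atLeastAtMost del:
      rho_coeff.simps upt_Suc)
  have even: "int ((m + 1) * (m + 2) div 2) * 2 = (int m + 1) * (int m + 2)"
  proof -
    have "even ((m + 1) * (m + 2))" by simp
    then have "(m + 1) * (m + 2) div 2 * 2 = (m + 1) * (m + 2)" by (rule dvd_div_mult_self)
    then have "int ((m + 1) * (m + 2) div 2 * 2) = int ((m + 1) * (m + 2))" by (rule arg_cong)
    then show ?thesis by (simp only: of_nat_mult of_nat_numeral of_nat_add of_nat_1)
  qed
  have coeff: "int (rho_coeff m (Node_j \<beta>)) = (int m + 1) * (int m + 2) - int \<beta> * (int \<beta> + 1)" if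
    "\<beta> \<le> m + 1" for \<beta>
  proof -
    have "\<beta> * (\<beta> + 1) \<le> (m + 1) * (m + 2)" using that by (intro mult_mono) auto
    then show ?thesis by (simp add: of_nat_diff algebra_simps)
  qed
  have ik: "(\<Sum>\<beta>=1..m. int (rho_coeff m (Node_j \<beta>)) * (if \<beta> = 1 then -1 else 0)) = 2 - (int m + 1)
    * (int m + 2)"
  proof -
    have "(\<Sum>\<beta>=1..m. int (rho_coeff m (Node_j \<beta>)) * (if \<beta> = 1 then -1 else 0)) =
      (\<Sum>\<beta>=1..m. if \<beta> = 1 then - int (rho_coeff m (Node_j 1)) else 0)"
      by (intro sum.cong) auto
    then show ?thesis using assms coeff[of 1] by (simp add: sum.delta del: rho_coeff.simps)
  qed
  consider "b = Node_i" | "b = Node_k" | \<gamma> where "b = Node_j \<gamma>" "\<gamma> \<in> {1..m}"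
    using assms(2) by (auto simp: nodes_def)
  then show ?thesis
  proof cases
    case 1
    then show ?thesis using even ik unfolding J by (simp add: cartan_ik del: of_nat_mult of_nat_add)
  next
    case 2
    then show ?thesis using even ik unfolding J by (simp add: cartan_ik del: of_nat_mult of_nat_add)
  next
    case (3 \<gamma>)
    have g: "int (\<gamma> - 1) = int \<gamma> - 1" using 3 by auto
    \<comment> \<open>the coefficient vanishes at the missing vertex \<open>j\<close> with index \<open>m + 1\<close>, so the end of
      the diagram needs no separate treatment\<close>
    have last: "(if \<gamma> = m then 0 else int (rho_coeff m (Node_j (\<gamma> + 1)))) = int (rho_coeff m
      (Node_j (\<gamma> + 1)))"
      by simp
    have S: "(\<Sum>\<beta>=1..m. int (rho_coeff m (Node_j \<beta>)) * cartan m (Node_j \<beta>) (Node_j \<gamma>)) =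
      2 * int (rho_coeff m (Node_j \<gamma>)) - (if \<gamma> = 1 then 0 else int (rho_coeff m (Node_j (\<gamma> - 1))))
        - int (rho_coeff m (Node_j (\<gamma> + 1)))"
      by (subst sum_cartan_j[OF 3(2)]) (simp only: last)
    define A where "A = (int m + 1) * (int m + 2)"
    define x where "x = int \<gamma>"
    have r: "int (rho_coeff m (Node_j \<gamma>)) = A - x * (x + 1)"
      "int (rho_coeff m (Node_j (\<gamma> - 1))) = A - (x - 1) * x"
      "int (rho_coeff m (Node_j (\<gamma> + 1))) = A - (x + 1) * (x + 2)"
      using coeff[of \<gamma>] coeff[of "\<gamma> - 1"] coeff[of "\<gamma> + 1"] 3(2) g
      by (simp_all add: A_def x_def add.commute del: rho_coeff.simps)
    have h: "int (rho_coeff m Node_i) * 2 = A" "int (rho_coeff m Node_k) * 2 = A"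
      using even by (simp_all only: A_def rho_coeff.simps)
    show ?thesis
    proof (cases "\<gamma> = 1")
      case True
      then have "x = 1" by (simp add: x_def)
      then show ?thesis unfolding J[unfolded 3(1)] 3(1) S r cartan_ik using h True by simp
    next
      case False
      then show ?thesis unfolding J[unfolded 3(1)] 3(1) S r cartan_ik by (simp add: algebra_simps)
    qed
  qed
qed

context highest_weight_ideal
begin

definition rho_op :: "gen free_poly" where
  "rho_op = Poly_Mapping.single (Word (map K (rho_word m))) 1"

definition rho_weight :: int where
  "rho_weight = (\<Sum>a\<leftarrow>rho_word m. int (w a))"

lemma rho_op_F_word:
  assumes "1 \<le> m" "set l \<subseteq> nodes m"
  shows "rho_op * F_word l - const (v powi (rho_weight - 2 * int (length l))) * F_word l \<in> \<Lambda>"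
proof -
  have "(\<Sum>a\<leftarrow>ks. int (w a) - (\<Sum>b\<leftarrow>l. cartan m a b)) =
      (\<Sum>a\<leftarrow>ks. int (w a)) - (\<Sum>b\<leftarrow>l. \<Sum>a\<leftarrow>ks. cartan m a b)" for ks
    by (induction ks) (auto simp: sum_list_addf)
  moreover have "(\<Sum>b\<leftarrow>l. \<Sum>a\<leftarrow>rho_word m. cartan m a b) = (\<Sum>b\<leftarrow>l. 2)"
    using assms rho_word_cartan by (intro arg_cong[of _ _ sum_list] map_cong) auto
  moreover have "(\<Sum>b\<leftarrow>l. 2::int) = 2 * int (length l)" by (induction l) auto
  ultimately have "(\<Sum>a\<leftarrow>rho_word m. int (w a) - (\<Sum>b\<leftarrow>l. cartan m a b)) = rho_weight - 2 * int
    (length l)"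
    by (simp add: rho_weight_def)
  then show ?thesis using K_word_F_word[OF set_rho_word assms(2)] by (simp add: rho_op_def)
qed

lemma rho_op_mem: "rho_op \<in> gen_polys m"
  unfolding rho_op_def using set_rho_word[of m] by (intro free_alg_single) (auto simp: nodes_gens)

text \<open>
  The product of the factors \<open>\<rho> - v^(N - 2 s)\<close> over \<open>1 \<le> s \<le> r\<close>, where \<open>\<rho>\<close> is the operator
  \<open>rho_op\<close> and \<open>v^N\<close> its eigenvalue on the highest weight vector. It kills all words in the
  \<open>F\<^sub>b\<close> of length between \<open>1\<close> and \<open>r\<close> and acts on the empty word by a nonzero scalar.
\<close>

fun filter_op :: "nat \<Rightarrow> gen free_poly" where
  "filter_op 0 = 1"
| "filter_op (Suc r) = (rho_op - const (v powi (rho_weight - 2 * (int r + 1)))) * filter_op r"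

lemma filter_op_mem: "filter_op r \<in> gen_polys m"
  by (induction r) (auto intro!: free_alg_closed rho_op_mem)

lemma filter_op_F_word:
  assumes "1 \<le> m" "set l \<subseteq> nodes m"
  shows "filter_op r * F_word l
    - const (\<Prod>s<r. v powi (rho_weight - 2 * int (length l)) - v powi (rho_weight - 2 * (int s +
      1))) * F_word l \<in> \<Lambda>"
proof (induction r)
  case 0
  then show ?case using zero_mem by simp
next
  case (Suc r)
  let ?k = "v powi (rho_weight - 2 * int (length l))"
  let ?e = "v powi (rho_weight - 2 * (int r + 1))"
  let ?c = "\<Prod>s<r. ?k - v powi (rho_weight - 2 * (int s + 1))"
  have 1: "(rho_op - const ?e) * (filter_op r * F_word l - const ?c * F_word l) \<in> \<Lambda>"
    using Suc by (intro left_mult free_alg_closed rho_op_mem)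
  have 2: "const ?c * (rho_op * F_word l - const ?k * F_word l) \<in> \<Lambda>"
    by (intro const_mem rho_op_F_word assms)
  have e: "(\<Prod>s<Suc r. ?k - v powi (rho_weight - 2 * (int s + 1))) = ?c * ?k - ?e * ?c"
    by (simp add: algebra_simps)
  have "filter_op (Suc r) * F_word l - const (?c * ?k - ?e * ?c) * F_word l =
    (rho_op - const ?e) * (filter_op r * F_word l - const ?c * F_word l)
    + const ?c * (rho_op * F_word l - const ?k * F_word l)"
    unfolding filter_op.simps single_diff
    by (simp only: right_diff_distrib left_diff_distrib mult.assoc const_mult_const
       const_left_commute[of rho_op]) simp
  then show ?case using add_mem[OF 1 2] by (simp only: e)
qed

text \<open>
  A polynomial in the \<open>F\<^sub>b\<close> with nonzero constant term cannot annihilate a highest weight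
  vector: the weights of the other terms are different from the highest one. A large \<open>filter_op\<close>
  isolates the constant term.
\<close>

lemma F_poly_const_coeff:
  assumes m: "1 \<le> m" and v: "\<And>i j :: int. v powi i = v powi j \<Longrightarrow> i = j"
    and y: "y \<in> F_polys m" "y \<in> \<Lambda>" and proper: "1 \<notin> \<Lambda>"
  shows "poly_coeff y 0 = 0"
proof (rule ccontr)
  define C where "C r = (\<Prod>s<r. v powi rho_weight - v powi (rho_weight - 2 * (int s + 1)))" for r
  have C: "C r \<noteq> 0" for r using v by (force simp: C_def)
  have "\<exists>R. \<forall>r\<ge>R. filter_op r * y - const (C r * poly_coeff y 0) \<in> \<Lambda>"
    using y(1)
  proof (induction rule: F_poly_induct)
    case zero
    then show ?case using zero_mem by simp
  next
    case (monomial l c)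
    have *: "const c * (filter_op r * F_word l - const (\<Prod>s<r. v powi (rho_weight - 2 * int (length
      l))
        - v powi (rho_weight - 2 * (int s + 1))) * F_word l) \<in> \<Lambda>" for r
      by (intro const_mem filter_op_F_word m monomial)
    show ?case
    proof (cases "l = []")
      case True
      have one: "F_word [] = 1" by (simp add: zero_word_def[symmetric])
      have "const c * (filter_op r - const (C r)) \<in> \<Lambda>" for r
        using *[of r] True by (simp only: one C_def) simp
      moreover have "const c * (filter_op r - const (C r)) = filter_op r * const c - const (C r *
        c)" for r
        unfolding right_diff_distrib const_commute[of "filter_op r" c] const_mult_single
          mult.commute[of c "C r"] ..
      ultimately have mem: "filter_op r * const c - const (C r * c) \<in> \<Lambda>" for r
        by (simp only:)
      have coeff: "poly_coeff (const c * F_word l) 0 = c"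
        unfolding True one mult_1_right by (rule lookup_single_eq)
      have word: "const c * F_word l = const c"
        unfolding True one mult_1_right ..
      show ?thesis
      proof (intro exI[of _ 0] allI impI)
        fix r
        show "filter_op r * (const c * F_word l)
            - const (C r * poly_coeff (const c * F_word l) 0) \<in> \<Lambda>"
          unfolding coeff unfolding word by (rule mem)
      qed
    next
      case False
      show ?thesis
      proof (intro exI[of _ "length l"] allI impI)
        fix r assume r: "length l \<le> r"
        have "length l - 1 < r" "int (length l - 1) = int (length l) - 1"
          using r False by (cases l; simp)+
        then have z: "(\<Prod>s<r. v powi (rho_weight - 2 * int (length l)) - v powi (rho_weight - 2 *
          (int s + 1))) = 0"
          by (intro prod_zero bexI[of _ "length l - 1"]) simp_all
        have "const c * (filter_op r * F_word l) \<in> \<Lambda>"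
          using *[of r] unfolding z single_zero mult_zero_left diff_zero .
        moreover have "poly_coeff (const c * F_word l) 0 = 0"
          unfolding const_mult_single using False by (simp add: lookup_single zero_word_def)
        ultimately show "filter_op r * (const c * F_word l)
            - const (C r * poly_coeff (const c * F_word l) 0) \<in> \<Lambda>"
          unfolding const_left_commute[of "filter_op r"]
          by (simp only: mult_zero_right single_zero diff_zero)
      qed
    qed
  next
    case (add x y)
    obtain R1 where R1: "\<forall>r\<ge>R1. filter_op r * x - const (C r * poly_coeff x 0) \<in> \<Lambda>" using add
      by blast
    obtain R2 where R2: "\<forall>r\<ge>R2. filter_op r * y - const (C r * poly_coeff y 0) \<in> \<Lambda>" using add
      by blast
    show ?case
    proof (intro exI[of _ "max R1 R2"] allI impI)
      fix r assume r: "max R1 R2 \<le> r"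
      have "(filter_op r * x - const (C r * poly_coeff x 0)) +
          (filter_op r * y - const (C r * poly_coeff y 0)) \<in> \<Lambda>"
        using R1 R2 r by (intro add_mem) auto
      then show "filter_op r * (x + y) - const (C r * poly_coeff (x + y) 0) \<in> \<Lambda>"
        by (simp add: lookup_add distrib_left single_add add_diff_add)
    qed
  qed
  then obtain r where "filter_op r * y - const (C r * poly_coeff y 0) \<in> \<Lambda>" by blast
  moreover have "filter_op r * y \<in> \<Lambda>" by (rule left_mult[OF filter_op_mem y(2)])
  ultimately have "const (C r * poly_coeff y 0) \<in> \<Lambda>" using diff by fastforce
  then have "const (inverse (C r * poly_coeff y 0)) * const (C r * poly_coeff y 0) \<in> \<Lambda>"
    by (rule const_mem)
  moreover assume "poly_coeff y 0 \<noteq> 0"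
  then have "inverse (C r * poly_coeff y 0) * (C r * poly_coeff y 0) = 1"
    using C by (intro left_inverse) simp
  ultimately show False using proper unfolding const_mult_single by (metis single_one)
qed

end

text \<open>
  Two nonzero highest weight vectors of the same weight cannot be separated: no \<open>p\<close> fixes the
  first and kills the second. Modulo both ideals at once, \<open>p\<close> is a polynomial in the \<open>F\<^sub>b\<close>, and
  its constant term would have to be \<open>1\<close> for the one vector and \<open>0\<close> for the other.
\<close>

proposition highest_weight_ideals_not_coprime:
  assumes L1: "highest_weight_ideal m v w \<Lambda>1" and L2: "highest_weight_ideal m v w \<Lambda>2"
    and m: "1 \<le> m" and v: "\<And>i j :: int. v powi i = v powi j \<Longrightarrow> i = j"
    and proper: "1 \<notin> \<Lambda>1" "1 \<notin> \<Lambda>2"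
    and p: "p \<in> gen_polys m" "p \<in> \<Lambda>2"
  shows "1 - p \<notin> \<Lambda>1"
proof
  assume 1: "1 - p \<in> \<Lambda>1"
  obtain y where y: "y \<in> F_polys m" "p - y \<in> \<Lambda>1" "p - y \<in> \<Lambda>2"
    using highest_weight_ideal.all_reducible[OF highest_weight_ideal_Int[OF L1 L2] p(1)] by auto
  have "y \<in> \<Lambda>2" using highest_weight_ideal.diff[OF L2 p(2) y(3)] by simp
  then have "poly_coeff y 0 = 0"
    using highest_weight_ideal.F_poly_const_coeff[OF L2 m v y(1)] proper by blast
  moreover have "1 - y \<in> \<Lambda>1" using highest_weight_ideal.add_mem[OF L1 1 y(2)] by simp
  then have "poly_coeff (1 - y) 0 = 0"
    using highest_weight_ideal.F_poly_const_coeff[OF L1 m v free_alg_diff[OF free_alg_one y(1)]]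
      proper
    by blast
  ultimately show False by (simp add: lookup_minus)
qed

section \<open>Subspaces of a finite vector space\<close>

locale finite_vector_space = vector_space s
  for s :: "'k::{field,finite} \<Rightarrow> 'v::{ab_group_add,finite} \<Rightarrow> 'v"

sublocale finite_vector_space \<subseteq> finite_dimensional_vector_space s "extend_basis {}"
  by unfold_locales (simp_all add: independent_extend_basis[OF independent_empty]
    span_extend_basis[OF independent_empty])

definition ssum :: "'v::ab_group_add set \<Rightarrow> 'v set \<Rightarrow> 'v set" where
  "ssum S T = {x + y | x y. x \<in> S \<and> y \<in> T}"

context finite_vector_space
begin

abbreviation adj :: "'v \<Rightarrow> 'v set \<Rightarrow> 'v set" where
  "adj x Z \<equiv> span (insert x Z)"

lemma mem_adj: "subspace Z \<Longrightarrow> y \<in> adj x Z \<longleftrightarrow> (\<exists>k. y - s k x \<in> Z)"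
  by (metis span_breakdown_eq span_eq_iff)

lemma subset_adj: "Z \<subseteq> adj x Z" and self_adj: "x \<in> adj x Z"
  by (auto intro: span_base)

lemma adj_redundant: "subspace Z \<Longrightarrow> x \<in> Z \<Longrightarrow> adj x Z = Z"
  by (simp add: insert_absorb)

lemma adj_subset: "subspace Y \<Longrightarrow> Z \<subseteq> Y \<Longrightarrow> x \<in> Y \<Longrightarrow> adj x Z \<subseteq> Y"
  by (simp add: span_minimal)

lemma dim_adj: "subspace Z \<Longrightarrow> x \<notin> Z \<Longrightarrow> dim (adj x Z) = dim Z + 1"
  by (metis dim_insert dim_span span_eq_iff)

lemma adj_eq:
  assumes "subspace Z" "subspace W" "Z \<subseteq> W" "dim W = dim Z + 1" "x \<in> W" "x \<notin> Z"
  shows "adj x Z = W"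
  using assms adj_subset dim_adj by (intro subspace_dim_equal) auto

lemma adj_translate:
  assumes "subspace Z" "z \<in> Z"
  shows "adj (x + z) Z = adj x Z"
proof -
  have "x + z \<in> adj x Z" using assms self_adj subset_adj subspace_span
    by (meson span_add span_base subset_iff insertI1 insertI2)
  moreover have "x \<in> adj (x + z) Z"
    using assms by (metis add_diff_cancel_right' insertI1 insertI2 span_base span_diff)
  ultimately show ?thesis by (simp add: span_eq subset_adj)
qed

lemma subspace_ssum: "subspace S \<Longrightarrow> subspace T \<Longrightarrow> subspace (ssum S T)"
  unfolding ssum_def by (rule subspace_sums)

lemma ssum_upper1: "subspace T \<Longrightarrow> S \<subseteq> ssum S T"
  unfolding ssum_def using subspace_0 by force

lemma ssum_upper2: "subspace S \<Longrightarrow> T \<subseteq> ssum S T"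
  unfolding ssum_def using subspace_0 by force

lemma ssum_least: "subspace W \<Longrightarrow> S \<subseteq> W \<Longrightarrow> T \<subseteq> W \<Longrightarrow> ssum S T \<subseteq> W"
  unfolding ssum_def using subspace_add by blast

lemma ssum_mono: "S \<subseteq> S' \<Longrightarrow> T \<subseteq> T' \<Longrightarrow> ssum S T \<subseteq> ssum S' T'"
  unfolding ssum_def by blast

lemma ssum_absorb: "subspace S \<Longrightarrow> subspace T \<Longrightarrow> T \<subseteq> S \<Longrightarrow> ssum S T = S"
  using ssum_least[of S S T] ssum_upper1[of T S] by blast

lemma ssum_commute: "ssum S T = ssum T S"
  unfolding ssum_def by (auto simp: add.commute) (metis add.commute)+

lemma dim_ssum: "subspace S \<Longrightarrow> subspace T \<Longrightarrow> dim (ssum S T) + dim (S \<inter> T) = dim S + dim T"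
  unfolding ssum_def by (rule dim_sums_Int)

lemma modular_law:
  assumes "subspace Y" "Z \<subseteq> Y"
  shows "Y \<inter> ssum Z C = ssum Z (Y \<inter> C)"
proof
  show "Y \<inter> ssum Z C \<subseteq> ssum Z (Y \<inter> C)"
  proof
    fix y assume y: "y \<in> Y \<inter> ssum Z C"
    then obtain z c where *: "z \<in> Z" "c \<in> C" "y = z + c" by (auto simp: ssum_def)
    then have "c \<in> Y" using y assms subspace_diff[of Y y z] by auto
    then show "y \<in> ssum Z (Y \<inter> C)" using * by (auto simp: ssum_def)
  qed
  show "ssum Z (Y \<inter> C) \<subseteq> Y \<inter> ssum Z C"
    using assms subspace_add by (fastforce simp: ssum_def)
qed

lemma ssum_adj:
  assumes "subspace Z" "subspace C"
  shows "ssum (adj x Z) C = adj x (ssum Z C)"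
proof
  have "adj x Z \<subseteq> adj x (ssum Z C)" using ssum_upper1[OF assms(2)] by (intro span_mono) auto
  moreover have "C \<subseteq> adj x (ssum Z C)" using ssum_upper2[OF assms(1)] subset_adj by blast
  ultimately show "ssum (adj x Z) C \<subseteq> adj x (ssum Z C)" by (intro ssum_least) auto
  have "ssum Z C \<subseteq> ssum (adj x Z) C" by (intro ssum_mono subset_adj) auto
  moreover have "x \<in> ssum (adj x Z) C" using ssum_upper1[OF assms(2)] self_adj by blast
  ultimately show "adj x (ssum Z C) \<subseteq> ssum (adj x Z) C"
    using assms by (intro adj_subset subspace_ssum) auto
qed

text \<open>
  Adjoining a vector outside \<open>Z + C\<close> enlarges the image modulo \<open>C\<close> and leaves the intersection
  with \<open>C\<close> alone; adjoining a vector of \<open>C\<close> does the opposite.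
\<close>

lemma adj_Int_outside:
  assumes Z: "subspace Z" and C: "subspace C" and x: "x \<notin> ssum Z C"
  shows "adj x Z \<inter> C = Z \<inter> C"
proof -
  have "y \<in> Z" if y: "y \<in> adj x Z" "y \<in> C" for y
  proof -
    obtain k where k: "y - s k x \<in> Z" using y mem_adj[OF Z] by blast
    have "k = 0"
    proof (rule ccontr)
      assume k0: "k \<noteq> 0"
      have "s k x = - (y - s k x) + y" by simp
      moreover have "- (y - s k x) \<in> Z" using k Z by (rule subspace_neg[rotated])
      ultimately have "s k x \<in> ssum Z C" using y unfolding ssum_def by blast
      then have "s (inverse k) (s k x) \<in> ssum Z C"
        by (rule subspace_scale[OF subspace_ssum[OF Z C]])
      then show False using k0 x by simp
    qed
    then show ?thesis using k by simp
  qed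
  then show ?thesis using subset_adj by blast
qed

lemma adj_Int_inside:
  assumes "subspace Z" "subspace C" "c \<in> C"
  shows "adj c Z \<inter> C = adj c (Z \<inter> C)"
proof
  show "adj c (Z \<inter> C) \<subseteq> adj c Z \<inter> C"
    using assms by (intro adj_subset subspace_inter) (auto simp: span_base)
  show "adj c Z \<inter> C \<subseteq> adj c (Z \<inter> C)"
    using assms subspace_diff subspace_scale
    by (auto simp: mem_adj subspace_inter)
qed

text \<open>
  Sum \<open>h (x + t)\<close> over all pairs \<open>(x, t) \<in> S \<times> T\<close> in two ways; every element of \<open>S + T\<close> is hit
  \<open>card (S \<inter> T)\<close> times.
\<close>

lemma sum_over_ssum:
  fixes h :: "'v \<Rightarrow> complex"
  assumes S: "subspace S" and T: "subspace T" and h: "\<And>x t. t \<in> T \<Longrightarrow> h (x + t) = h x"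
  shows "of_nat (card (S \<inter> T)) * (\<Sum>x\<in>ssum S T. h x) = of_nat (card T) * (\<Sum>x\<in>S. h x)"
proof -
  let ?f = "\<lambda>p. fst p + snd p"
  have fiber: "card {p \<in> S \<times> T. ?f p = x} = card (S \<inter> T)" if x: "x \<in> ssum S T" for x
  proof -
    obtain a b where ab: "a \<in> S" "b \<in> T" "x = a + b" using x by (auto simp: ssum_def)
    have "bij_betw (\<lambda>u. (a + u, b - u)) (S \<inter> T) {p \<in> S \<times> T. ?f p = x}"
    proof (rule bij_betw_byWitness[where f' = "\<lambda>p. fst p - a"])
      show "(\<lambda>p. fst p - a) ` {p \<in> S \<times> T. ?f p = x} \<subseteq> S \<inter> T"
      proof
        fix u assume "u \<in> (\<lambda>p. fst p - a) ` {p \<in> S \<times> T. ?f p = x}"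
        then obtain p q where p: "p \<in> S" "q \<in> T" "p + q = a + b" "u = p - a" using ab by auto
        have "p - a = b - q" using p(3) by (simp add: algebra_simps)
        then show "u \<in> S \<inter> T"
          using subspace_diff[OF S p(1) ab(1)] subspace_diff[OF T ab(2) p(2)] p(4) by (metis IntI)
      qed
      show "(\<lambda>u. (a + u, b - u)) ` (S \<inter> T) \<subseteq> {p \<in> S \<times> T. ?f p = x}"
        using ab subspace_add[OF S] subspace_diff[OF T] by auto
      show "\<forall>p\<in>{p \<in> S \<times> T. ?f p = x}. (a + (fst p - a), b - (fst p - a)) = p"
      proof
        fix p assume p: "p \<in> {p \<in> S \<times> T. ?f p = x}"
        then have "fst p + snd p = a + b" using ab(3) by blast
        then have "snd p = a + b - fst p" by (metis add_diff_cancel_left')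
        moreover have "b - (fst p - a) = a + b - fst p" by (simp add: diff_diff_eq2 add.commute)
        moreover have "a + (fst p - a) = fst p" by simp
        ultimately show "(a + (fst p - a), b - (fst p - a)) = p"
          unfolding prod_eq_iff fst_conv snd_conv by (metis (no_types))
      qed
    qed simp
    from bij_betw_same_card[OF this] show ?thesis by simp
  qed
  have "(\<Sum>p\<in>S \<times> T. h (?f p)) = (\<Sum>x\<in>ssum S T. \<Sum>p\<in>{p \<in> S \<times> T. ?f p = x}. h (?f p))"
    by (rule sum.group[symmetric]) (simp, simp, force simp: ssum_def)
  also have "\<dots> = (\<Sum>x\<in>ssum S T. of_nat (card (S \<inter> T)) * h x)"
    by (intro sum.cong refl) (simp add: fiber)
  finally have 1: "(\<Sum>p\<in>S \<times> T. h (?f p)) = of_nat (card (S \<inter> T)) * (\<Sum>x\<in>ssum S T. h x)"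
    by (simp add: sum_distrib_left)
  have "(\<Sum>p\<in>S \<times> T. h (?f p)) = (\<Sum>x\<in>S. \<Sum>t\<in>T. h (x + t))"
    by (simp add: sum.cartesian_product split_def)
  also have "\<dots> = of_nat (card T) * (\<Sum>x\<in>S. h x)"
    by (simp add: h sum_distrib_left)
  finally show ?thesis using 1 by simp
qed

lemma card_subspace_pos: "subspace S \<Longrightarrow> card S \<noteq> 0"
  using subspace_0 by auto

lemma card_adj:
  assumes Z: "subspace Z" and x: "x \<notin> Z"
  shows "card (adj x Z) = CARD('k) * card Z"
proof -
  let ?f = "\<lambda>(k, z). s k x + z"
  have "inj_on ?f (UNIV \<times> Z)"
  proof (rule inj_onI, clarify)
    fix k z k' z' assume zz: "z \<in> Z" "z' \<in> Z" and e: "s k x + z = s k' x + z'"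
    have "s (k - k') x = z' - z" using e by (simp add: scale_left_diff_distrib algebra_simps)
    then have mem: "s (k - k') x \<in> Z" using zz Z by (simp add: subspace_diff)
    have "k = k'"
    proof (rule ccontr)
      assume "k \<noteq> k'"
      then have "x = s (inverse (k - k')) (s (k - k') x)" by simp
      then show False using mem Z x by (metis subspace_scale)
    qed
    then show "k = k' \<and> z = z'" using e by simp
  qed
  moreover have "?f ` (UNIV \<times> Z) = adj x Z"
  proof
    show "?f ` (UNIV \<times> Z) \<subseteq> adj x Z" by (auto simp: mem_adj[OF Z])
       (metis add_diff_cancel_left')
    show "adj x Z \<subseteq> ?f ` (UNIV \<times> Z)"
    proof
      fix y assume "y \<in> adj x Z"
      then obtain k where k: "y - s k x \<in> Z" using mem_adj[OF Z] by blast
      then show "y \<in> ?f ` (UNIV \<times> Z)" by (intro image_eqI[of _ _ "(k, y - s k x)"]) auto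
    qed
  qed
  ultimately have "card (adj x Z) = card ((UNIV :: 'k set) \<times> Z)" using card_image by metis
  then show ?thesis by (simp add: card_cartesian_product)
qed

lemma card_adj_fiber:
  assumes Y: "subspace Y" "Z \<subseteq> Y" and Z: "subspace Z" and x: "x \<in> Y" "x \<notin> Z"
  shows "card {y \<in> Y - Z. adj y Z = adj x Z} = (CARD('k) - 1) * card Z"
proof -
  have "{y \<in> Y - Z. adj y Z = adj x Z} = adj x Z - Z"
  proof
    show "{y \<in> Y - Z. adj y Z = adj x Z} \<subseteq> adj x Z - Z" using self_adj by blast
    show "adj x Z - Z \<subseteq> {y \<in> Y - Z. adj y Z = adj x Z}"
    proof clarify
      fix y assume y: "y \<in> adj x Z" "y \<notin> Z"
      then have "y \<in> Y" using adj_subset[OF Y x(1)] by blast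
      moreover have "adj y Z = adj x Z"
        using y by (intro adj_eq[OF Z subspace_span subset_adj dim_adj[OF Z x(2)]])
      ultimately show "y \<in> Y - Z \<and> adj y Z = adj x Z" using y by blast
    qed
  qed
  then show ?thesis using card_adj[OF Z x(2)] subset_adj[of Z x]
    by (simp add: card_Diff_subset diff_mult_distrib)
qed

text \<open>
  The subspaces between \<open>Z\<close> and \<open>Y\<close> of dimension one more than \<open>Z\<close> are all spanned over \<open>Z\<close> by
  the same number of vectors, so summing over vectors or over subspaces is the same up to a
  nonzero factor. Sums over vectors are easier to split and to translate.
\<close>

lemma sum_adj:
  fixes g :: "'v set \<Rightarrow> complex"
  assumes "subspace Y" "Z \<subseteq> Y" "subspace Z"
  shows "(\<Sum>x\<in>Y - Z. g (adj x Z)) =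
    of_nat ((CARD('k) - 1) * card Z) * (\<Sum>W\<in>(\<lambda>x. adj x Z) ` (Y - Z). g W)"
proof -
  have "(\<Sum>x\<in>Y - Z. g (adj x Z)) =
      (\<Sum>W\<in>(\<lambda>x. adj x Z) ` (Y - Z). \<Sum>x\<in>{x \<in> Y - Z. adj x Z = W}. g (adj x Z))"
    by (rule sum.image_gen) simp
  also have "\<dots> = (\<Sum>W\<in>(\<lambda>x. adj x Z) ` (Y - Z). of_nat ((CARD('k) - 1) * card Z) * g W)"
  proof (intro sum.cong refl)
    fix W assume "W \<in> (\<lambda>x. adj x Z) ` (Y - Z)"
    then obtain x where x: "x \<in> Y" "x \<notin> Z" "W = adj x Z" by auto
    have "(\<Sum>x\<in>{x \<in> Y - Z. adj x Z = W}. g (adj x Z)) = of_nat (card {x \<in> Y - Z. adj x Z = W}) * g W"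
      by simp
    then show "(\<Sum>x\<in>{x \<in> Y - Z. adj x Z = W}. g (adj x Z)) = of_nat ((CARD('k) - 1) * card Z) * g W"
      using card_adj_fiber[OF assms x(1,2)] x(3) by simp
  qed
  finally show ?thesis by (simp add: sum_distrib_left)
qed

lemma card_field_gt_1: "1 < CARD('k)"
proof -
  have "card {0, 1 :: 'k} \<le> CARD('k)" by (rule card_mono) auto
  then show ?thesis by simp
qed

lemma dim_span_union_le: "finite T \<Longrightarrow> dim (span (W \<union> e ` T)) \<le> dim W + card T"
proof (induction T rule: finite_induct)
  case (insert x T)
  have "span (W \<union> e ` insert x T) = span (insert (e x) (W \<union> e ` T))" by simp
  then have "dim (span (W \<union> e ` insert x T)) \<le> dim (span (W \<union> e ` T)) + 1"
    by (simp add: dim_insert)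
  then show ?case using insert by simp
qed simp

lemma extension_exists:
  assumes A: "subspace A" and B: "subspace B" and AB: "A \<subseteq> B" and r: "dim A + r \<le> dim B"
  shows "\<exists>e. e ` {..<r} \<subseteq> B \<and> dim (span (A \<union> e ` {..<r :: nat})) = dim A + r"
  using r
proof (induction r)
  case 0
  then show ?case by simp
next
  case (Suc r)
  then obtain e where e: "e ` {..<r} \<subseteq> B" "dim (span (A \<union> e ` {..<r})) = dim A + r" by auto
  have "span (A \<union> e ` {..<r}) \<noteq> B" using e(2) Suc.prems by auto
  moreover have "span (A \<union> e ` {..<r}) \<subseteq> B" using e(1) AB B by (simp add: span_minimal)
  ultimately obtain x where x: "x \<in> B" "x \<notin> span (A \<union> e ` {..<r})" by blast
  let ?e = "e(r := x)"
  have im: "?e ` {..<Suc r} = insert x (e ` {..<r})" by (auto simp: lessThan_Suc)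
  have "A \<union> ?e ` {..<Suc r} = insert x (A \<union> e ` {..<r})" unfolding im by blast
  then have "dim (span (A \<union> ?e ` {..<Suc r})) = dim (insert x (A \<union> e ` {..<r}))"
    by (simp only: dim_span)
  then have "dim (span (A \<union> ?e ` {..<Suc r})) = dim A + Suc r"
    using x(2) e(2) by (simp add: dim_insert)
  moreover have "?e ` {..<Suc r} \<subseteq> B" unfolding im using e(1) x(1) by blast
  ultimately show ?case by blast
qed

lemma intermediate_exists:
  assumes "subspace A" "subspace B" "A \<subseteq> B" "dim A + r \<le> dim B"
  obtains C where "subspace C" "A \<subseteq> C" "C \<subseteq> B" "dim C = dim A + r"
proof -
  obtain e where e: "e ` {..<r} \<subseteq> B" "dim (span (A \<union> e ` {..<r})) = dim A + r"
    using extension_exists[OF assms] by blast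
  have "A \<subseteq> span (A \<union> e ` {..<r})" using span_superset by blast
  moreover have "span (A \<union> e ` {..<r}) \<subseteq> B" using e(1) assms(2,3) by (simp add: span_minimal)
  ultimately show ?thesis using that[OF subspace_span _ _ e(2)] by blast
qed

lemma dim_extension:
  assumes e: "dim (span (A \<union> e ` {..<r :: nat})) = dim A + r" and S: "S \<subseteq> {..<r}"
  shows "dim (span (A \<union> e ` S)) = dim A + card S"
proof (rule antisym)
  have fin: "finite S" using S finite_subset by blast
  then show "dim (span (A \<union> e ` S)) \<le> dim A + card S" by (rule dim_span_union_le)
  have "(A \<union> e ` S) \<union> e ` ({..<r} - S) = A \<union> e ` {..<r}" using S by auto
  then have "dim A + r \<le> dim (A \<union> e ` S) + card ({..<r} - S)"
    using dim_span_union_le[of "{..<r} - S" "A \<union> e ` S" e] e by simp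
  moreover have "card ({..<r} - S) = r - card S" "card S \<le> r"
    using S fin card_mono[OF _ S] by (auto simp: card_Diff_subset)
  ultimately show "dim A + card S \<le> dim (span (A \<union> e ` S))" by simp
qed

lemma relative_complement_exists:
  assumes A: "subspace A" and C: "subspace C" and B: "subspace B" and "A \<subseteq> C" "C \<subseteq> B"
  obtains T where "subspace T" "ssum T C = B" "T \<inter> C = A"
proof -
  define r where "r = dim B - dim C"
  have dB: "dim B = dim C + r" using dim_subset[OF \<open>C \<subseteq> B\<close>] by (simp add: r_def)
  obtain e where e: "e ` {..<r} \<subseteq> B" "dim (span (C \<union> e ` {..<r})) = dim C + r"
    using extension_exists[OF C B \<open>C \<subseteq> B\<close>, of r, OF eq_refl[OF dB[symmetric]]] by blast
  define T where "T = span (A \<union> e ` {..<r})"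
  have T: "subspace T" "A \<subseteq> T" "e ` {..<r} \<subseteq> T" 
    using span_superset[of "A \<union> e ` {..<r}"] by (auto simp: T_def)
  have TB: "T \<subseteq> B" unfolding T_def using e(1) assms by (intro span_minimal) auto
  have "span (C \<union> e ` {..<r}) \<subseteq> ssum T C"
    using ssum_upper1[OF C, of T] ssum_upper2[OF T(1), of C] T C
    by (intro span_minimal subspace_ssum) auto
  then have "dim B \<le> dim (ssum T C)" using dim_subset e(2) dB by metis
  then have 1: "ssum T C = B"
    using ssum_least[OF B TB \<open>C \<subseteq> B\<close>] T C B by (intro subspace_dim_equal subspace_ssum) auto
  have "dim T \<le> dim A + r" unfolding T_def using dim_span_union_le[of "{..<r}" A e] by simp
  then have "dim (T \<inter> C) \<le> dim A" using dim_ssum[OF T(1) C] 1 dB by simp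
  then have "A = T \<inter> C"
    using assms T by (intro subspace_dim_equal subspace_inter) auto
  then show ?thesis using that T(1) 1 by simp
qed

end

section \<open>Singular functions on chains of subspaces\<close>

text \<open>
  The space directly above position \<open>a\<close> in the \<open>U\<close>-part of a flag, where \<open>B\<close> is the top space.
\<close>

fun upper :: "nat \<Rightarrow> 'v set \<Rightarrow> (node \<Rightarrow> 'v set) \<Rightarrow> node \<Rightarrow> 'v set" where
  "upper m B U (Node_j \<beta>) = (if \<beta> = m then B else U (Node_j (\<beta> + 1)))"
| "upper m B U a = U (Node_j 1)"

lemma Node_j_mem [simp]: "Node_j \<beta> \<in> nodes m \<longleftrightarrow> 1 \<le> \<beta> \<and> \<beta> \<le> m"
  and Node_i_mem [simp]: "Node_i \<in> nodes m" and Node_k_mem [simp]: "Node_k \<in> nodes m"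
  by (auto simp: nodes_def)

lemma upper_upd: "upper m B (U(a := W)) a = upper m B U a"
  by (cases a) auto

context finite_vector_space
begin

text \<open>
  The \<open>U\<close>-parts of flags with vanishing \<open>V\<close>-spaces, more generally in a subquotient \<open>B / A\<close>; its
  subspaces are represented by the subspaces between \<open>A\<close> and \<open>B\<close>. The values off \<open>nodes m\<close> are
  left free, because they would not survive intersecting with or adding another subspace.
\<close>

definition chains :: "nat \<Rightarrow> 'v set \<Rightarrow> 'v set \<Rightarrow> (node \<Rightarrow> 'v set) set" where
  "chains m A B = {U. \<forall>a \<in> nodes m. subspace (U a) \<and> A \<subseteq> U a \<and> U a \<subseteq> upper m B U a}"

text \<open>
  The nonzero functions of dimension vector \<open>\<nu>\<close> that are killed by all \<open>E\<^sub>a\<close>, see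
  \<open>E_extend_by_zero\<close>; the subspaces enlarging \<open>U a\<close> by one dimension are counted through the
  vectors that span them.
\<close>

definition singular :: "nat \<Rightarrow> 'v set \<Rightarrow> 'v set \<Rightarrow> (node \<Rightarrow> nat) \<Rightarrow> ((node \<Rightarrow> 'v set) \<Rightarrow> complex) \<Rightarrow> bool"
  where
  "singular m A B \<nu> \<phi> \<longleftrightarrow>
     (\<forall>U U'. (\<forall>a \<in> nodes m. U a = U' a) \<longrightarrow> \<phi> U = \<phi> U') \<and>
     (\<exists>U \<in> chains m A B. \<phi> U \<noteq> 0) \<and>
     (\<forall>U \<in> chains m A B. \<phi> U \<noteq> 0 \<longrightarrow> (\<forall>a \<in> nodes m. dim (U a) = dim A + \<nu> a)) \<and>
     (\<forall>U \<in> chains m A B. \<forall>a \<in> nodes m. (\<Sum>x\<in>upper m B U a - U a. \<phi> (U(a := adj x (U a)))) = 0)"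

lemma singular_local:
  "singular m A B \<nu> \<phi> \<Longrightarrow> (\<And>a. a \<in> nodes m \<Longrightarrow> U a = U' a) \<Longrightarrow> \<phi> U = \<phi> U'"
  unfolding singular_def by blast

lemma singular_dim:
  "singular m A B \<nu> \<phi> \<Longrightarrow> U \<in> chains m A B \<Longrightarrow> \<phi> U \<noteq> 0 \<Longrightarrow> a \<in> nodes m \<Longrightarrow>
    dim (U a) = dim A + \<nu> a"
  unfolding singular_def by blast

lemma singular_sum:
  "singular m A B \<nu> \<phi> \<Longrightarrow> U \<in> chains m A B \<Longrightarrow> a \<in> nodes m \<Longrightarrow>
    (\<Sum>x\<in>upper m B U a - U a. \<phi> (U(a := adj x (U a)))) = 0"
  unfolding singular_def by blast

lemma chainsD:
  assumes "U \<in> chains m A B" "a \<in> nodes m"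
  shows "subspace (U a)" "A \<subseteq> U a" "U a \<subseteq> upper m B U a"
  using assms by (auto simp: chains_def)

lemma chains_subset:
  assumes U: "U \<in> chains m A B" and m: "1 \<le> m" and a: "a \<in> nodes m"
  shows "U a \<subseteq> B"
proof -
  have j: "U (Node_j \<beta>) \<subseteq> B" if "1 \<le> \<beta>" "\<beta> \<le> m" for \<beta>
    using that(2,1)
  proof (induction rule: inc_induct)
    case base
    then show ?case using chainsD(3)[OF U, of "Node_j m"] by simp
  next
    case (step \<beta>)
    then show ?case using chainsD(3)[OF U, of "Node_j \<beta>"] by auto
  qed
  show ?thesis
  proof (cases a)
    case (Node_j \<beta>)
    then show ?thesis using j a by simp
  qed (use chainsD(3)[OF U a] j[of 1] m in auto)
qed

lemma upper_subspace:
  assumes U: "U \<in> chains m A B" and m: "1 \<le> m" and a: "a \<in> nodes m" and B: "subspace B"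
  shows "subspace (upper m B U a)"
  using a m B by (cases a) (auto intro!: chainsD(1)[OF U])

lemma upper_subset:
  assumes U: "U \<in> chains m A B" and m: "1 \<le> m" and a: "a \<in> nodes m"
  shows "upper m B U a \<subseteq> B"
  using a m by (cases a) (auto dest: chains_subset[OF U m, THEN subsetD, rotated])

lemma upper_Int: "B \<inter> C = C \<Longrightarrow> upper m C (\<lambda>a. U a \<inter> C) a = upper m B U a \<inter> C"
  by (cases a) auto

lemma upper_ssum: "ssum B C = B \<Longrightarrow> upper m B (\<lambda>a. ssum (U a) C) a = ssum (upper m B U a) C"
  by (cases a) auto

text \<open>
  A chain \<open>U\<close> in \<open>B / A\<close> induces the chains of all \<open>U a \<inter> C\<close> in \<open>C / A\<close> and of all \<open>U a + C\<close> in
  \<open>B / C\<close>. Enlarging \<open>U a\<close> by one vector enlarges exactly one of the two. If the vector lies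
  outside \<open>U a + C\<close>, the first factor stays fixed and the sum over the second vanishes;
  otherwise the roles are exchanged. Each enlargement of an induced chain comes from the same
  number of vectors.
\<close>

proposition singular_product:
  assumes m: "1 \<le> m" and A: "subspace A" and C: "subspace C" and B: "subspace B"
    and AC: "A \<subseteq> C" and CB: "C \<subseteq> B"
    and s1: "singular m A C \<nu>1 \<phi>1" and s2: "singular m C B \<nu>2 \<phi>2"
  shows "singular m A B (\<lambda>a. \<nu>1 a + \<nu>2 a) (\<lambda>U. \<phi>1 (\<lambda>a. U a \<inter> C) * \<phi>2 (\<lambda>a. ssum (U a) C))"
proof -
  have BC: "B \<inter> C = C" "ssum B C = B" using CB ssum_absorb[OF B C] by auto
  have low: "(\<lambda>a. U a \<inter> C) \<in> chains m A C" if U: "U \<in> chains m A B" for U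
    unfolding chains_def
  proof (intro CollectI ballI)
    fix a assume "a \<in> nodes m"
    note D = chainsD[OF U this]
    show "subspace (U a \<inter> C) \<and> A \<subseteq> U a \<inter> C \<and> U a \<inter> C \<subseteq> upper m C (\<lambda>a. U a \<inter> C) a"
      unfolding upper_Int[OF BC(1)] using subspace_inter[OF D(1) C] D AC by blast
  qed
  have high: "(\<lambda>a. ssum (U a) C) \<in> chains m C B" if U: "U \<in> chains m A B" for U
    unfolding chains_def
  proof (intro CollectI ballI)
    fix a assume "a \<in> nodes m"
    note D = chainsD[OF U this]
    show "subspace (ssum (U a) C) \<and> C \<subseteq> ssum (U a) C \<and> ssum (U a) C \<subseteq> upper m B (\<lambda>a. ssum (U a) C)
      a"
      unfolding upper_ssum[OF BC(2)] using subspace_ssum[OF D(1) C] ssum_upper2[OF D(1)]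
        ssum_mono[OF D(3) order_refl] by blast
  qed
  show ?thesis unfolding singular_def
  proof (intro conjI ballI allI impI)
    fix U U' assume "\<forall>a\<in>nodes m. U a = (U' a :: 'v set)"
    then have "\<phi>1 (\<lambda>a. U a \<inter> C) = \<phi>1 (\<lambda>a. U' a \<inter> C)"
      "\<phi>2 (\<lambda>a. ssum (U a) C) = \<phi>2 (\<lambda>a. ssum (U' a) C)"
      by (intro singular_local[OF s1] singular_local[OF s2]; simp)+
    then show "\<phi>1 (\<lambda>a. U a \<inter> C) * \<phi>2 (\<lambda>a. ssum (U a) C) =
        \<phi>1 (\<lambda>a. U' a \<inter> C) * \<phi>2 (\<lambda>a. ssum (U' a) C)" by simp
  next
    obtain U1 where U1: "U1 \<in> chains m A C" "\<phi>1 U1 \<noteq> 0" using s1 by (auto simp: singular_def)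
    obtain U2 where U2: "U2 \<in> chains m C B" "\<phi>2 U2 \<noteq> 0" using s2 by (auto simp: singular_def)
    \<comment> \<open>a relative complement of \<open>C\<close> glues two given chains to one that induces both\<close>
    obtain T where T: "subspace T" "ssum T C = B" "T \<inter> C = A"
      using relative_complement_exists[OF A C B AC CB] by blast
    define U where "U a = ssum (U1 a) (U2 a \<inter> T)" for a
    have TB: "B \<inter> T = T" using ssum_upper1[OF C, of T] T(2) by blast
    have up: "upper m B U a = ssum (upper m C U1 a) (upper m B U2 a \<inter> T)" for a
      using T(2) ssum_commute[of T C] by (cases a) (auto simp: U_def TB)
    have Uc: "U \<in> chains m A B"
      unfolding chains_def
    proof (intro CollectI ballI)
      fix a assume a: "a \<in> nodes m"
      note D1 = chainsD[OF U1(1) a] and D2 = chainsD[OF U2(1) a]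
      have T2: "subspace (U2 a \<inter> T)" using D2(1) T(1) by (rule subspace_inter)
      show "subspace (U a) \<and> A \<subseteq> U a \<and> U a \<subseteq> upper m B U a"
        unfolding up unfolding U_def using subspace_ssum[OF D1(1) T2] D1(2) ssum_upper1[OF T2, of
          "U1 a"]
          ssum_mono[OF D1(3), of "U2 a \<inter> T" "upper m B U2 a \<inter> T"] D2(3) by blast
    qed
    have on: "U a \<inter> C = U1 a \<and> ssum (U a) C = U2 a" if a: "a \<in> nodes m" for a
    proof
      note D1 = chainsD[OF U1(1) a] and D2 = chainsD[OF U2(1) a]
      have 1: "U1 a \<subseteq> C" using chains_subset[OF U1(1) m a] .
      have 2: "U2 a \<subseteq> B" using chains_subset[OF U2(1) m a] .
      have "U a \<inter> C = ssum (U1 a) (C \<inter> (U2 a \<inter> T))"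
        unfolding U_def using modular_law[OF C 1] by blast
      also have "C \<inter> (U2 a \<inter> T) = A" using D2(2) T(3) AC by blast
      also have "ssum (U1 a) A = U1 a" using D1 A by (intro ssum_absorb)
      finally show "U a \<inter> C = U1 a" .
      have "U2 a = U2 a \<inter> ssum C T" using 2 T(2) ssum_commute[of T C] by blast
      also have "\<dots> = ssum C (U2 a \<inter> T)" using D2 by (intro modular_law)
      also have "\<dots> \<subseteq> ssum (U a) C"
        unfolding U_def using D1 D2 T(1) C
        by (intro ssum_least subspace_ssum subspace_inter ssum_upper2 order_trans[OF _
          ssum_upper1[OF C]])
      finally show "ssum (U a) C = U2 a"
        unfolding U_def using 1 D2
        by (intro antisym ssum_least) auto
    qed
    have "\<phi>1 (\<lambda>a. U a \<inter> C) = \<phi>1 U1" "\<phi>2 (\<lambda>a. ssum (U a) C) = \<phi>2 U2"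
      using on by (intro singular_local[OF s1] singular_local[OF s2]; simp)+
    then show "\<exists>U\<in>chains m A B. \<phi>1 (\<lambda>a. U a \<inter> C) * \<phi>2 (\<lambda>a. ssum (U a) C) \<noteq> 0"
      using Uc U1(2) U2(2) by (intro bexI[of _ U]) simp_all
  next
    fix U a assume U: "U \<in> chains m A B" and nz: "\<phi>1 (\<lambda>a. U a \<inter> C) * \<phi>2 (\<lambda>a. ssum (U a) C) \<noteq> 0"
      and a: "a \<in> nodes m"
    have "dim (U a \<inter> C) = dim A + \<nu>1 a" using nz by (intro singular_dim[OF s1 low[OF U] _ a]) simp
    moreover have "dim (ssum (U a) C) = dim C + \<nu>2 a" using nz
      by (intro singular_dim[OF s2 high[OF U] _ a]) simp
    ultimately show "dim (U a) = dim A + (\<nu>1 a + \<nu>2 a)"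
      using dim_ssum[OF chainsD(1)[OF U a] C] by simp
  next
    fix U a assume U: "U \<in> chains m A B" and a: "a \<in> nodes m"
    define Y where "Y = upper m B U a"
    define Z where "Z = U a"
    define U' where "U' = (\<lambda>a. U a \<inter> C)"
    define U'' where "U'' = (\<lambda>a. ssum (U a) C)"
    have Z: "subspace Z" "Z \<subseteq> Y" using chainsD[OF U a] by (auto simp: Z_def Y_def)
    have Y: "subspace Y" using upper_subspace[OF U m a B] by (simp add: Y_def)
    have Z': "U' a = Z \<inter> C" and Z'': "U'' a = ssum Z C" by (simp_all add: U'_def U''_def Z_def)
    have ZZ: "Z \<subseteq> ssum Z C" by (rule ssum_upper1[OF C])
    have "(\<Sum>x\<in>upper m C U' a - U' a. \<phi>1 (U'(a := adj x (U' a)))) = 0"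
      using singular_sum[OF s1 low[OF U] a] unfolding U'_def .
    then have sing1: "(\<Sum>x\<in>Y \<inter> C - Z \<inter> C. \<phi>1 (U'(a := adj x (Z \<inter> C)))) = 0"
      unfolding Z' unfolding U'_def upper_Int[OF BC(1)] Y_def .
    have "(\<Sum>x\<in>upper m B U'' a - U'' a. \<phi>2 (U''(a := adj x (U'' a)))) = 0"
      using singular_sum[OF s2 high[OF U] a] unfolding U''_def .
    then have sing2: "(\<Sum>x\<in>ssum Y C - ssum Z C. \<phi>2 (U''(a := adj x (ssum Z C)))) = 0"
      unfolding Z'' unfolding U''_def upper_ssum[OF BC(2)] Y_def .
    have upd1: "(\<lambda>b. (U(a := W)) b \<inter> C) = U'(a := W \<inter> C)" for W by (auto simp: U'_def fun_eq_iff)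
    have upd2: "(\<lambda>b. ssum ((U(a := W)) b) C) = U''(a := ssum W C)" for W
      by (auto simp: U''_def fun_eq_iff)
    define g where "g x = \<phi>1 (U'(a := adj x Z \<inter> C)) * \<phi>2 (U''(a := ssum (adj x Z) C))" for x
    \<comment> \<open>split by whether the new vector enlarges the image modulo \<open>C\<close>\<close>
    have split: "Y - Z = (Y - ssum Z C) \<union> (Y \<inter> ssum Z C - Z)" using ZZ by blast
    have out: "(\<Sum>x\<in>Y - ssum Z C. g x) = 0"
    proof -
      define h where "h x = (if x \<in> ssum Z C then 0 else \<phi>2 (U''(a := adj x (ssum Z C))))" for x
      have CZ: "c \<in> ssum Z C" if "c \<in> C" for c using that ssum_upper2[OF Z(1)] by blast
      have inv: "h (x + c) = h x" if c: "c \<in> C" for x c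
      proof -
        have "x + c \<in> ssum Z C \<longleftrightarrow> x \<in> ssum Z C"
          using subspace_ssum[OF Z(1) C] CZ[OF c] subspace_add subspace_diff
            by (metis add_diff_cancel_right')
        then show ?thesis using adj_translate[OF subspace_ssum[OF Z(1) C] CZ[OF c]]
          by (simp add: h_def)
      qed
      have "(\<Sum>x\<in>ssum Y C. h x) = (\<Sum>x\<in>ssum Y C - ssum Z C. h x)"
        by (rule sum.mono_neutral_right) (auto simp: h_def)
      also have "\<dots> = 0" using sing2 by (simp add: h_def)
      finally have "of_nat (card C) * (\<Sum>x\<in>Y. h x) = 0"
        using sum_over_ssum[OF Y C inv] by simp
      then have "(\<Sum>x\<in>Y. h x) = 0" using card_subspace_pos[OF C] by simp
      moreover have "(\<Sum>x\<in>Y. h x) = (\<Sum>x\<in>Y - ssum Z C. h x)"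
        by (rule sum.mono_neutral_right) (auto simp: h_def)
      moreover have "g x = \<phi>1 U' * h x" if "x \<in> Y - ssum Z C" for x
        using that adj_Int_outside[OF Z(1) C] ssum_adj[OF Z(1) C] Z'
        by (simp add: g_def h_def fun_upd_idem)
      ultimately show ?thesis by (simp add: sum_distrib_left[symmetric])
    qed
    have ins: "(\<Sum>x\<in>Y \<inter> ssum Z C - Z. g x) = 0"
    proof -
      define h where "h x = (if x \<in> Z then 0 else \<phi>1 (U'(a := adj x Z \<inter> C)))" for x
      have inv: "h (x + z) = h x" if z: "z \<in> Z" for x z
      proof -
        have "x + z \<in> Z \<longleftrightarrow> x \<in> Z"
          using Z(1) z subspace_add subspace_diff by (metis add_diff_cancel_right')
        then show ?thesis using adj_translate[OF Z(1) z] by (simp add: h_def)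
      qed
      have YC: "subspace (Y \<inter> C)" using Y C by (rule subspace_inter)
      have eq: "Y \<inter> ssum Z C = ssum (Y \<inter> C) Z"
        using modular_law[OF Y Z(2)] ssum_commute by simp
      have "(\<Sum>x\<in>Y \<inter> C. h x) = (\<Sum>x\<in>Y \<inter> C - Z \<inter> C. h x)"
        by (rule sum.mono_neutral_right) (auto simp: h_def)
      also have "\<dots> = (\<Sum>x\<in>Y \<inter> C - Z \<inter> C. \<phi>1 (U'(a := adj x (Z \<inter> C))))"
        by (rule sum.cong) (auto simp: h_def adj_Int_inside[OF Z(1) C])
      also have "\<dots> = 0" by (rule sing1)
      finally have "of_nat (card (Y \<inter> C \<inter> Z)) * (\<Sum>x\<in>ssum (Y \<inter> C) Z. h x) = 0"
        using sum_over_ssum[OF YC Z(1) inv] by simp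
      then have "(\<Sum>x\<in>ssum (Y \<inter> C) Z. h x) = 0"
        using card_subspace_pos[OF subspace_inter[OF YC Z(1)]] by simp
      moreover have "(\<Sum>x\<in>Y \<inter> ssum Z C. h x) = (\<Sum>x\<in>Y \<inter> ssum Z C - Z. h x)"
        by (rule sum.mono_neutral_right) (auto simp: h_def)
      moreover have "g x = \<phi>2 U'' * h x" if "x \<in> Y \<inter> ssum Z C - Z" for x
        using that ssum_adj[OF Z(1) C] adj_redundant[OF subspace_ssum[OF Z(1) C]] Z''
        by (simp add: g_def h_def fun_upd_idem)
      ultimately show ?thesis by (simp add: sum_distrib_left[symmetric] eq)
    qed
    have "(\<Sum>x\<in>Y - Z. g x) = 0"
      unfolding split using out ins by (subst sum.union_disjoint) auto
    then show "(\<Sum>x\<in>upper m B U a - U a. \<phi>1 (\<lambda>b. (U(a := adj x (U a))) b \<inter> C) *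
        \<phi>2 (\<lambda>b. ssum ((U(a := adj x (U a))) b) C)) = 0"
      unfolding upd1 upd2 g_def Y_def Z_def .
  qed
qed

section \<open>Singular functions for a plane and for a column\<close>

text \<open>
  The vector \<open>\<nu>\<close> with \<open>C \<nu> = 2 j\<^sub>m\<close>, so that a plane carries the weight \<open>0\<close>.
\<close>

fun plane_dims :: "node \<Rightarrow> nat" where
  "plane_dims (Node_j \<beta>) = 2"
| "plane_dims a = 1"

text \<open>
  All spaces \<open>U\<close> with index \<open>j\<^sub>\<beta>\<close> are the whole plane, and \<open>U\<^sub>i\<close>, \<open>U\<^sub>k\<close> are lines. The function
  is \<open>\<alpha>(U\<^sub>i) \<beta>(U\<^sub>k) - \<beta>(U\<^sub>i) \<alpha>(U\<^sub>k)\<close> for two independent functions \<open>\<alpha>\<close>, \<open>\<beta>\<close> on lines with sum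
  zero; a plane has at least three lines, so they exist. Sum zero gives the conditions at \<open>i\<close>
  and \<open>k\<close>. For the condition at \<open>j\<^sub>1\<close>, a line below the plane can only contain \<open>U\<^sub>i\<close> and \<open>U\<^sub>k\<close>
  if they are equal, and the function vanishes there because it is antisymmetric. The later
  \<open>j\<^sub>\<beta>\<close> impose no condition, as their spaces contain the whole plane.
\<close>

proposition singular_plane:
  assumes m: "1 \<le> m" and A: "subspace A" and B: "subspace B" and AB: "A \<subseteq> B"
    and d: "dim B = dim A + 2"
  shows "\<exists>\<phi>. singular m A B plane_dims \<phi>"
proof -
  have "A \<noteq> B" using d by auto
  then obtain e1 where e1: "e1 \<in> B" "e1 \<notin> A" using AB by blast
  define l0 where "l0 = adj e1 A"
  have l0: "subspace l0" "A \<subseteq> l0" "l0 \<subseteq> B" "dim l0 = dim A + 1"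
    using subset_adj adj_subset[OF B AB e1(1)] dim_adj[OF A e1(2)] by (auto simp: l0_def)
  have "l0 \<noteq> B" using d l0(4) by auto
  then obtain e2 where e2: "e2 \<in> B" "e2 \<notin> l0" using l0(3) by blast
  have e1l0: "e1 \<in> l0" by (simp add: l0_def self_adj)
  have e2A: "e2 \<notin> A" using e2 l0 by blast
  have e12: "e1 + e2 \<in> B" "e1 + e2 \<notin> l0"
    using subspace_add[OF B e1(1) e2(1)] subspace_diff[OF l0(1) _ e1l0, of "e1 + e2"] e2(2) by auto
  then have e12A: "e1 + e2 \<notin> A" using l0 by blast
  define l1 where "l1 = adj e2 A"
  define l2 where "l2 = adj (e1 + e2) A"
  have dims: "dim l1 = dim A + 1" "dim l2 = dim A + 1"
    using dim_adj[OF A e2A] dim_adj[OF A e12A] by (auto simp: l1_def l2_def)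
  have ne: "l0 \<noteq> l1" "l0 \<noteq> l2" using e2 e12 self_adj by (auto simp: l1_def l2_def)
  have ne': "l1 \<noteq> l2"
  proof
    assume eq: "l1 = l2"
    have "e1 + e2 \<in> l1" unfolding eq l2_def by (rule self_adj)
    moreover have "e2 \<in> l1" unfolding l1_def by (rule self_adj)
    ultimately have "(e1 + e2) - e2 \<in> l1" unfolding l1_def by (rule span_diff)
    then have e1l1: "e1 \<in> l1" by simp
    have "adj e1 A = l1"
      by (rule adj_eq[OF A _ _ dims(1) e1l1 e1(2)]) (simp_all add: l1_def subset_adj)
    then show False using ne by (simp add: l0_def)
  qed
  define \<alpha> where "\<alpha> W = (if W = l0 then 1 else if W = l2 then -1 else 0 :: complex)" for W
  define \<beta> where "\<beta> W = (if W = l1 then 1 else if W = l2 then -1 else 0 :: complex)" for W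
  define f where "f W1 W2 = \<alpha> W1 * \<beta> W2 - \<beta> W1 * \<alpha> W2" for W1 W2
  have line: "dim W = dim A + 1" if "\<alpha> W \<noteq> 0 \<or> \<beta> W \<noteq> 0" for W
    using that dims l0 by (auto simp: \<alpha>_def \<beta>_def split: if_splits)
  have f_line: "dim W1 = dim A + 1" "dim W2 = dim A + 1" if "f W1 W2 \<noteq> 0" for W1 W2
  proof -
    have "\<alpha> W1 \<noteq> 0 \<or> \<beta> W1 \<noteq> 0" "\<alpha> W2 \<noteq> 0 \<or> \<beta> W2 \<noteq> 0" using that by (auto simp: f_def)
    then show "dim W1 = dim A + 1" "dim W2 = dim A + 1" using line by blast+
  qed
  define L where "L = (\<lambda>x. adj x A) ` (B - A)"
  have L: "l0 \<in> L" "l1 \<in> L" "l2 \<in> L"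
    using e1 e2 e12 e2A e12A by (auto simp: L_def l0_def l1_def l2_def)
  have "(\<Sum>W\<in>L. \<alpha> W) = (\<Sum>W\<in>L. (if W = l0 then 1 else 0) - (if W = l2 then 1 else 0))"
    using ne by (intro sum.cong) (auto simp: \<alpha>_def)
  then have sa: "(\<Sum>W\<in>L. \<alpha> W) = 0" using L by (simp add: sum_subtractf)
  have "(\<Sum>W\<in>L. \<beta> W) = (\<Sum>W\<in>L. (if W = l1 then 1 else 0) - (if W = l2 then 1 else 0))"
    using ne' by (intro sum.cong) (auto simp: \<beta>_def)
  then have sb: "(\<Sum>W\<in>L. \<beta> W) = 0" using L by (simp add: sum_subtractf)
  have sum0: "(\<Sum>x\<in>B - A. \<alpha> (adj x A)) = 0" "(\<Sum>x\<in>B - A. \<beta> (adj x A)) = 0"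
    using sum_adj[OF B AB A, of \<alpha>] sum_adj[OF B AB A, of \<beta>] sa sb unfolding L_def by simp_all
  have sum1: "(\<Sum>x\<in>B - Z. f (adj x Z) W) = 0" "(\<Sum>x\<in>B - Z. f W (adj x Z)) = 0"
    if Z: "subspace Z" "A \<subseteq> Z" for Z W
  proof -
    show "(\<Sum>x\<in>B - Z. f (adj x Z) W) = 0"
    proof (cases "Z = A")
      case True
      have "(\<Sum>x\<in>B - A. f (adj x A) W) =
          (\<Sum>x\<in>B - A. \<alpha> (adj x A)) * \<beta> W - (\<Sum>x\<in>B - A. \<beta> (adj x A)) * \<alpha> W"
        by (simp add: f_def sum_subtractf sum_distrib_right)
      then show ?thesis using True sum0 by simp
    next
      case False
      then have "dim A < dim Z" using Z A subspace_dim_equal[OF A Z(1)] by force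
      then have "f (adj x Z) W = 0" if "x \<in> B - Z" for x
        using f_line(1)[of "adj x Z" W] dim_adj[OF Z(1)] that by force
      then show ?thesis by simp
    qed
    moreover have "(\<Sum>x\<in>B - Z. f W (adj x Z)) = (\<Sum>x\<in>B - Z. - f (adj x Z) W)"
      by (intro sum.cong refl) (simp add: f_def)
    ultimately show "(\<Sum>x\<in>B - Z. f W (adj x Z)) = 0" by (simp add: sum_negf)
  qed
  define \<phi> where "\<phi> U = (if \<forall>\<beta>\<in>{1..m}. U (Node_j \<beta>) = B then f (U Node_i) (U Node_k) else 0)" for U
  have "singular m A B plane_dims \<phi>"
    unfolding singular_def
  proof (intro conjI allI ballI impI)
    fix U U' assume "\<forall>a\<in>nodes m. U a = (U' a :: 'v set)"
    then show "\<phi> U = \<phi> U'" by (simp add: \<phi>_def)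
  next
    define U where "U = (\<lambda>a. case a of Node_i \<Rightarrow> l0 | Node_k \<Rightarrow> l1 | _ \<Rightarrow> B)"
    have l1: "subspace l1" "A \<subseteq> l1" "l1 \<subseteq> B"
      using subset_adj adj_subset[OF B AB e2(1)] by (auto simp: l1_def)
    have "U \<in> chains m A B" unfolding chains_def
    proof (intro CollectI ballI)
      fix a assume "a \<in> nodes m"
      show "subspace (U a) \<and> A \<subseteq> U a \<and> U a \<subseteq> upper m B U a"
        using l0 l1 B AB by (cases a) (auto simp: U_def)
    qed
    moreover have "\<phi> U = 1" using ne ne' by (simp add: \<phi>_def U_def f_def \<alpha>_def \<beta>_def)
    ultimately show "\<exists>U\<in>chains m A B. \<phi> U \<noteq> 0" by (intro bexI[of _ U]) simp_all
  next
    fix U a assume U: "U \<in> chains m A B" and nz: "\<phi> U \<noteq> 0" and a: "a \<in> nodes m"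
    then have "\<forall>\<beta>\<in>{1..m}. U (Node_j \<beta>) = B" "f (U Node_i) (U Node_k) \<noteq> 0"
      by (auto simp: \<phi>_def split: if_splits)
    then show "dim (U a) = dim A + plane_dims a"
      using a d f_line[of "U Node_i" "U Node_k"] by (cases a) auto
  next
    fix U a assume U: "U \<in> chains m A B" and a: "a \<in> nodes m"
    note D = chainsD[OF U]
    show "(\<Sum>x\<in>upper m B U a - U a. \<phi> (U(a := adj x (U a)))) = 0"
    proof (cases a)
      case Node_i
      show ?thesis
      proof (cases "\<forall>\<beta>\<in>{1..m}. U (Node_j \<beta>) = B")
        case True
        then have "upper m B U a = B" using Node_i m by simp
        moreover have "\<phi> (U(a := W)) = f W (U Node_k)" for W using True Node_i by (simp add: \<phi>_def)
        ultimately show ?thesis using sum1(1)[OF D(1,2)[OF a]] by simp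
      next
        case False
        then have "\<phi> (U(a := W)) = 0" for W using Node_i by (auto simp: \<phi>_def)
        then show ?thesis by simp
      qed
    next
      case Node_k
      show ?thesis
      proof (cases "\<forall>\<beta>\<in>{1..m}. U (Node_j \<beta>) = B")
        case True
        then have "upper m B U a = B" using Node_k m by simp
        moreover have "\<phi> (U(a := W)) = f (U Node_i) W" for W using True Node_k by (simp add: \<phi>_def)
        ultimately show ?thesis using sum1(2)[OF D(1,2)[OF a]] by simp
      next
        case False
        then have "\<phi> (U(a := W)) = 0" for W using Node_k by (auto simp: \<phi>_def)
        then show ?thesis by simp
      qed
    next
      case (Node_j \<beta>)
      then have \<beta>: "1 \<le> \<beta>" "\<beta> \<le> m" using a by auto
      have "\<phi> (U(a := adj x (U a))) = 0" if x: "x \<in> upper m B U a - U a" for x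
      proof (rule ccontr)
        assume nz: "\<phi> (U(a := adj x (U a))) \<noteq> 0"
        then have j: "\<forall>\<gamma>\<in>{1..m}. (U(a := adj x (U a))) (Node_j \<gamma>) = B"
          and f: "f (U Node_i) (U Node_k) \<noteq> 0"
          using Node_j by (auto simp: \<phi>_def split: if_splits)
        have xB: "x \<in> B" using x upper_subset[OF U m a] by blast
        have aB: "U a \<subseteq> B" using chains_subset[OF U m a] .
        show False
        proof (cases "\<beta> = 1")
          case False
          then have "\<beta> - 1 \<in> {1..m}" "Node_j (\<beta> - 1) \<noteq> a" using \<beta> Node_j by auto
          then have "U (Node_j (\<beta> - 1)) = B" using bspec[OF j, of "\<beta> - 1"] by simp
          moreover have "U (Node_j (\<beta> - 1)) \<subseteq> U a"
          proof -
            have "\<beta> - 1 + 1 = \<beta>" "\<beta> - 1 \<noteq> m" using \<beta> False by auto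
            then have "upper m B U (Node_j (\<beta> - 1)) = U a" using Node_j by simp
            moreover have "Node_j (\<beta> - 1) \<in> nodes m" using \<beta> False by auto
            ultimately show ?thesis using D(3) by metis
          qed
          ultimately show False using xB x by blast
        next
          case True
          have "dim (U a) < dim B"
            using subspace_dim_equal[OF D(1)[OF a] B aB] xB x by fastforce
          moreover have sub: "U Node_i \<subseteq> U a" "U Node_k \<subseteq> U a"
            using D(3)[of Node_i] D(3)[of Node_k] True Node_j by auto
          ultimately have le: "dim (U a) \<le> dim (U Node_i)" "dim (U a) \<le> dim (U Node_k)"
            using f_line[OF f] d by auto
          have "U Node_i = U a" by (rule subspace_dim_equal[OF D(1) D(1)[OF a] sub(1) le(1)]) simp
          moreover have "U Node_k = U a" by (rule subspace_dim_equal[OF D(1) D(1)[OF a] sub(2)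
            le(2)]) simp
          ultimately show False using f by (simp add: f_def)
        qed
      qed
      then show ?thesis by simp
    qed
  qed
  then show ?thesis by blast
qed

text \<open>
  Number the vertices other than \<open>z\<close> along the chain, the other short leg being \<open>0\<close> and \<open>j\<^sub>\<beta>\<close>
  being \<open>\<beta>\<close>. The dimensions are zero below position \<open>t\<close> and then increase by one at every step.
\<close>

fun column_dims :: "node \<Rightarrow> nat \<Rightarrow> node \<Rightarrow> nat" where
  "column_dims z t (Node_j \<beta>) = \<beta> + 1 - t"
| "column_dims z t a = (if a = z then 0 else 1 - t)"

text \<open>
  Fix a basis of \<open>B\<close> modulo \<open>A\<close>. A permutation \<open>\<sigma>\<close> gives the chain of the coordinate subspaces
  spanned by the first \<open>c a\<close> basis vectors in the order \<open>\<sigma>\<close>, and \<open>\<phi>\<close> is the alternating sum of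
  the indicator functions of these chains. The nonzero dimensions occur once each and without
  gaps, so a chain in which \<open>U a\<close> is one dimension short fits \<open>\<sigma>\<close> if and only if it fits \<open>\<sigma>\<close>
  with the entries next to \<open>c a\<close> exchanged; the two terms cancel.
\<close>

proposition singular_column:
  assumes m: "1 \<le> m" and A: "subspace A" and B: "subspace B" and AB: "A \<subseteq> B"
    and z: "z = Node_i \<or> z = Node_k" and t: "t \<le> m + 1"
    and d: "dim B = dim A + (m + 2 - t)"
  shows "\<exists>\<phi>. singular m A B (column_dims z t) \<phi>"
proof -
  define r where "r = m + 2 - t"
  define c where "c = column_dims z t"
  obtain e where e: "e ` {..<r} \<subseteq> B" "dim (span (A \<union> e ` {..<r})) = dim A + r"
    using extension_exists[OF A B AB, of r] d by (auto simp: r_def)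
  define P where "P S = span (A \<union> e ` S)" for S
  have P: "subspace (P S)" "A \<subseteq> P S" for S by (auto simp: P_def intro: span_base)
  have P_mono: "S \<subseteq> S' \<Longrightarrow> P S \<subseteq> P S'" for S S' unfolding P_def by (intro span_mono) auto
  have P_dim: "dim (P S) = dim A + card S" if "S \<subseteq> {..<r}" for S
    unfolding P_def by (rule dim_extension[OF e(2) that])
  have P_top: "P {..<r} = B"
    unfolding P_def using e AB B d r_def by (intro subspace_dim_equal span_minimal) auto
  have P_inj: "S = S'" if S: "S \<subseteq> {..<r}" "S' \<subseteq> {..<r}" and eq: "P S = P S'" for S S'
  proof -
    have *: "T \<subseteq> S" if T: "T \<subseteq> {..<r}" and S: "S \<subseteq> {..<r}" and eq: "P T = P S" for S T
    proof -
      have "P (S \<union> T) \<subseteq> P S" unfolding P_def[of "S \<union> T"]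
        using eq P by (intro span_minimal) (auto simp: P_def span_base)
      then have "dim A + card (S \<union> T) \<le> dim A + card S"
        using dim_subset P_dim S T by (metis Un_least)
      then have "S = S \<union> T" using S T finite_subset[of "S \<union> T" "{..<r}"] by (intro card_seteq) auto
      then show ?thesis by blast
    qed
    show ?thesis using *[OF S eq] *[OF S(2,1) eq[symmetric]] by blast
  qed
  have P_0: "P {} = A" using A by (simp add: P_def)
  have P_Suc: "adj (e x) (P S) = P (insert x S)" for x S
  proof
    show "adj (e x) (P S) \<subseteq> P (insert x S)"
      using P_mono[of S "insert x S"] by (intro adj_subset P) (auto simp: P_def span_base)
    show "P (insert x S) \<subseteq> adj (e x) (P S)"
      unfolding P_def[of "insert x S"] using subset_adj self_adj P(2)[of S]
      by (intro span_minimal) (auto simp: P_def span_base)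
  qed
  \<comment> \<open>consecutive nonzero dimensions differ by one, also at the top\<close>
  have c_next: "upper m B (\<lambda>a. P (h {..<c a})) a = P (h {..<c a + 1})"
    if "a \<in> nodes m" "1 \<le> c a" "h {..<r} = {..<r}" for a and h :: "nat set \<Rightarrow> nat set"
  proof (cases a)
    case (Node_j \<beta>)
    then have \<beta>: "t \<le> \<beta>" "\<beta> \<le> m" using that by (auto simp: c_def)
    show ?thesis
    proof (cases "\<beta> = m")
      case True
      have "c a + 1 = r" using \<beta> True Node_j by (simp add: c_def r_def)
      then have "P (h {..<c a + 1}) = B" using that(3) P_top by (simp only:)
      then show ?thesis using True Node_j by simp
    next
      case False
      have "c (Node_j (\<beta> + 1)) = c a + 1" using \<beta> Node_j by (simp add: c_def)
      then show ?thesis using False Node_j by simp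
    qed
  next
    case Node_i
    then have "c (Node_j 1) = c a + 1" using that(2) by (auto simp: c_def split: if_splits)
    then show ?thesis using Node_i by simp
  next
    case Node_k
    then have "c (Node_j 1) = c a + 1" using that(2) by (auto simp: c_def split: if_splits)
    then show ?thesis using Node_k by simp
  qed
  have c_le: "c a < r" if "a \<in> nodes m" for a
    using that t by (cases a) (auto simp: c_def r_def)
  have c_prev: "\<exists>b\<in>nodes m. c b = c a - 1 \<and> (\<forall>U :: node \<Rightarrow> 'v set. upper m B U b = U a) \<and> b \<noteq> a"
    if "a \<in> nodes m" "2 \<le> c a" for a
  proof (cases a)
    case (Node_j \<beta>)
    show ?thesis
    proof (cases "\<beta> = 1")
      case True
      define b where "b = (if z = Node_i then Node_k else Node_i)"
      show ?thesis using True z that Node_j by (intro bexI[of _ b]) (auto simp: c_def b_def)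
    next
      case False
      show ?thesis using False that Node_j
        by (intro bexI[of _ "Node_j (\<beta> - 1)"]) (auto simp: c_def)
    qed
  qed (use that in \<open>auto simp: c_def split: if_splits\<close>)
  have c_inj: "c a = 0" if "a \<in> nodes m" "b \<in> nodes m" "a \<noteq> b" "c a = c b" for a b
    using that z by (cases a; cases b) (auto simp: c_def split: if_splits)
  define G where "G = {\<sigma>. \<sigma> permutes {..<r}}"
  have fin: "finite G" by (simp add: G_def finite_permutations)
  have sub: "\<sigma> ` {..<n} \<subseteq> {..<r}" "card (\<sigma> ` {..<n}) = n" if "\<sigma> \<in> G" "n \<le> r" for \<sigma> n
    using that permutes_image[of \<sigma> "{..<r}"] permutes_inj_on[of \<sigma> "{..<r}"]
    by (auto simp: G_def card_image dest: image_mono[of "{..<n}" "{..<r}" \<sigma>, THEN subsetD, rotated])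
  define fits where "fits \<sigma> U a \<longleftrightarrow> U a = P (\<sigma> ` {..<c a})" for \<sigma> and U :: "node \<Rightarrow> 'v set" and a
  define \<phi> where "\<phi> U = (\<Sum>\<sigma>\<in>G. of_int (sign \<sigma>) * (if \<forall>a\<in>nodes m. fits \<sigma> U a then 1 else 0 ::
    complex))" for U
  have "singular m A B c \<phi>"
    unfolding singular_def
  proof (intro conjI allI ballI impI)
    fix U U' assume "\<forall>a\<in>nodes m. U a = (U' a :: 'v set)"
    then show "\<phi> U = \<phi> U'" by (simp add: \<phi>_def fits_def)
  next
    define U where "U a = P {..<c a}" for a
    have U: "U \<in> chains m A B" unfolding chains_def
    proof (intro CollectI ballI)
      fix a assume a: "a \<in> nodes m"
      have "U a \<subseteq> upper m B U a"
      proof (cases "c a = 0")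
        case True
        then show ?thesis using P(2) P_0 AB by (cases a) (auto simp: U_def)
      next
        case False
        then show ?thesis
          using c_next[OF a, of "\<lambda>x. x"] P_mono[of "{..<c a}" "{..<c a + 1}"]
            by (auto simp: U_def[abs_def])
      qed
      then show "subspace (U a) \<and> A \<subseteq> U a \<and> U a \<subseteq> upper m B U a"
        using P by (simp add: U_def)
    qed
    have id: "\<sigma> = id" if \<sigma>: "\<sigma> \<in> G" and f: "\<forall>a\<in>nodes m. fits \<sigma> U a" for \<sigma>
    proof -
      have 1: "\<sigma> ` {..<c a} = {..<c a}" if a: "a \<in> nodes m" for a
        using f a sub(1)[OF \<sigma>, of "c a"] c_le[OF a] by (intro P_inj) (auto simp: fits_def U_def)
      have 2: "\<sigma> ` {..<n} = {..<n}" if n: "n \<le> r" for n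
      proof -
        consider "n = 0" | "n = r" | "1 \<le> n" "n < r" using n by linarith
        then show ?thesis
        proof cases
          case 2
          then show ?thesis using \<sigma> permutes_image by (auto simp: G_def)
        next
          case 3
          have "\<exists>a\<in>nodes m. c a = n"
          proof (cases "n + t = 1")
            case True
            then show ?thesis using z 3
              by (intro bexI[of _ "if z = Node_i then Node_k else Node_i"]) (auto simp: c_def)
          next
            case False
            then show ?thesis using 3
              by (intro bexI[of _ "Node_j (n + t - 1)"]) (auto simp: c_def r_def)
          qed
          then show ?thesis using 1 by blast
        qed simp
      qed
      show "\<sigma> = id"
      proof
        fix n show "\<sigma> n = id n"
        proof (cases "n < r")
          case True
          have "\<sigma> n \<in> \<sigma> ` {..<Suc n}" by auto
          then have "\<sigma> n < Suc n" using 2[of "Suc n"] True by auto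
          moreover have "\<sigma> n \<notin> \<sigma> ` {..<n}"
            using \<sigma> permutes_inj[of \<sigma>] by (auto simp: G_def inj_eq)
          then have "\<not> \<sigma> n < n" using 2[of n] True by auto
          ultimately show ?thesis by simp
        next
          case False
          then show ?thesis using \<sigma> by (simp add: G_def permutes_not_in)
        qed
      qed
    qed
    have "\<phi> U = (\<Sum>\<sigma>\<in>G. if \<sigma> = id then 1 else 0)"
      unfolding \<phi>_def
    proof (intro sum.cong refl)
      fix \<sigma> assume "\<sigma> \<in> G"
      then show "of_int (sign \<sigma>) * (if \<forall>a\<in>nodes m. fits \<sigma> U a then 1 else 0) = (if \<sigma> = id then 1
        else 0 :: complex)"
      proof (cases "\<sigma> = id")
        case True
        then show ?thesis by (simp add: fits_def U_def sign_id)
      next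
        case False
        then have "\<not> (\<forall>a\<in>nodes m. fits \<sigma> U a)" using id \<open>\<sigma> \<in> G\<close> by blast
        then show ?thesis using False by simp
      qed
    qed
    then have "\<phi> U = 1" using fin permutes_id by (simp add: G_def)
    then show "\<exists>U\<in>chains m A B. \<phi> U \<noteq> 0" using U by (intro bexI[of _ U]) simp_all
  next
    fix U a assume U: "U \<in> chains m A B" and nz: "\<phi> U \<noteq> 0" and a: "a \<in> nodes m"
    obtain \<sigma> where "\<sigma> \<in> G" "\<forall>a\<in>nodes m. fits \<sigma> U a"
    proof -
      have "\<exists>\<sigma>\<in>G. of_int (sign \<sigma>) * (if \<forall>a\<in>nodes m. fits \<sigma> U a then 1 else 0 :: complex) \<noteq> 0"
        using nz unfolding \<phi>_def by (rule contrapos_np) (auto intro!: sum.neutral)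
      then show ?thesis using that by (auto split: if_splits)
    qed
    then show "dim (U a) = dim A + c a"
      using a P_dim[OF sub(1)] sub(2) c_le[OF a] by (simp add: fits_def)
  next
    fix U a assume U: "U \<in> chains m A B" and a: "a \<in> nodes m"
    define Y where "Y = upper m B U a"
    define Z where "Z = U a"
    note Da = chainsD[OF U a, folded Y_def Z_def]
    define off where "off \<sigma> \<longleftrightarrow> (\<forall>b\<in>nodes m - {a}. fits \<sigma> U b)" for \<sigma>
    \<comment> \<open>the number of vectors that enlarge \<open>U a\<close> so as to fit \<open>\<sigma>\<close>, by the claim \<open>inner\<close>
      below; this expression is visibly unchanged when \<open>\<sigma>\<close> is composed with the
      transposition\<close>
    define g where "g \<sigma> = (if off \<sigma> \<and> Z = P (\<sigma> ` {..<c a - 1}) then of_nat ((CARD('k) - 1) * card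
      Z) else 0 :: complex)" for \<sigma>
    have fits_upd: "(\<forall>b\<in>nodes m. fits \<sigma> (U(a := W)) b) \<longleftrightarrow> off \<sigma> \<and> W = P (\<sigma> ` {..<c a})" for \<sigma> W
      using a by (auto simp: off_def fits_def)
    have swap: "(\<Sum>x\<in>Y - Z. \<phi> (U(a := adj x Z))) =
        (\<Sum>\<sigma>\<in>G. of_int (sign \<sigma>) * (\<Sum>x\<in>Y - Z. if off \<sigma> \<and> adj x Z = P (\<sigma> ` {..<c a}) then 1 else 0))"
      unfolding \<phi>_def fits_upd by (subst sum.swap) (simp add: sum_distrib_left)
    show "(\<Sum>x\<in>upper m B U a - U a. \<phi> (U(a := adj x (U a)))) = 0"
    proof (cases "c a = 0")
      case True
      have "adj x Z \<noteq> A" if "x \<in> Y - Z" for x using that Da(2) self_adj[of x Z] by blast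
      then show ?thesis using swap P_0 True by (simp add: Y_def Z_def)
    next
      case False
      then have ca: "1 \<le> c a" by simp
      have inner: "(\<Sum>x\<in>Y - Z. if off \<sigma> \<and> adj x Z = P (\<sigma> ` {..<c a}) then 1 else 0) = g \<sigma>"
        if \<sigma>: "\<sigma> \<in> G" for \<sigma>
      proof (cases "off \<sigma>")
        case False
        then show ?thesis by (simp add: g_def)
      next
        case off: True
        have count: "(\<Sum>x\<in>Y - Z. if off \<sigma> \<and> adj x Z = P (\<sigma> ` {..<c a}) then 1 else 0) =
            (of_nat (card {x \<in> Y - Z. adj x Z = P (\<sigma> ` {..<c a})}) :: complex)"
          using off by (simp add: sum.If_cases Int_def)
        show ?thesis
        proof (cases "Z = P (\<sigma> ` {..<c a - 1})")
          case True
          let ?x = "e (\<sigma> (c a - 1))"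
          have ins: "insert (\<sigma> (c a - 1)) (\<sigma> ` {..<c a - 1}) = \<sigma> ` {..<c a}"
            using ca by (cases "c a") (auto simp: lessThan_Suc)
          then have adj: "adj ?x Z = P (\<sigma> ` {..<c a})" using P_Suc True by simp
          have "dim (P (\<sigma> ` {..<c a})) = dim Z + 1"
            using P_dim[OF sub(1)[OF \<sigma>]] sub(2)[OF \<sigma>] c_le[OF a] ca True by simp
          then have xZ: "?x \<notin> Z" using adj adj_redundant[OF Da(1)] by auto
          have "?x \<in> Y"
          proof -
            have "Y = P (\<sigma> ` {..<c a + 1})"
            proof -
              have "Y = upper m B (\<lambda>a. P (\<sigma> ` {..<c a})) a"
                unfolding Y_def using off a m by (cases a) (auto simp: off_def fits_def)
              then show ?thesis
                using c_next[OF a ca, of "image \<sigma>"] permutes_image[of \<sigma>] \<sigma> by (simp add: G_def)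
            qed
            moreover have "?x \<in> P (\<sigma> ` {..<c a + 1})" unfolding P_def by (intro span_base) auto
            ultimately show ?thesis by simp
          qed
          have "subspace Y" unfolding Y_def by (rule upper_subspace[OF U m a B])
          from card_adj_fiber[OF this Da(3,1) \<open>?x \<in> Y\<close> xZ]
          have "card {x \<in> Y - Z. adj x Z = P (\<sigma> ` {..<c a})} = (CARD('k) - 1) * card Z"
            unfolding adj .
          moreover have "g \<sigma> = of_nat ((CARD('k) - 1) * card Z)"
            unfolding g_def by (rule if_P) (intro conjI off True)
          ultimately show ?thesis unfolding count by (simp only:)
        next
          case ne: False
          have "adj x Z \<noteq> P (\<sigma> ` {..<c a})" if x: "x \<in> Y - Z" for x
          proof
            assume eq: "adj x Z = P (\<sigma> ` {..<c a})"
            have "dim Z + 1 = dim A + c a"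
            proof -
              have "dim (adj x Z) = dim Z + 1" using x by (intro dim_adj[OF Da(1)]) simp
              moreover have "dim (adj x Z) = dim A + c a"
                unfolding eq using P_dim[OF sub(1)[OF \<sigma>]] sub(2)[OF \<sigma>] c_le[OF a] by simp
              ultimately show ?thesis by simp
            qed
            then have dZ: "dim Z = dim A + (c a - 1)" using ca by simp
            have dP: "dim (P (\<sigma> ` {..<c a - 1})) = dim A + (c a - 1)"
              using P_dim[OF sub(1)[OF \<sigma>]] sub(2)[OF \<sigma>] c_le[OF a] by simp
            have "P (\<sigma> ` {..<c a - 1}) \<subseteq> Z"
            proof (cases "c a = 1")
              case True
              then show ?thesis using P_0 Da by simp
            next
              case False
              then obtain b where b: "b \<in> nodes m" "c b = c a - 1" "upper m B U b = U a" "b \<noteq> a"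
                using c_prev[OF a] ca by force
              then have "U b = P (\<sigma> ` {..<c a - 1})" using off by (auto simp: off_def fits_def)
              then show ?thesis using chainsD(3)[OF U b(1)] b(3) by (simp add: Z_def)
            qed
            then show False using ne dZ dP Da(1) P(1) subspace_dim_equal by (metis order_refl)
          qed
          then have none: "{x \<in> Y - Z. adj x Z = P (\<sigma> ` {..<c a})} = {}" by blast
          have "g \<sigma> = 0" unfolding g_def using ne by (intro if_not_P) blast
          then show ?thesis unfolding count none by simp
        qed
      qed
      let ?\<tau> = "transpose (c a - 1) (c a)"
      have \<tau>: "?\<tau> permutes {..<r}" using c_le[OF a] by (intro permutes_swap_id) auto
      have g: "g (\<sigma> \<circ> ?\<tau>) = g \<sigma>" for \<sigma>
      proof -
        have im: "?\<tau> ` {..<n} = {..<n}" if "n \<noteq> c a" for n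
        proof (cases "n < c a")
          case True
          then have "?\<tau> ` {..<n} = (\<lambda>x. x) ` {..<n}"
            by (intro image_cong) (auto simp: transpose_def)
          then show ?thesis by simp
        next
          case False
          then show ?thesis using that by (intro permutes_image permutes_swap_id) auto
        qed
        have "off (\<sigma> \<circ> ?\<tau>) = off \<sigma>"
        proof -
          have "c b \<noteq> c a" if "b \<in> nodes m - {a}" for b using c_inj[OF a, of b] that ca by auto
          then show ?thesis unfolding off_def fits_def image_comp[symmetric] using im by auto
        qed
        then show ?thesis using im[of "c a - 1"] ca unfolding g_def image_comp[symmetric] by auto
      qed
      have "(\<Sum>\<sigma>\<in>G. of_int (sign \<sigma>) * g \<sigma>) = (\<Sum>\<sigma>\<in>G. of_int (sign (\<sigma> \<circ> ?\<tau>)) * g (\<sigma> \<circ> ?\<tau>))"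
        unfolding G_def by (rule sum_permutations_compose_right[OF \<tau>])
      also have "\<dots> = (\<Sum>\<sigma>\<in>G. - (of_int (sign \<sigma>) * g \<sigma>))"
      proof (intro sum.cong refl)
        fix \<sigma> assume "\<sigma> \<in> G"
        then have "permutation \<sigma>" "permutation ?\<tau>"
          using permutation_permutes \<tau> by (auto simp: G_def permutation_permutes)
        then have "sign (\<sigma> \<circ> ?\<tau>) = - sign \<sigma>"
          using ca by (simp add: sign_compose sign_swap_id)
        then show "of_int (sign (\<sigma> \<circ> ?\<tau>)) * g (\<sigma> \<circ> ?\<tau>) = - (of_int (sign \<sigma>) * g \<sigma>)"
          unfolding g by simp
      qed
      finally have "(\<Sum>\<sigma>\<in>G. of_int (sign \<sigma>) * g \<sigma>) = 0" by (simp add: sum_negf)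
      moreover have "(\<Sum>\<sigma>\<in>G. of_int (sign \<sigma>) * (\<Sum>x\<in>Y - Z. if off \<sigma> \<and> adj x Z = P (\<sigma> ` {..<c a})
        then 1 else 0)) =
          (\<Sum>\<sigma>\<in>G. of_int (sign \<sigma>) * g \<sigma>)"
        by (intro sum.cong refl) (simp only: inner)
      ultimately show ?thesis using swap by (simp add: Y_def Z_def)
    qed
  qed
  then show ?thesis unfolding c_def by blast
qed

text \<open>
  The weight \<open>d j\<^sub>m - C \<nu>\<close> has no negative coefficient; inequalities between natural numbers
  avoid subtraction.
\<close>

definition dominant :: "nat \<Rightarrow> nat \<Rightarrow> (node \<Rightarrow> nat) \<Rightarrow> bool" where
  "dominant m d \<nu> \<longleftrightarrow> 2 * \<nu> Node_i \<le> \<nu> (Node_j 1) \<and> 2 * \<nu> Node_k \<le> \<nu> (Node_j 1) \<and>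
     2 * \<nu> (Node_j 1) \<le> (if m = 1 then d else \<nu> (Node_j 2)) + \<nu> Node_i + \<nu> Node_k \<and>
     (\<forall>\<beta>. 2 \<le> \<beta> \<and> \<beta> \<le> m \<longrightarrow>
        2 * \<nu> (Node_j \<beta>) \<le> (if \<beta> = m then d else \<nu> (Node_j (\<beta> + 1))) + \<nu> (Node_j (\<beta> - 1)))"

lemma singular_cong:
  assumes "singular m A B \<nu> \<phi>" "\<And>a. a \<in> nodes m \<Longrightarrow> \<nu> a = \<nu>' a"
  shows "singular m A B \<nu>' \<phi>"
  using assms unfolding singular_def by simp

text \<open>
  Induction on \<open>d\<close>. If \<open>\<nu>\<^sub>i\<close> and \<open>\<nu>\<^sub>k\<close> are both positive, a plane is split off, which does not
  change the weight. Otherwise one of them is zero, and dominance says that the dimensions from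
  the other leg along the \<open>j\<^sub>\<beta>\<close> up to \<open>d\<close> form a convex sequence that starts from zero. Its
  increments are the parts of a partition of \<open>d\<close>, and the first column of the Young diagram,
  which lowers every nonzero part by one, is split off.
\<close>

theorem singular_exists:
  assumes m: "1 \<le> m" and "subspace A" "subspace B" "A \<subseteq> B" "dim B = dim A + d" "dominant m d \<nu>"
  shows "\<exists>\<phi>. singular m A B \<nu> \<phi>"
  using assms(2-)
proof (induction d arbitrary: B \<nu> rule: less_induct)
  case (less d)
  note A = less.prems(1) and B = less.prems(2) and AB = less.prems(3) and d = less.prems(4)
  define N where "N \<beta> = (if \<beta> = m + 1 then d else \<nu> (Node_j \<beta>))" for \<beta>
  have dom: "2 * \<nu> Node_i \<le> N 1" "2 * \<nu> Node_k \<le> N 1" "2 * N 1 \<le> N 2 + \<nu> Node_i + \<nu> Node_k"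
    "\<And>\<beta>. 2 \<le> \<beta> \<Longrightarrow> \<beta> \<le> m \<Longrightarrow> 2 * N \<beta> \<le> N (\<beta> + 1) + N (\<beta> - 1)"
    using less.prems(5) m unfolding dominant_def N_def by auto
  have mono: "N \<beta> \<le> N (\<beta> + 1)" if "1 \<le> \<beta>" "\<beta> \<le> m" for \<beta>
    using that
  proof (induction \<beta> rule: nat_induct_at_least)
    case base
    have "N (1 + 1) = N 2" by (rule arg_cong) simp
    then show ?case using dom(1-3) by linarith
  next
    case (Suc \<beta>)
    then show ?case using dom(4)[of "Suc \<beta>"] by simp
  qed
  \<comment> \<open>split off a factor with dimension vector \<open>\<mu>\<close> at the top of the interval\<close>
  have step: "\<exists>\<phi>. singular m A B \<nu> \<phi>"
    if n: "0 < n" "n \<le> d" and w: "\<And>a. a \<in> nodes m \<Longrightarrow> \<mu> a \<le> \<nu> a"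
      and dom': "dominant m (d - n) (\<lambda>a. \<nu> a - \<mu> a)"
      and base: "\<And>C. subspace C \<Longrightarrow> C \<subseteq> B \<Longrightarrow> dim B = dim C + n \<Longrightarrow> \<exists>\<phi>. singular m C B \<mu> \<phi>"
    for n \<mu>
  proof -
    obtain C where C: "subspace C" "A \<subseteq> C" "C \<subseteq> B" "dim C = dim A + (d - n)"
      using intermediate_exists[OF A B AB, of "d - n"] d by auto
    have "dim B = dim C + n" using C(4) d n by simp
    then obtain \<phi>2 where 2: "singular m C B \<mu> \<phi>2" using base C by blast
    obtain \<phi>1 where 1: "singular m A C (\<lambda>a. \<nu> a - \<mu> a) \<phi>1"
      using less.IH[OF _ A C(1,2,4) dom'] n by auto
    show ?thesis
      using singular_cong[OF singular_product[OF m A C(1) B C(2,3) 1 2]] w by fastforce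
  qed
  show ?case
  proof (cases "d = 0")
    case True
    then have N0: "N \<beta> = 0" if "\<beta> \<in> {1..m + 1}" for \<beta>
    proof -
      have "N \<beta> \<le> N (m + 1)" if "\<beta> \<le> m + 1" "1 \<le> \<beta>" for \<beta>
        using that
      proof (induction rule: inc_induct)
        case (step n)
        then show ?case using mono[of n] by simp
      qed simp
      then show ?thesis using that True by (force simp: N_def)
    qed
    have \<nu>0: "\<nu> a = 0" if a: "a \<in> nodes m" for a
    proof (cases a)
      case (Node_j \<beta>)
      then show ?thesis using N0[of \<beta>] a by (auto simp: N_def)
    qed (use dom(1,2) N0[of 1] in auto)
    have eq: "A = B" using d True AB A B by (intro subspace_dim_equal) auto
    have triv: "U a = A \<and> upper m B U a = A" if U: "U \<in> chains m A B" and a: "a \<in> nodes m" for U a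
      using chainsD[OF U a] chains_subset[OF U m a] upper_subset[OF U m a] eq by blast
    have "(\<lambda>_. A) \<in> chains m A B" unfolding chains_def
    proof (intro CollectI ballI)
      fix a show "subspace A \<and> A \<subseteq> A \<and> A \<subseteq> upper m B (\<lambda>_. A) a" using A eq by (cases a) auto
    qed
    then have "singular m A B \<nu> (\<lambda>_. 1)"
      unfolding singular_def using triv \<nu>0 by auto
    then show ?thesis by blast
  next
    case d0: False
    show ?thesis
    proof (cases "1 \<le> \<nu> Node_i \<and> 1 \<le> \<nu> Node_k")
      case True
      have N2: "2 \<le> N \<beta>" if "1 \<le> \<beta>" "\<beta> \<le> m + 1" for \<beta>
        using that
      proof (induction \<beta> rule: nat_induct_at_least)
        case base
        then show ?case using True dom(1) by simp
      next
        case (Suc \<beta>)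
        then show ?case using mono[of \<beta>] by simp
      qed
      have \<nu>2: "2 \<le> \<nu> (Node_j \<beta>)" if "1 \<le> \<beta>" "\<beta> \<le> m" for \<beta> using N2[of \<beta>] that by (simp add: N_def)
      have d2: "2 \<le> d" using N2[of "m + 1"] by (simp add: N_def)
      show ?thesis
      proof (rule step[of 2 plane_dims])
        show "dominant m (d - 2) (\<lambda>a. \<nu> a - plane_dims a)"
          using less.prems(5) True \<nu>2 d2 m unfolding dominant_def
        proof (intro conjI allI impI)
          fix \<beta> assume \<beta>: "2 \<le> \<beta> \<and> \<beta> \<le> m"
          then have "2 * \<nu> (Node_j \<beta>) \<le> (if \<beta> = m then d else \<nu> (Node_j (\<beta> + 1))) + \<nu> (Node_j (\<beta> -
            1))"
            using less.prems(5) unfolding dominant_def by blast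
          moreover have "2 \<le> \<nu> (Node_j (\<beta> - 1))" using \<beta> by (intro \<nu>2) auto
          moreover have "2 \<le> (if \<beta> = m then d else \<nu> (Node_j (\<beta> + 1)))" using \<beta> d2 \<nu>2[of "\<beta> + 1"]
            by auto
          ultimately show "2 * (\<nu> (Node_j \<beta>) - plane_dims (Node_j \<beta>)) \<le>
              (if \<beta> = m then d - 2 else \<nu> (Node_j (\<beta> + 1)) - plane_dims (Node_j (\<beta> + 1))) +
              (\<nu> (Node_j (\<beta> - 1)) - plane_dims (Node_j (\<beta> - 1)))" by (auto split: if_splits)
        next
          have "2 * \<nu> (Node_j 1) \<le> (if m = 1 then d else \<nu> (Node_j 2)) + \<nu> Node_i + \<nu> Node_k"
            using less.prems(5) unfolding dominant_def by blast
          moreover have "2 \<le> (if m = 1 then d else \<nu> (Node_j 2))" using d2 \<nu>2[of 2] m by auto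
          ultimately show "2 * (\<nu> (Node_j 1) - plane_dims (Node_j 1)) \<le>
              (if m = 1 then d - 2 else \<nu> (Node_j 2) - plane_dims (Node_j 2)) +
              (\<nu> Node_i - plane_dims Node_i) + (\<nu> Node_k - plane_dims Node_k)"
            using True by (auto split: if_splits)
        qed auto
        show "plane_dims a \<le> \<nu> a" if "a \<in> nodes m" for a using that True \<nu>2 by (cases a) auto
        show "\<exists>\<phi>. singular m C B plane_dims \<phi>" if "subspace C" "C \<subseteq> B" "dim B = dim C + 2" for C
          using singular_plane[OF m that(1) B that(2,3)] .
      qed (use d2 in auto)
    next
      case False
      define z where "z = (if \<nu> Node_i = 0 then Node_i else Node_k)"
      define z' where "z' = (if \<nu> Node_i = 0 then Node_k else Node_i)"
      have z: "z = Node_i \<and> z' = Node_k \<or> z = Node_k \<and> z' = Node_i" "\<nu> z = 0"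
        using False by (auto simp: z_def z'_def)
      \<comment> \<open>the dimensions along the chain through the leg \<open>z'\<close>, and \<open>t\<close> the first nonzero
        position\<close>
      define M where "M \<beta> = (if \<beta> = 0 then \<nu> z' else N \<beta>)" for \<beta>
      have M0: "2 * M 0 \<le> M 1" using z dom(1,2) by (auto simp: M_def)
      have Mc: "2 * M \<beta> \<le> M (\<beta> + 1) + M (\<beta> - 1)" if "1 \<le> \<beta>" "\<beta> \<le> m" for \<beta>
        using dom(3) dom(4)[of \<beta>] that z by (cases "\<beta> = 1") (auto simp: M_def numeral_2_eq_2)
      have Mm: "M (m + 1) = d" by (simp add: M_def N_def)
      define t where "t = (LEAST t. 0 < M t)"
      have t: "0 < M t" unfolding t_def by (rule LeastI[of _ "m + 1"]) (use Mm d0 in simp)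
      have tm: "t \<le> m + 1" unfolding t_def by (rule Least_le) (use Mm d0 in simp)
      have below: "M \<beta> = 0" if "\<beta> < t" for \<beta> using not_less_Least[OF that[unfolded t_def]] by simp
      have incr: "M \<beta> + 1 \<le> M (\<beta> + 1) \<and> \<beta> + 1 - t \<le> M \<beta>" if "t \<le> \<beta>" "\<beta> \<le> m" for \<beta>
        using that
      proof (induction \<beta> rule: dec_induct)
        case base
        then show ?case
        proof (cases "t = 0")
          case True
          then show ?thesis using M0 t by simp
        next
          case False
          then show ?thesis using Mc[of t] below[of "t - 1"] t base by simp
        qed
      next
        case (step \<beta>)
        then have "M \<beta> + 1 \<le> M (Suc \<beta>)" "\<beta> + 1 - t \<le> M \<beta>" by auto
        moreover have "2 * M (Suc \<beta>) \<le> M (Suc \<beta> + 1) + M \<beta>" using Mc[of "Suc \<beta>"] step by simp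
        ultimately show ?case using step(1) by simp
      qed
      have le: "\<beta> + 1 - t \<le> M \<beta>" if "\<beta> \<le> m + 1" for \<beta>
      proof (cases "\<beta> \<le> t")
        case True
        then show ?thesis using t by (cases "\<beta> = t") auto
      next
        case False
        then obtain \<gamma> where \<gamma>: "\<beta> = Suc \<gamma>" by (cases \<beta>) auto
        then have "Suc \<gamma> - t \<le> M \<gamma>" "M \<gamma> + 1 \<le> M (Suc \<gamma>)" using incr[of \<gamma>] False that by auto
        then show ?thesis unfolding \<gamma> by linarith
      qed
      define M' where "M' \<beta> = M \<beta> - (\<beta> + 1 - t)" for \<beta>
      have M'c: "2 * M' \<beta> \<le> M' (\<beta> + 1) + M' (\<beta> - 1)" if \<beta>: "1 \<le> \<beta>" "\<beta> \<le> m" for \<beta>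
      proof -
        have l: "\<beta> + 1 - t \<le> M \<beta>" "\<beta> + 1 + 1 - t \<le> M (\<beta> + 1)" "\<beta> - 1 + 1 - t \<le> M (\<beta> - 1)"
          using le[of \<beta>] le[of "\<beta> + 1"] le[of "\<beta> - 1"] \<beta> by auto
        consider "t \<le> \<beta>" | "t = \<beta> + 1" | "\<beta> + 1 < t" by linarith
        then show ?thesis
        proof cases
          case 1
          then obtain k where "\<beta> = t + k" using le_Suc_ex by blast
          then have k: "\<beta> + 1 - t = k + 1" "\<beta> + 1 + 1 - t = k + 2" "\<beta> - 1 + 1 - t = k"
            using \<beta> by auto
          show ?thesis using Mc[OF \<beta>] l unfolding M'_def k by linarith
        next
          case 2
          then show ?thesis using below[of \<beta>] by (simp add: M'_def)
        next
          case 3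
          then show ?thesis using below[of \<beta>] by (simp add: M'_def)
        qed
      qed
      have M'0: "2 * M' 0 \<le> M' 1"
      proof (cases "t = 0")
        case True
        then show ?thesis using M0 le[of 0] le[of 1] m by (simp add: M'_def)
      next
        case False
        then show ?thesis using below[of 0] by (simp add: M'_def)
      qed
      have dM: "d - (m + 2 - t) = M' (m + 1)" using Mm by (simp add: M'_def)
      define \<mu> where "\<mu> = column_dims z t"
      have j: "\<nu> (Node_j \<beta>) - \<mu> (Node_j \<beta>) = M' \<beta>" if "1 \<le> \<beta>" "\<beta> \<le> m" for \<beta>
        using that by (simp add: M'_def M_def N_def \<mu>_def)
      have j': "(if \<beta> = m then d - (m + 2 - t) else \<nu> (Node_j (\<beta> + 1)) - \<mu> (Node_j (\<beta> + 1))) = M'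
        (\<beta> + 1)"
        if "1 \<le> \<beta>" "\<beta> \<le> m" for \<beta> using that dM j[of "\<beta> + 1"] by auto
      have zz: "\<nu> z - \<mu> z = 0" "\<nu> z' - \<mu> z' = M' 0" using z by (auto simp: \<mu>_def M'_def M_def)
      show ?thesis
      proof (rule step[of "m + 2 - t" \<mu>])
        show "m + 2 - t \<le> d" using le[of "m + 1"] Mm by simp
        show "\<mu> a \<le> \<nu> a" if a: "a \<in> nodes m" for a
        proof (cases a)
          case (Node_j \<beta>)
          then show ?thesis using le[of \<beta>] a by (auto simp: \<mu>_def M_def N_def)
        next
          case Node_i
          then show ?thesis using le[of 0] z by (auto simp: \<mu>_def M_def)
        next
          case Node_k
          then show ?thesis using le[of 0] z by (auto simp: \<mu>_def M_def)
        qed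
        show "dominant m (d - (m + 2 - t)) (\<lambda>a. \<nu> a - \<mu> a)"
          unfolding dominant_def
        proof (intro conjI allI impI)
          show "2 * (\<nu> Node_i - \<mu> Node_i) \<le> \<nu> (Node_j 1) - \<mu> (Node_j 1)"
            using z(1) zz M'0 j[of 1] m by auto
          show "2 * (\<nu> Node_k - \<mu> Node_k) \<le> \<nu> (Node_j 1) - \<mu> (Node_j 1)"
            using z(1) zz M'0 j[of 1] m by auto
          have "\<nu> Node_i - \<mu> Node_i + (\<nu> Node_k - \<mu> Node_k) = M' 0" using z(1) zz by auto
          moreover have "(if m = 1 then d - (m + 2 - t) else \<nu> (Node_j 2) - \<mu> (Node_j 2)) = M' 2"
            using j'[of 1, unfolded one_add_one] m by auto
          ultimately show "2 * (\<nu> (Node_j 1) - \<mu> (Node_j 1)) \<le>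
              (if m = 1 then d - (m + 2 - t) else \<nu> (Node_j 2) - \<mu> (Node_j 2)) +
              (\<nu> Node_i - \<mu> Node_i) + (\<nu> Node_k - \<mu> Node_k)"
            using M'c[of 1, unfolded one_add_one] j[of 1] m by simp
        next
          fix \<beta> assume \<beta>: "2 \<le> \<beta> \<and> \<beta> \<le> m"
          then have b: "1 \<le> \<beta> - 1" "\<beta> - 1 \<le> m" "1 \<le> \<beta>" "\<beta> \<le> m" by auto
          show "2 * (\<nu> (Node_j \<beta>) - \<mu> (Node_j \<beta>)) \<le>
              (if \<beta> = m then d - (m + 2 - t) else \<nu> (Node_j (\<beta> + 1)) - \<mu> (Node_j (\<beta> + 1))) +
              (\<nu> (Node_j (\<beta> - 1)) - \<mu> (Node_j (\<beta> - 1)))"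
            unfolding j[OF b(3,4)] j[OF b(1,2)] j'[OF b(3,4)] by (rule M'c[OF b(3,4)])
        qed
        show "\<exists>\<phi>. singular m C B \<mu> \<phi>" if "subspace C" "C \<subseteq> B" "dim B = dim C + (m + 2 - t)" for C
          unfolding \<mu>_def using z tm by (intro singular_column[OF m that(1) B that(2) _ tm
            that(3)]) auto
      qed (use tm in auto)
    qed
  qed
qed

end

section \<open>Highest weight vectors among the functions on flags\<close>

lemma sum_nodes:
  "(\<Sum>a\<in>nodes m. f a) = f Node_i + f Node_k + (\<Sum>\<beta>=1..m. (f (Node_j \<beta>) :: int))"
proof -
  have "(\<Sum>a\<in>nodes m. f a) = (\<Sum>a\<in>{Node_i, Node_k}. f a) + (\<Sum>a\<in>Node_j ` {1..m}. f a)"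
    unfolding nodes_def by (rule sum.union_disjoint) auto
  then show ?thesis by (simp add: sum.reindex inj_on_def)
qed

lemma cartan_sym: "cartan m a b = cartan m b a"
  by (auto simp: cartan_def)

lemma cartan_sum_i:
  fixes n :: "node \<Rightarrow> int"
  assumes "1 \<le> m" "a = Node_i \<or> a = Node_k"
  shows "(\<Sum>b\<in>nodes m. cartan m a b * n b) = 2 * n a - n (Node_j 1)"
proof -
  have "(\<Sum>\<beta>=1..m. cartan m a (Node_j \<beta>) * n (Node_j \<beta>)) = (\<Sum>\<beta>=1..m. if \<beta> = 1 then - n (Node_j 1)
    else 0)"
    using assms(2) by (intro sum.cong) (auto simp: cartan_ik)
  then have "(\<Sum>\<beta>=1..m. cartan m a (Node_j \<beta>) * n (Node_j \<beta>)) = - n (Node_j 1)"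
    using assms(1) by simp
  then show ?thesis using assms(2) unfolding sum_nodes by (auto simp: cartan_ik)
qed

lemma cartan_sum_j:
  fixes n :: "node \<Rightarrow> int"
  assumes "1 \<le> \<beta>" "\<beta> \<le> m"
  shows "(\<Sum>b\<in>nodes m. cartan m (Node_j \<beta>) b * n b) = 2 * n (Node_j \<beta>)
    - (if \<beta> = 1 then n Node_i + n Node_k else n (Node_j (\<beta> - 1)))
    - (if \<beta> = m then 0 else n (Node_j (\<beta> + 1)))"
proof -
  have "(\<Sum>\<gamma>=1..m. cartan m (Node_j \<beta>) (Node_j \<gamma>) * n (Node_j \<gamma>)) =
      (\<Sum>\<gamma>=1..m. n (Node_j \<gamma>) * cartan m (Node_j \<gamma>) (Node_j \<beta>))"
    by (simp add: cartan_sym[of m "Node_j \<beta>"] mult.commute)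
  also have "\<dots> = 2 * n (Node_j \<beta>) - (if \<beta> = 1 then 0 else n (Node_j (\<beta> - 1)))
      - (if \<beta> = m then 0 else n (Node_j (\<beta> + 1)))"
    using assms by (intro sum_cartan_j) simp
  finally show ?thesis unfolding sum_nodes by (auto simp: cartan_ik)
qed

lemma upper_mono: "(\<And>b. U b \<subseteq> U' b) \<Longrightarrow> upper m B U a \<subseteq> upper m B U' a"
  by (cases a) auto

context finite_vector_space
begin

definition raised_sdim :: "'v flag \<Rightarrow> node \<Rightarrow> slot \<Rightarrow> int" where
  "raised_sdim f a t = sdim s f t + (if t = SU a then 1 else 0)"

text \<open>
  The coefficient in \<open>E\<^sub>a\<close> of enlarging a \<open>U\<close>-space, as a function of the dimensions of the
  larger flag.
\<close>

fun E_coeff :: "complex \<Rightarrow> node \<Rightarrow> (slot \<Rightarrow> int) \<Rightarrow> complex" where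
  "E_coeff v (Node_j \<beta>) e =
    (if \<beta> = 1 then v powi (- (e (SU (Node_j 2)) + 2 * e (SV 1) - e (SU (Node_j 1))))
     else v powi (- (e (SU (Node_j (\<beta> + 1))) + 2 * e (SV \<beta>) - e (SU (Node_j \<beta>)) - e (SV (\<beta> - 1)))))"
| "E_coeff v a e = v powi (- (e (SU (Node_j 1)) - e (SU a)))"

lemma sdim_step: "step s t f g \<Longrightarrow> sdim s g u = sdim s f u + (if u = t then 1 else 0)"
  by (auto simp: step_def sdim_def)

lemma E_val_step_SU:
  assumes "\<And>\<beta>. a = Node_j \<beta> \<Longrightarrow> \<not> step s (SV \<beta>) f g"
  shows "E_val s v a f g = (if step s (SU a) f g then E_coeff v a (raised_sdim f a) else 0)"
proof (cases "step s (SU a) f g")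
  case True
  have e: "sdim s g = raised_sdim f a" using sdim_step[OF True] by (auto simp: raised_sdim_def)
  show ?thesis using True assms by (cases a) (simp_all add: e Let_def)
next
  case False
  then show ?thesis using assms by (cases a) (simp_all add: Let_def)
qed

lemma flags_subspace: "f \<in> flags s m \<Longrightarrow> subspace (f t)"
  by (simp add: flags_def)

text \<open>
  A flag has infinitely many positions, but outside of finitely many its spaces are prescribed.
\<close>

lemma finite_flags: "finite (flags s m)"
proof -
  define T where "T = SU ` nodes m \<union> SV ` {1..m}"
  define r where "r f t = (if t \<in> T then f t else {})" for f :: "'v flag" and t
  have "finite T" by (simp add: T_def nodes_def)
  then have "finite {f :: 'v flag. \<forall>t. (t \<in> T \<longrightarrow> f t \<in> UNIV) \<and> (t \<notin> T \<longrightarrow> f t = {})}"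
    by (rule finite_set_of_finite_funs) simp
  then have "finite (r ` flags s m)" by (rule rev_finite_subset) (auto simp: r_def)
  moreover have "inj_on r (flags s m)"
  proof (rule inj_onI)
    fix f g assume f: "f \<in> flags s m" and g: "g \<in> flags s m" and eq: "r f = r g"
    show "f = g"
    proof
      fix t
      show "f t = g t"
      proof (cases "t \<in> T")
        case True
        then show ?thesis using fun_cong[OF eq, of t] by (simp add: r_def)
      next
        case False
        have T: "SU a \<in> T \<longleftrightarrow> a \<in> nodes m" "SV \<beta> \<in> T \<longleftrightarrow> \<beta> \<in> {1..m}" for a \<beta>
          by (auto simp: T_def)
        show ?thesis
        proof (cases t)
          case (SU a)
          with False T have "a \<notin> nodes m" by simp
          then obtain \<beta> where "a = Node_j \<beta>" "\<beta> \<notin> {1..m}" by (cases a) auto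
          then show ?thesis using SU f g by (simp add: flags_def)
        next
          case (SV \<beta>)
          with False T have "\<beta> \<notin> {1..m}" by simp
          then show ?thesis using SV f g by (simp add: flags_def)
        qed
      qed
    qed
  qed
  ultimately show ?thesis by (rule finite_imageD)
qed

lemma flags_chain:
  assumes "f \<in> flags s m" shows "(\<lambda>a. f (SU a)) \<in> chains m {0} UNIV"
  unfolding chains_def
proof (intro CollectI ballI)
  fix a assume "a \<in> nodes m"
  then show "subspace (f (SU a)) \<and> {0} \<subseteq> f (SU a) \<and> f (SU a) \<subseteq> upper m UNIV (\<lambda>a. f (SU a)) a"
    using assms subspace_0 by (cases a) (auto simp: flags_def)
qed

definition flag_of_chain :: "nat \<Rightarrow> (node \<Rightarrow> 'v set) \<Rightarrow> 'v flag" where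
  "flag_of_chain m U t = (case t of SU a \<Rightarrow> if a \<in> nodes m then U a else UNIV | SV \<beta> \<Rightarrow> {0})"

lemma flag_of_chain:
  assumes U: "U \<in> chains m {0} UNIV" and m: "1 \<le> m"
  shows "flag_of_chain m U \<in> flags s m"
proof -
  note D = chainsD[OF U]
  have "subspace (flag_of_chain m U t)" for t
    using D(1) by (cases t) (auto simp: flag_of_chain_def)
  moreover have "U (Node_j \<beta>) \<subseteq> U (Node_j (\<beta> + 1))" if "1 \<le> \<beta>" "\<beta> < m" for \<beta>
    using D(3)[of "Node_j \<beta>"] that by simp
  ultimately show ?thesis
    using D(2)[of Node_i] D(2)[of Node_k] D(3)[of Node_i] D(3)[of Node_k] m
    by (auto simp: flags_def flag_of_chain_def)
qed

lemma flags_upd: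
  assumes f: "f \<in> flags s m" and m: "1 \<le> m" and a: "a \<in> nodes m"
    and W: "subspace W" "f (SU a) \<subseteq> W" "W \<subseteq> upper m UNIV (\<lambda>a. f (SU a)) a"
  shows "f(SU a := W) \<in> flags s m"
proof -
  have sub: "subspace (f t)" for t using flags_subspace[OF f] .
  have off: "f (SU (Node_j \<beta>)) = UNIV \<and> f (SV \<beta>) = {0}" if "\<beta> \<notin> {1..m}" for \<beta>
    using f that by (simp add: flags_def)
  have V: "f (SV (\<beta> + 1)) \<subseteq> f (SV \<beta>)" if "1 \<le> \<beta>" "\<beta> < m" for \<beta>
    using f that by (simp add: flags_def)
  have I: "f (SV 1) \<subseteq> f (SU Node_i)" "f (SV 1) \<subseteq> f (SU Node_k)"
    using f by (simp_all add: flags_def)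
  let ?h = "f(SU a := W)"
  have grow: "f t \<subseteq> ?h t" for t using W(2) by simp
  have U: "?h (SU b) \<subseteq> upper m UNIV (\<lambda>b. ?h (SU b)) b" if b: "b \<in> nodes m" for b
  proof (cases "b = a")
    case True
    have "upper m UNIV (\<lambda>a. f (SU a)) a \<subseteq> upper m UNIV (\<lambda>b. ?h (SU b)) a"
      using grow by (intro upper_mono)
    then show ?thesis using True W(3) by auto
  next
    case False
    have "f (SU b) \<subseteq> upper m UNIV (\<lambda>a. f (SU a)) b" using chainsD(3)[OF flags_chain[OF f] b] .
    also have "\<dots> \<subseteq> upper m UNIV (\<lambda>b. ?h (SU b)) b" using grow by (intro upper_mono)
    finally show ?thesis using False by simp
  qed
  have "subspace (?h t)" for t using sub W(1) by simp
  moreover have "?h (SU (Node_j \<beta>)) = UNIV \<and> ?h (SV \<beta>) = {0}" if "\<beta> \<notin> {1..m}" for \<beta>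
    using off[OF that] a that by auto
  moreover have "?h (SU (Node_j \<beta>)) \<subseteq> ?h (SU (Node_j (\<beta> + 1)))" if "1 \<le> \<beta>" "\<beta> < m" for \<beta>
  proof -
    have m: "Node_j \<beta> \<in> nodes m" "\<beta> \<noteq> m" using that by auto
    then show ?thesis using U[OF m(1)] unfolding upper.simps by (simp only: if_False)
  qed
  moreover have "?h (SV (\<beta> + 1)) \<subseteq> ?h (SV \<beta>)" if "1 \<le> \<beta>" "\<beta> < m" for \<beta>
    using V[OF that] by simp
  moreover have "?h (SV 1) \<subseteq> ?h (SU b)" if "b = Node_i \<or> b = Node_k" for b
    using I(1,2) grow[of "SU b"] that by auto
  moreover have "?h (SU b) \<subseteq> ?h (SU (Node_j 1))" if "b = Node_i \<or> b = Node_k" for b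
    using U[of b] that by auto
  ultimately show ?thesis unfolding flags_def by (intro CollectI conjI allI impI) simp_all
qed

lemma flag_steps:
  assumes f: "f \<in> flags s m" and m: "1 \<le> m" and a: "a \<in> nodes m"
  defines "Z \<equiv> f (SU a)" and "Y \<equiv> upper m UNIV (\<lambda>a. f (SU a)) a"
  shows "bij_betw (\<lambda>W. f(SU a := W)) ((\<lambda>x. adj x Z) ` (Y - Z)) {g \<in> flags s m. step s (SU a) f g}"
proof (rule bij_betw_byWitness[where f' = "\<lambda>g. g (SU a)"])
  note c = flags_chain[OF f]
  have Z: "subspace Z" using flags_subspace[OF f] by (simp add: Z_def)
  have Y: "subspace Y" "Z \<subseteq> Y"
    using upper_subspace[OF c m a] chainsD(3)[OF c a] by (auto simp: Y_def Z_def)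
  show "\<forall>g\<in>{g \<in> flags s m. step s (SU a) f g}. f(SU a := g (SU a)) = g"
    by (auto simp: step_def fun_eq_iff)
  show "(\<lambda>W. f(SU a := W)) ` (\<lambda>x. adj x Z) ` (Y - Z) \<subseteq> {g \<in> flags s m. step s (SU a) f g}"
  proof clarify
    fix x assume x: "x \<in> Y" "x \<notin> Z"
    have "f(SU a := adj x Z) \<in> flags s m"
      using subset_adj adj_subset[OF Y x(1)] by (intro flags_upd[OF f m a]) (auto simp: Z_def Y_def)
    moreover have "step s (SU a) f (f(SU a := adj x Z))"
      using subset_adj[of Z x] self_adj[of x Z] x dim_adj[OF Z x(2)]
      by (auto simp: step_def sdim_def Z_def)
    ultimately show "f(SU a := adj x Z) \<in> flags s m \<and> step s (SU a) f (f(SU a := adj x Z))" ..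
  qed
  show "(\<lambda>g. g (SU a)) ` {g \<in> flags s m. step s (SU a) f g} \<subseteq> (\<lambda>x. adj x Z) ` (Y - Z)"
  proof clarify
    fix g assume g: "g \<in> flags s m" "step s (SU a) f g"
    then obtain x where x: "x \<in> g (SU a)" "x \<notin> Z" by (auto simp: step_def Z_def)
    have "g (SU a) \<subseteq> upper m UNIV (\<lambda>a. g (SU a)) a" using chainsD(3)[OF flags_chain[OF g(1)] a] .
    also have "(\<lambda>a. g (SU a)) = (\<lambda>a. f (SU a))(a := g (SU a))" using g(2)
      by (auto simp: step_def fun_eq_iff)
    finally have gY: "g (SU a) \<subseteq> Y" unfolding upper_upd fun_upd_same Y_def .
    have "Z \<subseteq> g (SU a)" "dim (g (SU a)) = dim Z + 1" using g(2)
      by (auto simp: step_def sdim_def Z_def)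
    then have "adj x Z = g (SU a)" using x flags_subspace[OF g(1)] Z by (intro adj_eq) auto
    then show "g (SU a) \<in> (\<lambda>x. adj x Z) ` (Y - Z)" using x gY by blast
  qed
qed simp

definition extend_by_zero :: "nat \<Rightarrow> ((node \<Rightarrow> 'v set) \<Rightarrow> complex) \<Rightarrow> 'v flag \<Rightarrow> complex" where
  "extend_by_zero m \<phi> f = (if \<forall>\<beta>\<in>{1..m}. f (SV \<beta>) = {0} then \<phi> (\<lambda>a. f (SU a)) else 0)"

text \<open>
  On the support the \<open>V\<close>-spaces vanish, so no contribution comes from enlarging a \<open>V\<close>-space.
  When a \<open>U\<close>-space is enlarged, the dimensions of the larger flag, and with them the
  coefficient, depend on \<open>f\<close> alone.
\<close>

lemma E_extend_by_zero:
  assumes m: "1 \<le> m" and \<phi>: "singular m {0} UNIV \<nu> \<phi>" and f: "f \<in> flags s m" and a: "a \<in> nodes m"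
  shows "(\<Sum>g\<in>flags s m. E_val s v a f g * extend_by_zero m \<phi> g) = 0"
proof -
  let ?\<phi> = "extend_by_zero m \<phi>"
  let ?c = "E_coeff v a (raised_sdim f a)"
  define Z where "Z = f (SU a)"
  define Y where "Y = upper m UNIV (\<lambda>a. f (SU a)) a"
  note c = flags_chain[OF f]
  have Z: "subspace Z" using flags_subspace[OF f] by (simp add: Z_def)
  have Y: "subspace Y" "Z \<subseteq> Y"
    using upper_subspace[OF c m a] chainsD(3)[OF c a] by (auto simp: Y_def Z_def)
  have summand: "E_val s v a f g * ?\<phi> g =
      (if step s (SU a) f g then ?c * ?\<phi> g else 0)" if g: "g \<in> flags s m" for g
  proof (cases "?\<phi> g = 0")
    case False
    then have g0: "\<forall>\<beta>\<in>{1..m}. g (SV \<beta>) = {0}" by (auto simp: extend_by_zero_def split: if_splits)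
    have "\<not> step s (SV \<beta>) f g" if "a = Node_j \<beta>" for \<beta>
    proof
      assume "step s (SV \<beta>) f g"
      then have "f (SV \<beta>) \<subset> {0}" using g0 that a by (auto simp: step_def)
      then show False using subspace_0[OF flags_subspace[OF f]] by blast
    qed
    from E_val_step_SU[OF this] show ?thesis by simp
  qed simp
  have "(\<Sum>g\<in>{g \<in> flags s m. step s (SU a) f g}. ?\<phi> g) = 0"
  proof (cases "\<forall>\<beta>\<in>{1..m}. f (SV \<beta>) = {0}")
    case True
    have "(\<Sum>g\<in>{g \<in> flags s m. step s (SU a) f g}. ?\<phi> g) =
        (\<Sum>W\<in>(\<lambda>x. adj x Z) ` (Y - Z). ?\<phi> (f(SU a := W)))"
      unfolding Z_def Y_def by (rule sum.reindex_bij_betw[OF flag_steps[OF f m a], symmetric])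
    also have "\<dots> = (\<Sum>W\<in>(\<lambda>x. adj x Z) ` (Y - Z). \<phi> ((\<lambda>b. f (SU b))(a := W)))"
    proof (intro sum.cong refl)
      fix W
      have "(\<lambda>b. (f(SU a := W)) (SU b)) = (\<lambda>b. f (SU b))(a := W)" by auto
      then show "?\<phi> (f(SU a := W)) = \<phi> ((\<lambda>b. f (SU b))(a := W))"
        using True by (simp add: extend_by_zero_def)
    qed
    finally have eq: "(\<Sum>g\<in>{g \<in> flags s m. step s (SU a) f g}. ?\<phi> g) =
        (\<Sum>W\<in>(\<lambda>x. adj x Z) ` (Y - Z). \<phi> ((\<lambda>b. f (SU b))(a := W)))" .
    have "(\<Sum>x\<in>Y - Z. \<phi> ((\<lambda>b. f (SU b))(a := adj x Z))) = 0"
      using singular_sum[OF \<phi> c a] unfolding Y_def Z_def .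
    then have "of_nat ((CARD('k) - 1) * card Z) *
        (\<Sum>W\<in>(\<lambda>x. adj x Z) ` (Y - Z). \<phi> ((\<lambda>b. f (SU b))(a := W))) = 0"
      using sum_adj[OF Y Z, of "\<lambda>W. \<phi> ((\<lambda>b. f (SU b))(a := W))"] by simp
    moreover have "(CARD('k) - 1) * card Z \<noteq> 0" using card_subspace_pos[OF Z] card_field_gt_1
      by simp
    ultimately show ?thesis unfolding eq by (metis mult_eq_0_iff of_nat_eq_0_iff)
  next
    case False
    then have "?\<phi> g = 0" if "step s (SU a) f g" for g
      using that by (auto simp: step_def extend_by_zero_def)
    then show ?thesis by (intro sum.neutral) auto
  qed
  then have "(\<Sum>g\<in>{g \<in> flags s m. step s (SU a) f g}. ?c * ?\<phi> g) = 0"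
    by (simp add: sum_distrib_left[symmetric])
  then have "(\<Sum>g\<in>flags s m. if step s (SU a) f g then ?c * ?\<phi> g else 0) = 0"
    by (simp add: sum.inter_filter[OF finite_flags])
  moreover have "(\<Sum>g\<in>flags s m. E_val s v a f g * ?\<phi> g) =
      (\<Sum>g\<in>flags s m. if step s (SU a) f g then ?c * ?\<phi> g else 0)"
    by (intro sum.cong refl summand)
  ultimately show ?thesis by simp
qed

text \<open>
  The weight \<open>w = d j\<^sub>m - C \<nu>\<close> is dominant, so there is a singular function of dimension vector
  \<open>\<nu>\<close>; when the \<open>V\<close>-spaces are zero, \<open>kappa\<close> computes exactly the coefficients of \<open>d j\<^sub>m - C \<nu>\<close>.
\<close>

theorem highest_weight_vector_exists:
  assumes m: "1 \<le> m" and d: "dim (UNIV :: 'v set) = d" and w: "w \<in> weights m d"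
  obtains \<phi> where "\<exists>f\<in>flags s m. \<phi> f \<noteq> 0"
    and "\<And>a f. a \<in> nodes m \<Longrightarrow> f \<in> flags s m \<Longrightarrow> (\<Sum>g\<in>flags s m. E_val s v a f g * \<phi> g) = 0"
    and "\<And>a f. a \<in> nodes m \<Longrightarrow> f \<in> flags s m \<Longrightarrow> \<phi> f \<noteq> 0 \<Longrightarrow> kappa s a f = int (w a)"
proof -
  obtain \<nu> :: "node \<Rightarrow> nat" where \<nu>: "\<And>a. a \<in> nodes m \<Longrightarrow> int (w a) =
      (if a = Node_j m then int d else 0) - (\<Sum>b\<in>nodes m. cartan m a b * int (\<nu> b))"
    using w by (auto simp: weights_def)
  have wi: "int (w a) = int (\<nu> (Node_j 1)) - 2 * int (\<nu> a)" if "a = Node_i \<or> a = Node_k" for a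
    using \<nu>[of a] cartan_sum_i[OF m that] that by auto
  have wj: "int (w (Node_j \<beta>)) = (if \<beta> = m then int d else int (\<nu> (Node_j (\<beta> + 1))))
      + (if \<beta> = 1 then int (\<nu> Node_i) + int (\<nu> Node_k) else int (\<nu> (Node_j (\<beta> - 1))))
      - 2 * int (\<nu> (Node_j \<beta>))" if "1 \<le> \<beta>" "\<beta> \<le> m" for \<beta>
    using \<nu>[of "Node_j \<beta>"] cartan_sum_j[OF that, of "\<lambda>a. int (\<nu> a)"] that by (auto split: if_splits)
  have "dominant m d \<nu>"
    unfolding dominant_def
  proof (intro conjI allI impI)
    show "2 * \<nu> Node_i \<le> \<nu> (Node_j 1)" "2 * \<nu> Node_k \<le> \<nu> (Node_j 1)"
      using wi[of Node_i] wi[of Node_k] by simp_all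
    show "2 * \<nu> (Node_j 1) \<le> (if m = 1 then d else \<nu> (Node_j 2)) + \<nu> Node_i + \<nu> Node_k"
      using wj[of 1, unfolded one_add_one] m by (auto split: if_splits)
    fix \<beta> assume "2 \<le> \<beta> \<and> \<beta> \<le> m"
    then show "2 * \<nu> (Node_j \<beta>) \<le> (if \<beta> = m then d else \<nu> (Node_j (\<beta> + 1))) + \<nu> (Node_j (\<beta> - 1))"
      using wj[of \<beta>] by (auto split: if_splits)
  qed
  then obtain \<phi> where \<phi>: "singular m {0} UNIV \<nu> \<phi>"
    using singular_exists[OF m subspace_single_0 subspace_UNIV, of d \<nu>] d by auto
  show ?thesis
  proof (rule that[of "extend_by_zero m \<phi>"])
    obtain U where U: "U \<in> chains m {0} UNIV" "\<phi> U \<noteq> 0" using \<phi> by (auto simp: singular_def)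
    have "\<phi> (\<lambda>a. flag_of_chain m U (SU a)) = \<phi> U"
      by (rule singular_local[OF \<phi>]) (simp add: flag_of_chain_def)
    then have "extend_by_zero m \<phi> (flag_of_chain m U) \<noteq> 0"
      using U(2) by (simp add: extend_by_zero_def) (simp add: flag_of_chain_def)
    then show "\<exists>f\<in>flags s m. extend_by_zero m \<phi> f \<noteq> 0" using flag_of_chain[OF U(1) m] by blast
  next
    fix a f assume "a \<in> nodes m" "f \<in> flags s m"
    then show "(\<Sum>g\<in>flags s m. E_val s v a f g * extend_by_zero m \<phi> g) = 0"
      by (intro E_extend_by_zero[OF m \<phi>])
  next
    fix a f assume a: "a \<in> nodes m" and f: "f \<in> flags s m" and nz: "extend_by_zero m \<phi> f \<noteq> 0"
    then have "\<forall>\<beta>\<in>{1..m}. f (SV \<beta>) = {0}" and nz': "\<phi> (\<lambda>a. f (SU a)) \<noteq> 0"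
      by (auto simp: extend_by_zero_def split: if_splits)
    then have "f (SV \<beta>) = {0}" for \<beta> using f by (cases "\<beta> \<in> {1..m}") (auto simp: flags_def)
    then have V: "sdim s f (SV \<beta>) = 0" for \<beta> by (simp add: sdim_def)
    have S: "sdim s f (SU b) = int (\<nu> b)" if "b \<in> nodes m" for b
      using singular_dim[OF \<phi> flags_chain[OF f] nz' that] by (simp add: sdim_def)
    have top: "sdim s f (SU (Node_j \<beta>)) = int d" if "m < \<beta>" for \<beta>
      using f that d by (simp add: sdim_def flags_def)
    have N: "sdim s f (SU (Node_j (\<beta> + 1))) = (if \<beta> = m then int d else int (\<nu> (Node_j (\<beta> + 1))))"
      if "1 \<le> \<beta>" "\<beta> \<le> m" for \<beta> using that S top by auto
    show "kappa s a f = int (w a)"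
    proof (cases a)
      case (Node_j \<beta>)
      then have \<beta>: "1 \<le> \<beta>" "\<beta> \<le> m" using a by auto
      show ?thesis
      proof (cases "\<beta> = 1")
        case True
        then show ?thesis
          using wj[of 1, unfolded one_add_one] N[of 1, unfolded one_add_one] S Node_j \<beta> V
          by (simp add: Let_def)
      next
        case False
        then have "Node_j (\<beta> - 1) \<in> nodes m" using \<beta> by auto
        from S[OF this] False show ?thesis
          using wj[OF \<beta>] N[OF \<beta>] S[of "Node_j \<beta>"] Node_j \<beta> V by (simp add: Let_def)
      qed
    qed (use wi S m V in \<open>auto simp: Let_def\<close>)
  qed
qed

end

section \<open>Quotient algebras\<close>

text \<open>
  Whether a record is a ring depends only on the ring operations; this moves the ring structure
  of a quotient to the record that also has a scalar action.
\<close>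

lemma ring_cong:
  assumes "ring R" and S: "carrier S = carrier R" "monoid.mult S = monoid.mult R" "one S = one R"
    "zero S = zero R" "add S = add R"
  shows "ring S"
proof -
  interpret R: ring R by fact
  show ?thesis
  proof (intro ringI abelian_groupI monoidI)
    fix x assume "x \<in> carrier S"
    then show "\<exists>y\<in>carrier S. y \<oplus>\<^bsub>S\<^esub> x = \<zero>\<^bsub>S\<^esub>"
      unfolding S using R.l_neg R.a_inv_closed by blast
  qed (simp_all add: S R.a_assoc R.a_comm R.a_lcomm R.m_assoc R.l_distr R.r_distr)
qed

lemma quot_alg_simps:
  "carrier (quot_alg A I) = carrier (A Quot I)" "monoid.mult (quot_alg A I) = monoid.mult (A Quot
    I)"
  "one (quot_alg A I) = one (A Quot I)" "zero (quot_alg A I) = zero (A Quot I)"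
  "add (quot_alg A I) = add (A Quot I)"
  "smult (quot_alg A I) = (\<lambda>c X. \<Union>x\<in>X. I +>\<^bsub>A\<^esub> (c \<odot>\<^bsub>A\<^esub> x))"
  by (simp_all add: quot_alg_def ring.defs module.defs)

lemma quot_alg_zero: "zero (quot_alg A I) = I"
  by (simp add: quot_alg_simps FactRing_def)

lemma quot_alg_ring:
  assumes "ideal I A" shows "ring (quot_alg A I)"
  by (rule ring_cong[OF ideal.quotient_is_ring[OF assms]]) (simp_all add: quot_alg_simps)

lemma quot_alg_carrier: "carrier (quot_alg A I) = (\<lambda>x. I +>\<^bsub>A\<^esub> x) ` carrier A"
  by (auto simp: quot_alg_simps FactRing_def A_RCOSETS_def')

lemma quot_alg_hom:
  assumes "ideal I A" shows "(\<lambda>x. I +>\<^bsub>A\<^esub> x) \<in> ring_hom A (quot_alg A I)"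
  using ideal.rcos_ring_hom[OF assms] by (simp add: ring_hom_def quot_alg_simps)

lemma quot_alg_coset_zero_iff:
  assumes "ideal I A" "x \<in> carrier A"
  shows "I +>\<^bsub>A\<^esub> x = zero (quot_alg A I) \<longleftrightarrow> x \<in> I"
proof -
  interpret ideal I A by fact
  show ?thesis unfolding quot_alg_zero
    using a_rcos_const a_rcos_self[OF assms(2)] by auto
qed

text \<open>
  The union in the definition is over equal cosets, provided that scalars act as multiples of
  the unit.
\<close>

lemma quot_alg_smult:
  assumes I: "ideal I A" and x: "x \<in> carrier A" and k: "k \<in> carrier A"
    and c: "\<And>y. y \<in> carrier A \<Longrightarrow> c \<odot>\<^bsub>A\<^esub> y = k \<otimes>\<^bsub>A\<^esub> y"
  shows "c \<odot>\<^bsub>quot_alg A I\<^esub> (I +>\<^bsub>A\<^esub> x) = I +>\<^bsub>A\<^esub> (k \<otimes>\<^bsub>A\<^esub> x)"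
proof -
  interpret ideal I A by fact
  have "I +>\<^bsub>A\<^esub> (c \<odot>\<^bsub>A\<^esub> y) = I +>\<^bsub>A\<^esub> (k \<otimes>\<^bsub>A\<^esub> x)" if y: "y \<in> I +>\<^bsub>A\<^esub> x" for y
  proof -
    have yA: "y \<in> carrier A" using y a_r_coset_subset_G[OF a_subset x] by blast
    have "I +>\<^bsub>A\<^esub> y = I +>\<^bsub>A\<^esub> x" using a_repr_independence'[OF y x] by simp
    then show ?thesis
      using rcoset_mult_add[OF k yA] rcoset_mult_add[OF k x] c[OF yA] by simp
  qed
  moreover have "x \<in> I +>\<^bsub>A\<^esub> x" using a_rcos_self[OF x] .
  ultimately show ?thesis by (auto simp: quot_alg_simps)
qed

section \<open>The quantum algebra and the convolution algebra as rings\<close>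

lemma free_alg_ring: "ring (free_alg S)"
proof (intro ringI abelian_groupI monoidI)
  fix x assume "x \<in> carrier (free_alg S)"
  then show "\<exists>y\<in>carrier (free_alg S). y \<oplus>\<^bsub>free_alg S\<^esub> x = \<zero>\<^bsub>free_alg S\<^esub>"
    by (intro bexI[of _ "- x"]) (auto intro: free_alg_closed)
qed (auto intro: free_alg_closed simp: algebra_simps)

lemma Uq_ideal_ideal: "ideal (Uq_ideal m v) (free_alg (gens m))"
  unfolding Uq_ideal_def
  by (intro ring.genideal_ideal free_alg_ring) (auto intro: relators_in_free_alg)

lemma relators_Uq_ideal: "r \<in> relators m v \<Longrightarrow> r \<in> Uq_ideal m v"
  unfolding Uq_ideal_def
  using ring.genideal_self[OF free_alg_ring, of "relators m v" "gens m"] relators_in_free_alg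
    by blast

definition Uq_class :: "nat \<Rightarrow> complex \<Rightarrow> gen free_poly \<Rightarrow> gen free_poly set" where
  "Uq_class m v p = Uq_ideal m v +>\<^bsub>free_alg (gens m)\<^esub> p"

lemma Uq_ring: "ring (Uq m v)"
  unfolding Uq_def by (rule quot_alg_ring[OF Uq_ideal_ideal])

lemma Uq_carrier: "carrier (Uq m v) = Uq_class m v ` gen_polys m"
  unfolding Uq_def Uq_class_def[abs_def] by (rule quot_alg_carrier)

lemma Uq_class_hom: "Uq_class m v \<in> ring_hom (free_alg (gens m)) (Uq m v)"
  unfolding Uq_def Uq_class_def[abs_def] by (rule quot_alg_hom[OF Uq_ideal_ideal])

lemma Uq_class_closed: "p \<in> gen_polys m \<Longrightarrow> Uq_class m v p \<in> carrier (Uq m v)"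
  by (simp add: Uq_carrier)

lemma Uq_class_mult:
  "p \<in> gen_polys m \<Longrightarrow> q \<in> gen_polys m \<Longrightarrow>
    Uq_class m v (p * q) = Uq_class m v p \<otimes>\<^bsub>Uq m v\<^esub> Uq_class m v q"
  using ring_hom_mult[OF Uq_class_hom] by fastforce

lemma Uq_class_add:
  "p \<in> gen_polys m \<Longrightarrow> q \<in> gen_polys m \<Longrightarrow>
    Uq_class m v (p + q) = Uq_class m v p \<oplus>\<^bsub>Uq m v\<^esub> Uq_class m v q"
  using ring_hom_add[OF Uq_class_hom] by fastforce

lemma Uq_class_one: "Uq_class m v 1 = \<one>\<^bsub>Uq m v\<^esub>"
  using ring_hom_one[OF Uq_class_hom, of m v] by simp

lemma Uq_class_zero_iff:
  "p \<in> gen_polys m \<Longrightarrow> Uq_class m v p = \<zero>\<^bsub>Uq m v\<^esub> \<longleftrightarrow> p \<in> Uq_ideal m v"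
  unfolding Uq_def Uq_class_def by (rule quot_alg_coset_zero_iff[OF Uq_ideal_ideal])

lemma Uq_class_smult:
  assumes "p \<in> gen_polys m"
  shows "c \<odot>\<^bsub>Uq m v\<^esub> Uq_class m v p = Uq_class m v (const c * p)"
  unfolding Uq_def Uq_class_def
  using quot_alg_smult[OF Uq_ideal_ideal assms free_alg_const, of c c] by simp

lemma Uq_smult_const:
  assumes "y \<in> carrier (Uq m v)"
  shows "c \<odot>\<^bsub>Uq m v\<^esub> y = Uq_class m v (const c) \<otimes>\<^bsub>Uq m v\<^esub> y"
  using assms by (auto simp: Uq_carrier Uq_class_smult Uq_class_mult free_alg_const)

lemma conv_alg_simps [simp]:
  "monoid.mult (conv_alg X) = (\<lambda>h1 h2 f g. \<Sum>f'\<in>X. h1 f f' * h2 f' g)"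
  "one (conv_alg X) = (\<lambda>f g. if f = g \<and> f \<in> X then 1 else 0)"
  "zero (conv_alg X) = (\<lambda>f g. 0)" "add (conv_alg X) = (\<lambda>h1 h2 f g. h1 f g + h2 f g)"
  "smult (conv_alg X) = (\<lambda>c h f g. c * h f g)"
  by (simp_all add: conv_alg_def)

lemma conv_alg_carrier: "h \<in> carrier (conv_alg X) \<longleftrightarrow> (\<forall>f g. \<not> (f \<in> X \<and> g \<in> X) \<longrightarrow> h f g = 0)"
  by (simp add: conv_alg_def)

lemma conv_alg_ring:
  assumes X: "finite X" shows "ring (conv_alg X)"
proof (intro ringI abelian_groupI monoidI)
  fix x y z assume "x \<in> carrier (conv_alg X)" "y \<in> carrier (conv_alg X)" "z \<in> carrier (conv_alg X)"
  have "(\<Sum>k\<in>X. (\<Sum>l\<in>X. x f l * y l k) * z k g) = (\<Sum>l\<in>X. x f l * (\<Sum>k\<in>X. y l k * z k g))" for f g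
  proof -
    have "(\<Sum>k\<in>X. (\<Sum>l\<in>X. x f l * y l k) * z k g) = (\<Sum>k\<in>X. \<Sum>l\<in>X. x f l * y l k * z k g)"
      by (simp add: sum_distrib_right)
    also have "\<dots> = (\<Sum>l\<in>X. \<Sum>k\<in>X. x f l * y l k * z k g)" by (rule sum.swap)
    finally show ?thesis by (simp add: sum_distrib_left mult.assoc)
  qed
  then show "x \<otimes>\<^bsub>conv_alg X\<^esub> y \<otimes>\<^bsub>conv_alg X\<^esub> z = x \<otimes>\<^bsub>conv_alg X\<^esub> (y \<otimes>\<^bsub>conv_alg X\<^esub> z)" by simp
next
  fix x assume x: "x \<in> carrier (conv_alg X)"
  have l: "(\<Sum>k\<in>X. (if f = k \<and> f \<in> X then 1 else 0) * x k g) = x f g" for f g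
  proof -
    have "(\<Sum>k\<in>X. (if f = k \<and> f \<in> X then 1 else 0) * x k g) = (\<Sum>k\<in>X. if f = k then x f g else 0)"
      by (intro sum.cong) auto
    then show ?thesis using X x by (auto simp: conv_alg_carrier)
  qed
  then show "\<one>\<^bsub>conv_alg X\<^esub> \<otimes>\<^bsub>conv_alg X\<^esub> x = x" by simp
  have r: "(\<Sum>k\<in>X. x f k * (if k = g \<and> k \<in> X then 1 else 0)) = x f g" for f g
  proof -
    have "(\<Sum>k\<in>X. x f k * (if k = g \<and> k \<in> X then 1 else 0)) = (\<Sum>k\<in>X. if k = g then x f g else 0)"
      by (intro sum.cong) auto
    then show ?thesis using X x by (auto simp: conv_alg_carrier)
  qed
  then show "x \<otimes>\<^bsub>conv_alg X\<^esub> \<one>\<^bsub>conv_alg X\<^esub> = x" by simp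
  show "\<exists>y\<in>carrier (conv_alg X). y \<oplus>\<^bsub>conv_alg X\<^esub> x = \<zero>\<^bsub>conv_alg X\<^esub>"
    using x by (intro bexI[of _ "\<lambda>f g. - x f g"]) (auto simp: conv_alg_carrier)
qed (auto simp: conv_alg_carrier algebra_simps sum.distrib)

section \<open>Submodules and annihilators\<close>

context left_module
begin

lemma zero_smult: "x \<in> carrier M \<Longrightarrow> \<zero>\<^bsub>R\<^esub> \<odot>\<^bsub>M\<^esub> x = \<zero>\<^bsub>M\<^esub>"
  using smult_l_distr[of "\<zero>\<^bsub>R\<^esub>" "\<zero>\<^bsub>R\<^esub>" x] smult_closed[of "\<zero>\<^bsub>R\<^esub>" x] M.add.r_cancel_one[of "\<zero>\<^bsub>R\<^esub>
    \<odot>\<^bsub>M\<^esub> x"]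
  by simp

lemma smult_zero: "a \<in> carrier R \<Longrightarrow> a \<odot>\<^bsub>M\<^esub> \<zero>\<^bsub>M\<^esub> = \<zero>\<^bsub>M\<^esub>"
  using smult_r_distr[of a "\<zero>\<^bsub>M\<^esub>" "\<zero>\<^bsub>M\<^esub>"] smult_closed[of a "\<zero>\<^bsub>M\<^esub>"] M.add.r_cancel_one[of "a \<odot>\<^bsub>M\<^esub>
    \<zero>\<^bsub>M\<^esub>"]
  by simp

lemma minus_smult:
  assumes "a \<in> carrier R" "x \<in> carrier M"
  shows "(\<ominus>\<^bsub>R\<^esub> a) \<odot>\<^bsub>M\<^esub> x = \<ominus>\<^bsub>M\<^esub> (a \<odot>\<^bsub>M\<^esub> x)"
proof -
  have "(\<ominus>\<^bsub>R\<^esub> a) \<odot>\<^bsub>M\<^esub> x \<oplus>\<^bsub>M\<^esub> a \<odot>\<^bsub>M\<^esub> x = \<zero>\<^bsub>M\<^esub>"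
    using assms smult_l_distr[of "\<ominus>\<^bsub>R\<^esub> a" a x] by (simp add: R.l_neg zero_smult)
  then show ?thesis using assms M.minus_equality smult_closed by auto
qed

text \<open>
  Used twice below for \<open>J\<close> the whole ring and \<open>J\<close> the kernel of the action on flags.
\<close>

lemma submodule_orbit:
  assumes x: "x \<in> carrier M" and J: "subgroup J (add_monoid R)"
    and left: "\<And>a b. a \<in> carrier R \<Longrightarrow> b \<in> J \<Longrightarrow> a \<otimes>\<^bsub>R\<^esub> b \<in> J"
  shows "submodule ((\<lambda>a. a \<odot>\<^bsub>M\<^esub> x) ` J) R M" (is "submodule ?N _ _")
proof -
  have JR: "a \<in> carrier R" if "a \<in> J" for a using subgroup.mem_carrier[OF J that] by simp
  show ?thesis
  proof (intro submodule.intro submodule_axioms.intro M.add.subgroupI)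
    show "?N \<subseteq> carrier M" using JR x smult_closed by auto
    show "?N \<noteq> {}" using subgroup.one_closed[OF J] by auto
  next
    fix y assume "y \<in> ?N"
    then obtain a where a: "a \<in> J" "y = a \<odot>\<^bsub>M\<^esub> x" by auto
    have "\<ominus>\<^bsub>R\<^esub> a \<in> J" using subgroup.m_inv_closed[OF J a(1)] by (simp add: a_inv_def)
    then show "\<ominus>\<^bsub>M\<^esub> y \<in> ?N"
      unfolding a(2) minus_smult[OF JR[OF a(1)] x, symmetric] by (rule imageI)
  next
    fix y z assume "y \<in> ?N" "z \<in> ?N"
    then obtain a b where ab: "a \<in> J" "y = a \<odot>\<^bsub>M\<^esub> x" "b \<in> J" "z = b \<odot>\<^bsub>M\<^esub> x" by auto
    have "y \<oplus>\<^bsub>M\<^esub> z = (a \<oplus>\<^bsub>R\<^esub> b) \<odot>\<^bsub>M\<^esub> x"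
      unfolding ab(2,4) by (rule smult_l_distr[OF JR JR x, symmetric]) (use ab in auto)
    moreover have "a \<oplus>\<^bsub>R\<^esub> b \<in> J" using subgroup.m_closed[OF J ab(1,3)] by simp
    ultimately show "y \<oplus>\<^bsub>M\<^esub> z \<in> ?N" by blast
  next
    fix a y assume a: "a \<in> carrier R" and "y \<in> ?N"
    then obtain b where b: "b \<in> J" "y = b \<odot>\<^bsub>M\<^esub> x" by auto
    have "a \<odot>\<^bsub>M\<^esub> y = (a \<otimes>\<^bsub>R\<^esub> b) \<odot>\<^bsub>M\<^esub> x"
      unfolding b(2) by (rule smult_assoc[OF a JR[OF b(1)] x, symmetric])
    then show "a \<odot>\<^bsub>M\<^esub> y \<in> ?N" using left[OF a b(1)] by blast
  qed
qed

end

lemma annihilator_ideal: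
  assumes L: "\<And>w. w \<in> weights m d \<Longrightarrow> left_module (Uq m v) (L w)"
  shows "ideal (annihilator m v d L) (Uq m v)"
    (is "ideal ?N _")
proof (rule idealI[OF Uq_ring])
  interpret U: ring "Uq m v" by (rule Uq_ring)
  show "subgroup ?N (add_monoid (Uq m v))"
  proof (intro U.add.subgroupI)
    show "?N \<subseteq> carrier (Uq m v)" by (auto simp: annihilator_def)
    have "\<zero>\<^bsub>Uq m v\<^esub> \<in> ?N"
      using left_module.zero_smult[OF L] by (auto simp: annihilator_def)
    then show "?N \<noteq> {}" by blast
  next
    fix a assume a: "a \<in> ?N"
    show "\<ominus>\<^bsub>Uq m v\<^esub> a \<in> ?N"
      unfolding annihilator_def
    proof (intro CollectI conjI ballI)
      show "\<ominus>\<^bsub>Uq m v\<^esub> a \<in> carrier (Uq m v)" using a by (simp add: annihilator_def)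
      fix w x assume w: "w \<in> weights m d" and x: "x \<in> carrier (L w)"
      interpret left_module "Uq m v" "L w" using L[OF w] .
      show "(\<ominus>\<^bsub>Uq m v\<^esub> a) \<odot>\<^bsub>L w\<^esub> x = \<zero>\<^bsub>L w\<^esub>"
        using a w x minus_smult by (auto simp: annihilator_def)
    qed
  next
    fix a b assume a: "a \<in> ?N" and b: "b \<in> ?N"
    show "a \<oplus>\<^bsub>Uq m v\<^esub> b \<in> ?N"
      unfolding annihilator_def
    proof (intro CollectI conjI ballI)
      show "a \<oplus>\<^bsub>Uq m v\<^esub> b \<in> carrier (Uq m v)" using a b by (simp add: annihilator_def)
      fix w x assume w: "w \<in> weights m d" and x: "x \<in> carrier (L w)"
      interpret left_module "Uq m v" "L w" using L[OF w] .
      show "(a \<oplus>\<^bsub>Uq m v\<^esub> b) \<odot>\<^bsub>L w\<^esub> x = \<zero>\<^bsub>L w\<^esub>"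
        using a b w x smult_l_distr[of a b x] by (simp add: annihilator_def)
    qed
  qed
next
  fix a u assume a: "a \<in> ?N" and u: "u \<in> carrier (Uq m v)"
  interpret U: ring "Uq m v" by (rule Uq_ring)
  have aU: "a \<in> carrier (Uq m v)" using a by (simp add: annihilator_def)
  have "u \<otimes>\<^bsub>Uq m v\<^esub> a \<odot>\<^bsub>L w\<^esub> x = \<zero>\<^bsub>L w\<^esub> \<and> a \<otimes>\<^bsub>Uq m v\<^esub> u \<odot>\<^bsub>L w\<^esub> x = \<zero>\<^bsub>L w\<^esub>"
    if w: "w \<in> weights m d" and x: "x \<in> carrier (L w)" for w x
  proof -
    interpret left_module "Uq m v" "L w" using L[OF w] .
    show ?thesis
      using smult_assoc[OF u aU x] smult_assoc[OF aU u x] a w x smult_closed[OF u x] smult_zero[OF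
        u]
      by (simp add: annihilator_def)
  qed
  then show "u \<otimes>\<^bsub>Uq m v\<^esub> a \<in> ?N" "a \<otimes>\<^bsub>Uq m v\<^esub> u \<in> ?N"
    using aU u by (auto simp: annihilator_def)
qed

section \<open>The kernel of the action on flags\<close>

text \<open>
  The action of the free algebra on functions on flags that factors through the quantum algebra.
  It arises by composing \<open>\<Psi>\<close> with the two quotient maps.
\<close>

locale flag_representation = finite_vector_space s
  for s :: "'k::{field,finite} \<Rightarrow> 'v::{ab_group_add,finite} \<Rightarrow> 'v" +
  fixes m :: nat and v :: complex and \<rho> :: "gen free_poly \<Rightarrow> 'v flag \<Rightarrow> 'v flag \<Rightarrow> complex"
  assumes m: "1 \<le> m" and v: "\<And>i j :: int. v powi i = v powi j \<Longrightarrow> i = j"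
    and \<rho>_closed: "p \<in> gen_polys m \<Longrightarrow> \<rho> p \<in> carrier (conv_alg (flags s m))"
    and \<rho>_mult: "p \<in> gen_polys m \<Longrightarrow> q \<in> gen_polys m \<Longrightarrow>
      \<rho> (p * q) f g = (\<Sum>h\<in>flags s m. \<rho> p f h * \<rho> q h g)"
    and \<rho>_diff: "p \<in> gen_polys m \<Longrightarrow> q \<in> gen_polys m \<Longrightarrow>
      \<rho> (p - q) f g = \<rho> p f g - \<rho> q f g"
    and \<rho>_const: "\<rho> (const c) f g = (if f = g \<and> f \<in> flags s m then c else 0)"
    and \<rho>_var: "x \<in> gens m \<Longrightarrow> \<rho> (var x) = gen_fun s m v x"
    and \<rho>_ideal: "p \<in> Uq_ideal m v \<Longrightarrow> \<rho> p f g = 0"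
begin

lemma v_nonzero: "v \<noteq> 0"
  using v[of 1 2] by auto

definition action :: "gen free_poly \<Rightarrow> ('v flag \<Rightarrow> complex) \<Rightarrow> 'v flag \<Rightarrow> complex" where
  "action p \<phi> f = (\<Sum>g\<in>flags s m. \<rho> p f g * \<phi> g)"

lemma action_mult:
  assumes "p \<in> gen_polys m" "q \<in> gen_polys m"
  shows "action (p * q) \<phi> f = action p (action q \<phi>) f"
proof -
  have "action (p * q) \<phi> f = (\<Sum>g\<in>flags s m. \<Sum>h\<in>flags s m. \<rho> p f h * \<rho> q h g * \<phi> g)"
    by (simp add: action_def \<rho>_mult[OF assms] sum_distrib_right)
  also have "\<dots> = (\<Sum>h\<in>flags s m. \<Sum>g\<in>flags s m. \<rho> p f h * \<rho> q h g * \<phi> g)" by (rule sum.swap)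
  finally show ?thesis by (simp add: action_def sum_distrib_left mult.assoc)
qed

lemma action_diff:
  assumes "p \<in> gen_polys m" "q \<in> gen_polys m"
  shows "action (p - q) \<phi> f = action p \<phi> f - action q \<phi> f"
  by (simp add: action_def \<rho>_diff[OF assms] left_diff_distrib sum_subtractf)

lemma sum_diagonal:
  "(\<Sum>g\<in>flags s m. (if f = g \<and> f \<in> flags s m then c else 0) * \<phi> g) =
    (if f \<in> flags s m then c * \<phi> f else (0 :: complex))"
proof -
  have "(\<Sum>g\<in>flags s m. (if f = g \<and> f \<in> flags s m then c else 0) * \<phi> g) =
      (\<Sum>g\<in>flags s m. if f = g then c * \<phi> f else 0)"
    by (intro sum.cong) auto
  then show ?thesis by (simp add: finite_flags)
qed

lemma action_const: "action (const c) \<phi> f = (if f \<in> flags s m then c * \<phi> f else 0)"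
  unfolding action_def \<rho>_const by (rule sum_diagonal)

lemma highest_weight_ideal_action:
  assumes E0: "\<And>a f. a \<in> nodes m \<Longrightarrow> f \<in> flags s m \<Longrightarrow> (\<Sum>g\<in>flags s m. E_val s v a f g * \<phi> g) = 0"
    and K0: "\<And>a f. a \<in> nodes m \<Longrightarrow> f \<in> flags s m \<Longrightarrow> \<phi> f \<noteq> 0 \<Longrightarrow> kappa s a f = int (w a)"
  shows "highest_weight_ideal m v w {p \<in> gen_polys m. \<forall>f. action p \<phi> f = 0}"
    (is "highest_weight_ideal m v w ?\<Lambda>")
proof
  fix x y assume "x \<in> ?\<Lambda>"
    "y \<in> ?\<Lambda>"
  then show "x - y \<in> ?\<Lambda>"
    by (simp add: free_alg_diff action_diff)
next
  fix p x assume "p \<in> gen_polys m" "x \<in> ?\<Lambda>"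
  moreover from this have "action x \<phi> = (\<lambda>f. 0)" by auto
  moreover have "action p (\<lambda>f. 0) f = 0" for p f by (simp add: action_def)
  ultimately show "p * x \<in> ?\<Lambda>"
    by (simp add: free_alg_mult action_mult)
next
  fix r p assume r: "r \<in> relators m v" and p: "p \<in> gen_polys m"
  have "r * p \<in> Uq_ideal m v"
    using ideal.I_r_closed[OF Uq_ideal_ideal relators_Uq_ideal[OF r], of p] p by simp
  then show "r * p \<in> ?\<Lambda>"
    using free_alg_mult[OF relators_in_free_alg[OF r] p] by (simp add: action_def \<rho>_ideal)
next
  fix a assume a: "a \<in> nodes m"
  have "action (var (E a)) \<phi> f = 0" for f
  proof (cases "f \<in> flags s m")
    case True
    then have "action (var (E a)) \<phi> f = (\<Sum>g\<in>flags s m. E_val s v a f g * \<phi> g)"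
      unfolding action_def \<rho>_var[OF nodes_gens(1)[OF a]]
        by (intro sum.cong) (auto simp: gen_fun_def)
    then show ?thesis using E0[OF a True] by simp
  next
    case False
    then show ?thesis unfolding action_def \<rho>_var[OF nodes_gens(1)[OF a]] by (simp add: gen_fun_def)
  qed
  then show "var (E a) \<in> ?\<Lambda>"
    using free_alg_var[OF nodes_gens(1)[OF a]] by simp
  have "action (var (K a)) \<phi> f = action (const (v ^ w a)) \<phi> f" for f
  proof -
    have "action (var (K a)) \<phi> f =
        (\<Sum>g\<in>flags s m. (if f = g \<and> f \<in> flags s m then v powi kappa s a f else 0) * \<phi> g)"
      unfolding action_def \<rho>_var[OF nodes_gens(3)[OF a]]
        by (intro sum.cong) (auto simp: gen_fun_def)
    also have "\<dots> = (if f \<in> flags s m then v powi kappa s a f * \<phi> f else 0)" by (rule sum_diagonal)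
    also have "\<dots> = action (const (v ^ w a)) \<phi> f"
      unfolding action_const using K0[OF a, of f] by (cases "\<phi> f = 0") auto
    finally show ?thesis .
  qed
  then show "var (K a) - const (v ^ w a) \<in> ?\<Lambda>"
    using free_alg_var[OF nodes_gens(3)[OF a]]
      by (simp add: free_alg_diff free_alg_const action_diff)
qed (auto simp: v_nonzero)

lemma highest_weight_ideal_module:
  assumes "left_module (Uq m v) M" and \<xi>: "\<xi> \<in> carrier M"
    and E0: "\<And>a. a \<in> nodes m \<Longrightarrow> Uq_gen m v (E a) \<odot>\<^bsub>M\<^esub> \<xi> = \<zero>\<^bsub>M\<^esub>"
    and K0: "\<And>a. a \<in> nodes m \<Longrightarrow>
      Uq_gen m v (K a) \<odot>\<^bsub>M\<^esub> \<xi> = (v ^ w a \<odot>\<^bsub>Uq m v\<^esub> \<one>\<^bsub>Uq m v\<^esub>) \<odot>\<^bsub>M\<^esub> \<xi>"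
  shows "highest_weight_ideal m v w
    {p \<in> gen_polys m. Uq_class m v p \<odot>\<^bsub>M\<^esub> \<xi> = \<zero>\<^bsub>M\<^esub>}"
    (is "highest_weight_ideal m v w ?\<Lambda>")
proof -
  interpret left_module "Uq m v" M by fact
  have diff: "Uq_class m v (p - q) \<odot>\<^bsub>M\<^esub> \<xi> = \<zero>\<^bsub>M\<^esub>"
    if p: "p \<in> gen_polys m" and q: "q \<in> gen_polys m"
      and eq: "Uq_class m v p \<odot>\<^bsub>M\<^esub> \<xi> = Uq_class m v q \<odot>\<^bsub>M\<^esub> \<xi>" for p q
  proof -
    have "Uq_class m v p \<odot>\<^bsub>M\<^esub> \<xi> = Uq_class m v ((p - q) + q) \<odot>\<^bsub>M\<^esub> \<xi>" by simp
    also have "\<dots> = Uq_class m v (p - q) \<odot>\<^bsub>M\<^esub> \<xi> \<oplus>\<^bsub>M\<^esub> Uq_class m v q \<odot>\<^bsub>M\<^esub> \<xi>"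
      using p q \<xi> by (simp only: Uq_class_add free_alg_diff Uq_class_closed smult_l_distr)
    finally show ?thesis
      using p q \<xi> eq by (simp add: free_alg_diff Uq_class_closed smult_closed)
  qed
  show ?thesis
  proof
    fix x y assume "x \<in> ?\<Lambda>"
      "y \<in> ?\<Lambda>"
    then show "x - y \<in> ?\<Lambda>"
      by (simp add: free_alg_diff diff)
  next
    fix p x assume "p \<in> gen_polys m"
      "x \<in> ?\<Lambda>"
    then show "p * x \<in> ?\<Lambda>"
      using \<xi> by (simp add: free_alg_mult Uq_class_mult Uq_class_closed smult_assoc smult_zero)
  next
    fix r p assume r: "r \<in> relators m v" and p: "p \<in> gen_polys m"
    have rp: "r * p \<in> gen_polys m" using free_alg_mult[OF relators_in_free_alg[OF r] p] .
    have "r * p \<in> Uq_ideal m v"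
      using ideal.I_r_closed[OF Uq_ideal_ideal relators_Uq_ideal[OF r], of p] p by simp
    then have "Uq_class m v (r * p) = \<zero>\<^bsub>Uq m v\<^esub>" using Uq_class_zero_iff[OF rp] by blast
    then show "r * p \<in> ?\<Lambda>"
      using rp \<xi> by (simp add: zero_smult)
  next
    fix a assume a: "a \<in> nodes m"
    show "var (E a) \<in> ?\<Lambda>"
      using E0[OF a] free_alg_var[OF nodes_gens(1)[OF a]] by (simp add: Uq_gen_def Uq_class_def)
    have "v ^ w a \<odot>\<^bsub>Uq m v\<^esub> \<one>\<^bsub>Uq m v\<^esub> = Uq_class m v (const (v ^ w a))"
      using Uq_class_smult[OF free_alg_one, where c = "v ^ w a" and m = m and v = v]
        by (simp add: Uq_class_one)
    then have "Uq_class m v (var (K a)) \<odot>\<^bsub>M\<^esub> \<xi> = Uq_class m v (const (v ^ w a)) \<odot>\<^bsub>M\<^esub> \<xi>"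
      using K0[OF a] by (simp add: Uq_gen_def Uq_class_def)
    then show "var (K a) - const (v ^ w a) \<in>
        ?\<Lambda>"
      using free_alg_var[OF nodes_gens(3)[OF a]] by (simp add: free_alg_diff free_alg_const diff)
  qed (auto simp: v_nonzero)
qed

text \<open>
  The kernel of the action on flags moves \<open>\<xi>\<close> through a submodule of the simple module \<open>M\<close>. This
  cannot be all of \<open>M\<close>, since then an element of the kernel would fix \<open>\<xi>\<close> while killing a
  nonzero function on flags with the same highest weight. As the kernel is a two-sided ideal and
  \<open>\<xi>\<close> generates \<open>M\<close>, it kills all of \<open>M\<close>.
\<close>

theorem kernel_annihilates:
  assumes d: "dim (UNIV :: 'v set) = d" and w: "w \<in> weights m d"
    and M: "simple_highest_weight_module m v w M"
    and p: "p \<in> gen_polys m" "\<And>f g. \<rho> p f g = 0" and x: "x \<in> carrier M"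
  shows "Uq_class m v p \<odot>\<^bsub>M\<^esub> x = \<zero>\<^bsub>M\<^esub>"
proof -
  have simple: "simple_module (Uq m v) M" using M by (simp add: simple_highest_weight_module_def)
  then have lm: "left_module (Uq m v) M" by (simp add: simple_module_def)
  interpret left_module "Uq m v" M by (rule lm)
  obtain \<xi> where \<xi>: "\<xi> \<in> carrier M"
    and \<xi>1: "\<forall>N. submodule N (Uq m v) M \<and> \<xi> \<in> N \<longrightarrow> N = carrier M"
    and \<xi>2: "\<forall>a \<in> nodes m.
      Uq_gen m v (K a) \<odot>\<^bsub>M\<^esub> \<xi> = (v ^ w a \<odot>\<^bsub>Uq m v\<^esub> \<one>\<^bsub>Uq m v\<^esub>) \<odot>\<^bsub>M\<^esub> \<xi> \<and>
      Uq_gen m v (E a) \<odot>\<^bsub>M\<^esub> \<xi> = \<zero>\<^bsub>M\<^esub>"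
    using conjunct2[OF M[unfolded simple_highest_weight_module_def]] by (elim bexE conjE)
  have gen: "N = carrier M" if "submodule N (Uq m v) M" "\<xi> \<in> N" for N
    using \<xi>1 that by (elim allE impE) (rule conjI)
  have K0: "Uq_gen m v (K a) \<odot>\<^bsub>M\<^esub> \<xi> = (v ^ w a \<odot>\<^bsub>Uq m v\<^esub> \<one>\<^bsub>Uq m v\<^esub>) \<odot>\<^bsub>M\<^esub> \<xi>"
    if "a \<in> nodes m" for a using bspec[OF \<xi>2 that] by (rule conjunct1)
  have E0: "Uq_gen m v (E a) \<odot>\<^bsub>M\<^esub> \<xi> = \<zero>\<^bsub>M\<^esub>"
    if "a \<in> nodes m" for a using bspec[OF \<xi>2 that] by (rule conjunct2)
  obtain \<phi> where \<phi>0: "\<exists>f\<in>flags s m. \<phi> f \<noteq> 0"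
    and \<phi>E: "\<And>a f. a \<in> nodes m \<Longrightarrow> f \<in> flags s m \<Longrightarrow> (\<Sum>g\<in>flags s m. E_val s v a f g * \<phi> g) = 0"
    and \<phi>K: "\<And>a f. a \<in> nodes m \<Longrightarrow> f \<in> flags s m \<Longrightarrow> \<phi> f \<noteq> 0 \<Longrightarrow> kappa s a f = int (w a)"
    by (rule highest_weight_vector_exists[OF m d w, where v = v]) (rule that)
  define P where "P = gen_polys m"
  define ker where "ker = {q \<in> P. \<forall>f g. \<rho> q f g = 0}"
  define J where "J = Uq_class m v ` ker"
  have ker: "q - q' \<in> ker" if "q \<in> ker" "q' \<in> ker" for q q'
    using that by (auto simp: ker_def P_def free_alg_diff \<rho>_diff)
  have ker_l: "q * q' \<in> ker" if "q \<in> P" "q' \<in> ker" for q q'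
    using that by (auto simp: ker_def P_def free_alg_mult \<rho>_mult)
  have ker_r: "q' * q \<in> ker" if "q \<in> P" "q' \<in> ker" for q q'
    using that by (auto simp: ker_def P_def free_alg_mult \<rho>_mult)
  have ker_0: "0 \<in> ker" using ker[of p p] p by (simp add: ker_def P_def)
  have J_sub: "J \<subseteq> carrier (Uq m v)" by (auto simp: J_def ker_def P_def Uq_class_closed)
  have J: "subgroup J (add_monoid (Uq m v))"
  proof (intro R.add.subgroupI J_sub)
    show "J \<noteq> {}" using ker_0 by (auto simp: J_def)
  next
    fix a assume "a \<in> J"
    then obtain q where q: "q \<in> ker" "a = Uq_class m v q" by (auto simp: J_def)
    have qP: "q \<in> gen_polys m" using q by (simp add: ker_def P_def)
    have "Uq_class m v (0 - q) \<oplus>\<^bsub>Uq m v\<^esub> a = Uq_class m v ((0 - q) + q)"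
      unfolding q(2) by (rule Uq_class_add[symmetric]) (use qP in \<open>auto intro: free_alg_closed\<close>)
    also have "\<dots> = \<zero>\<^bsub>Uq m v\<^esub>"
      using Uq_class_zero_iff[OF free_alg_zero, of m v] ideal.axioms(1)[OF Uq_ideal_ideal, of m v]
        additive_subgroup.zero_closed[of "Uq_ideal m v" "free_alg (gens m)"] by simp
    finally have "\<ominus>\<^bsub>Uq m v\<^esub> a = Uq_class m v (0 - q)"
      by (rule R.minus_equality) (use q qP in \<open>auto intro!: Uq_class_closed free_alg_closed\<close>)
    then show "\<ominus>\<^bsub>Uq m v\<^esub> a \<in> J" using ker[OF ker_0 q(1)] by (simp only: J_def imageI)
  next
    fix a b assume "a \<in> J" "b \<in> J"
    then obtain q q' where q: "q \<in> ker" "a = Uq_class m v q" "q' \<in> ker" "b = Uq_class m v q'"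
      by (auto simp: J_def)
    have "q + q' \<in> ker" using ker[OF q(1) ker[OF ker_0 q(3)]] by simp
    moreover have "a \<oplus>\<^bsub>Uq m v\<^esub> b = Uq_class m v (q + q')"
      unfolding q(2,4) by (rule Uq_class_add[symmetric]) (use q in \<open>auto simp: ker_def P_def\<close>)
    ultimately show "a \<oplus>\<^bsub>Uq m v\<^esub> b \<in> J" by (simp only: J_def imageI)
  qed
  have J_left: "a \<otimes>\<^bsub>Uq m v\<^esub> b \<in> J" if "a \<in> carrier (Uq m v)" "b \<in> J" for a b
  proof -
    have "a \<in> Uq_class m v ` P" using that(1) unfolding Uq_carrier P_def .
    moreover have "b \<in> Uq_class m v ` ker" using that(2) unfolding J_def .
    ultimately obtain q q' where q: "q \<in> P" "a = Uq_class m v q" "q' \<in> ker" "b = Uq_class m v q'"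
      by blast
    have "a \<otimes>\<^bsub>Uq m v\<^esub> b = Uq_class m v (q * q')"
      unfolding q(2,4) by (rule Uq_class_mult[symmetric]) (use q in \<open>auto simp: ker_def P_def\<close>)
    then show ?thesis using ker_l[OF q(1,3)] by (simp only: J_def imageI)
  qed
  have full: "(\<lambda>a. a \<odot>\<^bsub>M\<^esub> \<xi>) ` carrier (Uq m v) = carrier M"
  proof (rule gen)
    show "submodule ((\<lambda>a. a \<odot>\<^bsub>M\<^esub> \<xi>) ` carrier (Uq m v)) (Uq m v) M"
      by (rule submodule_orbit[OF \<xi>]) (auto intro: R.add.subgroup_self)
    show "\<xi> \<in> (\<lambda>a. a \<odot>\<^bsub>M\<^esub> \<xi>) ` carrier (Uq m v)" using smult_one[OF \<xi>] by force
  qed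
  define \<Lambda>1 where "\<Lambda>1 = {p \<in> gen_polys m. Uq_class m v p \<odot>\<^bsub>M\<^esub> \<xi> = \<zero>\<^bsub>M\<^esub>}"
  define \<Lambda>2 where "\<Lambda>2 = {p \<in> gen_polys m. \<forall>f. action p \<phi> f = 0}"
  have L1: "highest_weight_ideal m v w \<Lambda>1"
    unfolding \<Lambda>1_def by (rule highest_weight_ideal_module[OF lm \<xi> E0 K0])
  have L2: "highest_weight_ideal m v w \<Lambda>2"
    unfolding \<Lambda>2_def by (rule highest_weight_ideal_action[OF \<phi>E \<phi>K])
  have "\<xi> \<noteq> \<zero>\<^bsub>M\<^esub>"
  proof
    assume "\<xi> = \<zero>\<^bsub>M\<^esub>"
    then have "carrier M = {\<zero>\<^bsub>M\<^esub>}" using full smult_zero R.zero_closed by (auto simp: image_def)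
    then show False using simple by (simp add: simple_module_def)
  qed
  then have 1: "1 \<notin> \<Lambda>1" using smult_one[OF \<xi>] by (simp add: \<Lambda>1_def Uq_class_one)
  have 2: "1 \<notin> \<Lambda>2" using \<phi>0 action_const[of 1 \<phi>] by (auto simp: \<Lambda>2_def)
  have orbit: "(\<lambda>a. a \<odot>\<^bsub>M\<^esub> \<xi>) ` J = {\<zero>\<^bsub>M\<^esub>}"
  proof (rule ccontr)
    assume "(\<lambda>a. a \<odot>\<^bsub>M\<^esub> \<xi>) ` J \<noteq> {\<zero>\<^bsub>M\<^esub>}"
    moreover have "submodule ((\<lambda>a. a \<odot>\<^bsub>M\<^esub> \<xi>) ` J) (Uq m v) M"
      by (rule submodule_orbit[OF \<xi> J J_left])
    ultimately have "(\<lambda>a. a \<odot>\<^bsub>M\<^esub> \<xi>) ` J = carrier M" using simple by (auto simp: simple_module_def)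
    then obtain q where q: "q \<in> ker" "Uq_class m v q \<odot>\<^bsub>M\<^esub> \<xi> = \<xi>"
      using \<xi> unfolding J_def by (metis (no_types, lifting) image_iff)
    have qP: "q \<in> gen_polys m" using q by (simp add: ker_def P_def)
    have "q \<in> \<Lambda>2" using q qP by (simp add: \<Lambda>2_def ker_def action_def)
    moreover have "1 - q \<in> \<Lambda>1"
    proof -
      have "\<xi> = Uq_class m v ((1 - q) + q) \<odot>\<^bsub>M\<^esub> \<xi>" using smult_one[OF \<xi>] by (simp add: Uq_class_one)
      also have "\<dots> = Uq_class m v (1 - q) \<odot>\<^bsub>M\<^esub> \<xi> \<oplus>\<^bsub>M\<^esub> \<xi>"
        using qP \<xi> q(2) by (simp only: Uq_class_add free_alg_diff free_alg_one Uq_class_closed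
          smult_l_distr)
      finally have "\<xi> = Uq_class m v (1 - q) \<odot>\<^bsub>M\<^esub> \<xi> \<oplus>\<^bsub>M\<^esub> \<xi>" .
      moreover have "Uq_class m v (1 - q) \<odot>\<^bsub>M\<^esub> \<xi> \<in> carrier M"
        using qP \<xi> by (intro smult_closed Uq_class_closed free_alg_closed)
      ultimately have "Uq_class m v (1 - q) \<odot>\<^bsub>M\<^esub> \<xi> = \<zero>\<^bsub>M\<^esub>" using \<xi> M.add.r_cancel_one' by metis
      then show ?thesis using qP by (simp add: \<Lambda>1_def free_alg_diff free_alg_one)
    qed
    ultimately show False using highest_weight_ideals_not_coprime[OF L1 L2 m v 1 2 qP] by blast
  qed
  obtain u where u: "u \<in> carrier (Uq m v)" "x = u \<odot>\<^bsub>M\<^esub> \<xi>" using full x by auto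
  then obtain q where q: "q \<in> P" "u = Uq_class m v q" by (auto simp: Uq_carrier P_def)
  have "p \<in> ker" using p by (simp add: ker_def P_def)
  then have "Uq_class m v (p * q) \<odot>\<^bsub>M\<^esub> \<xi> = \<zero>\<^bsub>M\<^esub>"
    using ker_r[OF q(1)] orbit unfolding J_def by blast
  moreover have "Uq_class m v p \<odot>\<^bsub>M\<^esub> x = Uq_class m v (p * q) \<odot>\<^bsub>M\<^esub> \<xi>"
    unfolding u(2) q(2) using q(1) p(1) \<xi>
    by (simp only: P_def Uq_class_mult smult_assoc Uq_class_closed)
  ultimately show ?thesis by simp
qed

end

lemma powi_of_real_inj:
  fixes c :: real
  assumes c: "1 < c" and eq: "complex_of_real c powi i = complex_of_real c powi j"
  shows "i = j"
proof -
  have "c powi i = c powi j" using eq by (simp flip: of_real_power_int)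
  then show ?thesis
    using power_int_strict_increasing[OF _ c, of i j] power_int_strict_increasing[OF _ c, of j i]
    by (cases i j rule: linorder_cases) auto
qed

theorem theorem1p5:
  fixes s :: "'k::{field,finite} \<Rightarrow> 'v::{ab_group_add,finite} \<Rightarrow> 'v"
    and m d :: nat
    and v :: complex
    and L :: "(node \<Rightarrow> nat) \<Rightarrow> (gen free_poly set, 'l) module"
    and \<Psi> :: "gen free_poly set set \<Rightarrow> 'v flag \<Rightarrow> 'v flag \<Rightarrow> complex"
  assumes "vector_space s"
    and "vector_space.dim s (UNIV :: 'v set) = d"
    and "1 \<le> m"
    and "v = complex_of_real (sqrt (real CARD('k)))"
    and "\<And>w. w \<in> weights m d \<Longrightarrow> simple_highest_weight_module m v w (L w)"
    and "\<Psi> \<in> alg_hom (quot_alg (Uq m v) (annihilator m v d L)) (flag_alg s m v)"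
    and "\<And>x. x \<in> gens m \<Longrightarrow>
      \<Psi> (annihilator m v d L +>\<^bsub>Uq m v\<^esub> Uq_gen m v x) = gen_fun s m v x"
  shows "\<Psi> \<in> alg_iso (quot_alg (Uq m v) (annihilator m v d L)) (flag_alg s m v)"
proof -
  interpret finite_vector_space s using assms(1) by (simp add: finite_vector_space_def)
  define N where "N = annihilator m v d L"
  define Q where "Q = quot_alg (Uq m v) N"
  define A where "A = conv_alg (flags s m)"
  have lm: "left_module (Uq m v) (L w)" if "w \<in> weights m d" for w
    using assms(5)[OF that] by (simp add: simple_highest_weight_module_def simple_module_def)
  have N: "ideal N (Uq m v)" unfolding N_def by (rule annihilator_ideal[OF lm])
  have Q: "ring Q" unfolding Q_def by (rule quot_alg_ring[OF N])
  have A: "ring A" unfolding A_def by (rule conv_alg_ring[OF finite_flags])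
  have carA: "carrier (flag_alg s m v) =
      \<Inter>{B. subring B A \<and> (\<forall>c. \<forall>x\<in>B. c \<odot>\<^bsub>A\<^esub> x \<in> B) \<and> gen_fun s m v ` gens m \<subseteq> B}"
    by (simp add: flag_alg_def generated_subalg_def A_def)
  have ops: "monoid.mult (flag_alg s m v) = monoid.mult A" "one (flag_alg s m v) = one A"
    "add (flag_alg s m v) = add A" "smult (flag_alg s m v) = smult A"
    by (simp_all add: flag_alg_def generated_subalg_def A_def)
  have sub: "carrier (flag_alg s m v) \<subseteq> carrier A"
  proof -
    have "subring (carrier A) A" by (rule ring.carrier_is_subring[OF A])
    moreover have "\<forall>c. \<forall>x\<in>carrier A. c \<odot>\<^bsub>A\<^esub> x \<in> carrier A" by (simp add: A_def conv_alg_carrier)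
    moreover have "gen_fun s m v ` gens m \<subseteq> carrier A"
      by (auto simp: A_def conv_alg_carrier gen_fun_def)
    ultimately show ?thesis unfolding carA by blast
  qed
  have hom: "\<Psi> \<in> alg_hom Q (flag_alg s m v)" using assms(6) by (simp add: Q_def N_def)
  have \<Psi>hom: "\<Psi> \<in> ring_hom Q A"
    using hom sub by (auto simp: alg_hom_def ring_hom_def ops Pi_iff)
  interpret \<Psi>: ring_hom_ring Q A \<Psi> by (rule ring_hom_ringI2[OF Q A \<Psi>hom])
  have \<Psi>smult: "\<Psi> (c \<odot>\<^bsub>Q\<^esub> X) = c \<odot>\<^bsub>A\<^esub> \<Psi> X" if "X \<in> carrier Q" for c X
    using hom that by (simp add: alg_hom_def ops)
  define cls where "cls p = N +>\<^bsub>Uq m v\<^esub> Uq_class m v p" for p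
  let ?P = "gen_polys m"
  have N_hom: "(\<lambda>u. N +>\<^bsub>Uq m v\<^esub> u) \<in> ring_hom (Uq m v) Q" unfolding Q_def
    by (rule quot_alg_hom[OF N])
  have carQ: "carrier Q = cls ` ?P"
    by (simp add: Q_def quot_alg_carrier Uq_carrier cls_def image_image)
  have cls_closed: "cls p \<in> carrier Q" if "p \<in> ?P" for p using that by (simp add: carQ)
  have cls_mult: "cls (p * q) = cls p \<otimes>\<^bsub>Q\<^esub> cls q" if "p \<in> ?P" "q \<in> ?P" for p q
    using that ring_hom_mult[OF N_hom] by (simp add: cls_def Uq_class_mult Uq_class_closed)
  have cls_add: "cls (p + q) = cls p \<oplus>\<^bsub>Q\<^esub> cls q" if "p \<in> ?P" "q \<in> ?P" for p q
    using that ring_hom_add[OF N_hom] by (simp add: cls_def Uq_class_add Uq_class_closed)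
  have cls_one: "cls 1 = \<one>\<^bsub>Q\<^esub>" using ring_hom_one[OF N_hom] by (simp add: cls_def Uq_class_one)
  have cls_smult: "c \<odot>\<^bsub>Q\<^esub> cls p = cls (const c * p)" if p: "p \<in> ?P" for c p
    unfolding cls_def Q_def Uq_class_mult[OF free_alg_const p]
    by (rule quot_alg_smult[OF N Uq_class_closed[OF p] Uq_class_closed[OF free_alg_const]
      Uq_smult_const])
  have cls_zero: "cls p = \<zero>\<^bsub>Q\<^esub> \<longleftrightarrow> Uq_class m v p \<in> N" if "p \<in> ?P" for p
    unfolding cls_def Q_def by (rule quot_alg_coset_zero_iff[OF N Uq_class_closed[OF that]])
  define \<rho> where "\<rho> p = \<Psi> (cls p)" for p
  have \<rho>add: "\<rho> (p + q) f g = \<rho> p f g + \<rho> q f g" if "p \<in> ?P" "q \<in> ?P" for p q f g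
    using that by (simp add: \<rho>_def cls_add cls_closed A_def)
  have q1: "1 < CARD('k)" by (rule card_field_gt_1)
  interpret flag_representation s m v \<rho>
  proof
    show "1 \<le> m" by fact
    fix i j :: int assume "v powi i = v powi j"
    then show "i = j" unfolding assms(4) using q1
      by (intro powi_of_real_inj[of "sqrt (real CARD('k))"]) auto
  next
    fix p assume p: "p \<in> ?P"
    show "\<rho> p \<in> carrier (conv_alg (flags s m))" using \<Psi>.hom_closed[OF cls_closed[OF p]]
      by (simp add: \<rho>_def A_def)
  next
    fix p q f g assume "p \<in> ?P" "q \<in> ?P"
    then show "\<rho> (p * q) f g = (\<Sum>h\<in>flags s m. \<rho> p f h * \<rho> q h g)"
      by (simp add: \<rho>_def cls_mult cls_closed A_def)
  next
    fix p q f g assume p: "p \<in> ?P" and q: "q \<in> ?P"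
    show "\<rho> (p - q) f g = \<rho> p f g - \<rho> q f g"
      using \<rho>add[OF free_alg_diff[OF p q] q, of f g] by simp
  next
    fix c f g
    have "\<rho> (const c) = c \<odot>\<^bsub>A\<^esub> \<one>\<^bsub>A\<^esub>"
      using \<Psi>smult[OF cls_closed[OF free_alg_one], of c] cls_smult[OF free_alg_one, of c]
      by (simp add: \<rho>_def cls_one)
    then show "\<rho> (const c) f g = (if f = g \<and> f \<in> flags s m then c else 0)" by (auto simp: A_def)
  next
    fix x assume "x \<in> gens m"
    then show "\<rho> (var x) = gen_fun s m v x"
      using assms(7) by (simp add: \<rho>_def cls_def N_def Uq_class_def Uq_gen_def)
  next
    fix p f g assume p: "p \<in> Uq_ideal m v"
    then have pP: "p \<in> ?P" using additive_subgroup.a_subset[OF ideal.axioms(1)[OF Uq_ideal_ideal]]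
      by blast
    have "Uq_class m v p \<in> N"
      using p Uq_class_zero_iff[OF pP, of v] additive_subgroup.zero_closed[OF ideal.axioms(1)[OF
        N]] by simp
    then have "\<rho> p = \<zero>\<^bsub>A\<^esub>" using cls_zero[OF pP] by (simp add: \<rho>_def)
    then show "\<rho> p f g = 0" by (simp add: A_def)
  qed
  have kernel: "X = \<zero>\<^bsub>Q\<^esub>" if X: "X \<in> carrier Q" "\<Psi> X = \<zero>\<^bsub>A\<^esub>" for X
  proof -
    obtain p where p: "p \<in> ?P" "X = cls p" using X by (auto simp: carQ)
    have \<rho>0: "\<rho> p f g = 0" for f g using X(2) p(2) by (simp add: \<rho>_def A_def)
    have "Uq_class m v p \<in> N"
      unfolding N_def annihilator_def
    proof (intro CollectI conjI ballI Uq_class_closed[OF p(1)])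
      fix w x assume w: "w \<in> weights m d" and x: "x \<in> carrier (L w)"
      show "Uq_class m v p \<odot>\<^bsub>L w\<^esub> x = \<zero>\<^bsub>L w\<^esub>"
        by (rule kernel_annihilates[OF assms(2) w assms(5)[OF w] p(1) \<rho>0 x])
    qed
    then show ?thesis unfolding p(2) by (rule iffD2[OF cls_zero[OF p(1)]])
  qed
  have "inj_on \<Psi> (carrier Q)"
  proof (rule \<Psi>.trivial_ker_imp_inj)
    show "a_kernel Q A \<Psi> = {\<zero>\<^bsub>Q\<^esub>}"
      unfolding a_kernel_def' using kernel \<Psi>.hom_zero \<Psi>.R.zero_closed by blast
  qed
  moreover have "\<Psi> ` carrier Q = carrier (flag_alg s m v)"
  proof
    show "\<Psi> ` carrier Q \<subseteq> carrier (flag_alg s m v)" using hom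
      by (auto simp: alg_hom_def ring_hom_def)
    have "subring (\<Psi> ` carrier Q) A" by (rule \<Psi>.img_is_subring[OF ring.carrier_is_subring[OF Q]])
    moreover have "c \<odot>\<^bsub>A\<^esub> x \<in> \<Psi> ` carrier Q" if x: "x \<in> \<Psi> ` carrier Q" for c x
    proof -
      obtain p where p: "p \<in> ?P" "x = \<Psi> (cls p)" using x by (auto simp: carQ)
      have "c \<odot>\<^bsub>A\<^esub> x = \<Psi> (cls (const c * p))"
        using \<Psi>smult[OF cls_closed[OF p(1)]] cls_smult[OF p(1)] p(2) by simp
      then show ?thesis using cls_closed[OF free_alg_mult[OF free_alg_const p(1)]] by blast
    qed
    moreover have "gen_fun s m v ` gens m \<subseteq> \<Psi> ` carrier Q"
    proof clarify
      fix x assume x: "x \<in> gens m"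
      have "gen_fun s m v x = \<Psi> (cls (var x))" using \<rho>_var[OF x] by (simp add: \<rho>_def)
      then show "gen_fun s m v x \<in> \<Psi> ` carrier Q" using cls_closed[OF free_alg_var[OF x]]
        by (rule image_eqI)
    qed
    ultimately show "carrier (flag_alg s m v) \<subseteq> \<Psi> ` carrier Q" unfolding carA by blast
  qed
  ultimately show ?thesis
    using hom by (simp add: alg_iso_def bij_betw_def Q_def N_def)
qed

end
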